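(* Let $m\ge0$ and $q\in\mathscr{H}_{\kappa,m}$. (i) For a smooth function $f$ on a neighbourhood of $0\in\mathbb{R}^d$ and every integer $N\ge0$, \[ \frac{1}{\omega_{\kappa,d}}\int_{S^{d-1}} q(y)f(ry)h_\kappa^2(y)\,d\sigma(y)=\sum_{n=0}^{N}\frac{(q(\mathscr{D})\Delta_\kappa^n f)(0)}{n!\,(\lambda_\kappa+1)_{m+n}}\Big(\frac r2\Big)^{m+2n}+o(r^{m+2N})\quad (r\to+0). \] (ii) If $f$ is real analytic on the open ball of radius $1$ centred at $0$, then there is $\rho\in(0,1)$ such that for all $0<r<\rho$ \[ \frac{1}{\omega_{\kappa,d}}\int_{S^{d-1}} q(y)f(ry)h_\kappa^2(y)\,d\sigma(y)=\sum_{n=0}^{\infty}\frac{(q(\mathscr{D})\Delta_\kappa^n f)(0)}{n!\,(\lambda_\kappa+1)_{m+n}}\Big(\frac r2\Big)^{m+2n}. \]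
   Context: Let $d\ge1$, $\langle\cdot,\cdot\rangle$ the standard inner product on $\mathbb{R}^d$, $\|x\|=\langle x,x\rangle^{1/2}$. Let $R\subset\mathbb{R}^d$ be a reduced root system (not necessarily crystallographic) with a fixed positive system $R_+$, $r_\alpha$ the reflection in $\alpha^\perp$, and $G$ the finite reflection group generated by the $r_\alpha$. Let $\kappa:R\to\mathbb{R}_{\ge0}$, $\alpha\mapsto\kappa_\alpha$, be $G$-invariant (a multiplicity function). Put $\lambda_\kappa=\frac d2-1+\sum_{\alpha\in R_+}\kappa_\alpha$. For $\xi\in\mathbb{R}^d\setminus\{0\}$ the Dunkl operator is $\mathscr{D}_\xi f(x)=\partial_\xi f(x)+\sum_{\alpha\in R_+}\kappa_\alpha\langle\alpha,\xi\rangle\frac{f(x)-f(r_\alpha x)}{\langle\alpha,x\rangle}$, where $\partial_\xi$ is the directional derivative; these operators commute. With $e_1,\dots,e_d$ the standard basis, $\mathscr{D}_j=\mathscr{D}_{e_j}$, $\mathscr{D}=(\mathscr{D}_1,\dots,\mathscr{D}_d)$, and $\Delta_\kappa=\sum_j\mathscr{D}_j^2$ (Dunkl Laplacian). For a polynomial $q$, $q(\mathscr{D})$ is obtained by substituting $\mathscr{D}_j$ for $x_j$. $\mathscr{P}$ denotes real polynomials on $\mathbb{R}^d$, $\mathscr{P}_m$ the homogeneous ones of degree $m$, $\mathscr{H}_{\kappa,m}=\{p\in\mathscr{P}_m:\Delta_\kappa p=0\}$. The weight is $h_\kappa(x)=\prod_{\alpha\in R_+}|\langle\alpha,x\rangle|^{\kappa_\alpha}$,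 $d\sigma$ is surface measure on the unit sphere $S^{d-1}$, and $\omega_{\kappa,d}=\int_{S^{d-1}}h_\kappa^2\,d\sigma$. $(a)_0=1$, $(a)_n=a(a+1)\cdots(a+n-1)$. *)

theory Defs
  imports "HOL-Analysis.Analysis" "HOL-Library.Landau_Symbols"
begin

definition refl :: "real^'n \<Rightarrow> real^'n \<Rightarrow> real^'n" where
  "refl \<alpha> x = x - (2 * inner \<alpha> x / inner \<alpha> \<alpha>) *\<^sub>R \<alpha>"

text \<open>Reduced root system (not necessarily crystallographic, not necessarily spanning).\<close>
definition reduced_root_system :: "(real^'n) set \<Rightarrow> bool" where
  "reduced_root_system R \<longleftrightarrow> finite R \<and> 0 \<notin> R \<and>
     (\<forall>\<alpha>\<in>R. R \<inter> {t *\<^sub>R \<alpha> | t. True} = {\<alpha>, -\<alpha>}) \<and>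
     (\<forall>\<alpha>\<in>R. refl \<alpha> ` R = R)"

definition positive_system :: "(real^'n) set \<Rightarrow> (real^'n) set \<Rightarrow> bool" where
  "positive_system R Rp \<longleftrightarrow>
     (\<exists>\<beta>. (\<forall>\<alpha>\<in>R. inner \<alpha> \<beta> \<noteq> 0) \<and> Rp = {\<alpha>\<in>R. inner \<alpha> \<beta> > 0})"

inductive_set refl_group :: "(real^'n) set \<Rightarrow> (real^'n \<Rightarrow> real^'n) set" for R where
  id: "id \<in> refl_group R"
| step: "g \<in> refl_group R \<Longrightarrow> \<beta> \<in> R \<Longrightarrow> refl \<beta> \<circ> g \<in> refl_group R"

definition multiplicity_fn :: "(real^'n) set \<Rightarrow> (real^'n \<Rightarrow> real) \<Rightarrow> bool" where
  "multiplicity_fn R \<kappa> \<longleftrightarrow> (\<forall>\<alpha>\<in>R. \<kappa> \<alpha> \<ge> 0) \<and>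
     (\<forall>g\<in>refl_group R. \<forall>\<alpha>\<in>R. \<kappa> (g \<alpha>) = \<kappa> \<alpha>)"

definition lambda_k :: "(real^'n) set \<Rightarrow> (real^'n \<Rightarrow> real) \<Rightarrow> real" where
  "lambda_k Rp \<kappa> = real CARD('n) / 2 - 1 + (\<Sum>\<alpha>\<in>Rp. \<kappa> \<alpha>)"

text \<open>Weight \<open>h_\<kappa>\<close>; \<open>|t|^0 = 1\<close> handled explicitly since \<open>0 powr 0 = 0\<close> in Isabelle.\<close>
definition hk :: "(real^'n) set \<Rightarrow> (real^'n \<Rightarrow> real) \<Rightarrow> real^'n \<Rightarrow> real" where
  "hk Rp \<kappa> x = (\<Prod>\<alpha>\<in>Rp. if \<kappa> \<alpha> = 0 then 1 else \<bar>inner \<alpha> x\<bar> powr \<kappa> \<alpha>)"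

definition ddir :: "(real^'n \<Rightarrow> real) \<Rightarrow> real^'n \<Rightarrow> real^'n \<Rightarrow> real" where
  "ddir f \<xi> x = Lim (at 0) (\<lambda>t::real. (f (x + t *\<^sub>R \<xi>) - f x) / t)"

definition dquot :: "real^'n \<Rightarrow> (real^'n \<Rightarrow> real) \<Rightarrow> real^'n \<Rightarrow> real" where
  "dquot \<alpha> f x =
     (if inner \<alpha> x \<noteq> 0 then (f x - f (refl \<alpha> x)) / inner \<alpha> x
      else Lim (at x within {y. inner \<alpha> y \<noteq> 0}) (\<lambda>y. (f y - f (refl \<alpha> y)) / inner \<alpha> y))"

definition dunkl :: "(real^'n) set \<Rightarrow> (real^'n \<Rightarrow> real) \<Rightarrow> real^'n \<Rightarrow> (real^'n \<Rightarrow> real) \<Rightarrow> real^'n \<Rightarrow> real" where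
  "dunkl Rp \<kappa> \<xi> f x = ddir f \<xi> x + (\<Sum>\<alpha>\<in>Rp. \<kappa> \<alpha> * inner \<alpha> \<xi> * dquot \<alpha> f x)"

definition dunkl_lap :: "(real^'n) set \<Rightarrow> (real^'n \<Rightarrow> real) \<Rightarrow> (real^'n \<Rightarrow> real) \<Rightarrow> real^'n \<Rightarrow> real" where
  "dunkl_lap Rp \<kappa> f x = (\<Sum>j\<in>UNIV. dunkl Rp \<kappa> (axis j 1) (dunkl Rp \<kappa> (axis j 1) f) x)"

text \<open>Product of the \<open>\<D>_j\<close> for the indices in a list (the \<open>\<D>_j\<close> commute).\<close>
primrec dunkl_list :: "(real^'n) set \<Rightarrow> (real^'n \<Rightarrow> real) \<Rightarrow> 'n list \<Rightarrow> (real^'n \<Rightarrow> real) \<Rightarrow> real^'n \<Rightarrow> real" where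
  "dunkl_list Rp \<kappa> [] f = f"
| "dunkl_list Rp \<kappa> (k # ks) f = dunkl Rp \<kappa> (axis k 1) (dunkl_list Rp \<kappa> ks f)"

definition dunkl_mono :: "(real^'n) set \<Rightarrow> (real^'n \<Rightarrow> real) \<Rightarrow> ('n \<Rightarrow> nat) \<Rightarrow> (real^'n \<Rightarrow> real) \<Rightarrow> real^'n \<Rightarrow> real" where
  "dunkl_mono Rp \<kappa> a f = dunkl_list Rp \<kappa> (SOME ks. \<forall>i. count_list ks i = a i) f"

definition mpoly_fun :: "('n \<Rightarrow> nat) set \<Rightarrow> (('n \<Rightarrow> nat) \<Rightarrow> real) \<Rightarrow> real^'n \<Rightarrow> real" where
  "mpoly_fun A c x = (\<Sum>a\<in>A. c a * (\<Prod>i\<in>UNIV. (x $ i) ^ a i))"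

definition mpoly_dunkl :: "(real^'n) set \<Rightarrow> (real^'n \<Rightarrow> real) \<Rightarrow> ('n \<Rightarrow> nat) set \<Rightarrow> (('n \<Rightarrow> nat) \<Rightarrow> real) \<Rightarrow> (real^'n \<Rightarrow> real) \<Rightarrow> real^'n \<Rightarrow> real" where
  "mpoly_dunkl Rp \<kappa> A c f x = (\<Sum>a\<in>A. c a * dunkl_mono Rp \<kappa> a f x)"

definition mdeg :: "('n \<Rightarrow> nat) \<Rightarrow> nat" where
  "mdeg a = (\<Sum>i\<in>UNIV. a i)"

text \<open>Integral against surface measure on \<open>S^{d-1}\<close>, via polar coordinates:
  \<open>\<sigma>(E) = d \<cdot> vol{t y : 0 < t \<le> 1, y \<in> E}\<close>.\<close>
definition sphere_integral :: "(real^'n \<Rightarrow> real) \<Rightarrow> real" where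
  "sphere_integral g = real CARD('n) *
     integral\<^sup>L lborel (\<lambda>x. indicator (ball 0 1 - {0}) x * g (x /\<^sub>R norm x))"

fun higher_differentiable_on :: "(real^'n) set \<Rightarrow> (real^'n \<Rightarrow> real) \<Rightarrow> nat \<Rightarrow> bool" where
  "higher_differentiable_on S f 0 \<longleftrightarrow> continuous_on S f"
| "higher_differentiable_on S f (Suc n) \<longleftrightarrow>
     (\<forall>x\<in>S. f differentiable (at x)) \<and>
     (\<forall>v. higher_differentiable_on S (\<lambda>x. frechet_derivative f (at x) v) n)"

definition smooth_on :: "(real^'n) set \<Rightarrow> (real^'n \<Rightarrow> real) \<Rightarrow> bool" where
  "smooth_on S f \<longleftrightarrow> (\<forall>n. higher_differentiable_on S f n)"

definition pow_term :: "(('n \<Rightarrow> nat) \<Rightarrow> real) \<Rightarrow> real^'n \<Rightarrow> real^'n \<Rightarrow> ('n \<Rightarrow> nat) \<Rightarrow> real" where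
  "pow_term c a y k = c k * (\<Prod>i\<in>UNIV. (y $ i - a $ i) ^ k i)"

definition real_analytic_on :: "(real^'n) set \<Rightarrow> (real^'n \<Rightarrow> real) \<Rightarrow> bool" where
  "real_analytic_on S f \<longleftrightarrow> (\<forall>a\<in>S. \<exists>\<delta>>0. \<exists>c. \<forall>y\<in>ball a \<delta>.
      ((\<lambda>k. \<bar>pow_term c a y k\<bar>) summable_on UNIV) \<and> (pow_term c a y has_sum f y) UNIV)"

end

theory Submission
  imports Defs
begin

text \<open>
  Write \<open>I g\<close> for the integral of \<open>g h\<^sub>\<kappa>\<^sup>2\<close> over the sphere and \<open>D\<^sub>j\<close>, \<open>\<Delta>\<close> for the Dunkl operators.
  Integrating by parts in the unit ball, with the weight regularised to
  \<open>\<Prod>(\<langle>\<alpha>,x\<rangle>\<^sup>2 + \<epsilon>)\<^bsup>\<kappa> \<alpha>\<^esup>\<close> and the difference part symmetrised by the reflections, gives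
  \<open>I (D\<^sub>j p) = (k + 2\<lambda> + 1) I (x\<^sub>j p)\<close> for homogeneous polynomials \<open>p\<close> of degree \<open>k\<close>.
  Together with \<open>[D\<^sub>i, D\<^sub>j] = 0\<close> and \<open>[\<Delta>, x\<^sub>j] = 2 D\<^sub>j\<close> this makes \<open>x\<^sub>j\<close> and \<open>D\<^sub>j\<close> adjoint for the pairing of \<open>p\<close>
  with \<open>exp(-\<Delta>/2) v\<close> (suitably normalised by degree), so for harmonic \<open>q\<close> of degree \<open>m\<close> the number
  \<open>I (p q)\<close> is a multiple of \<open>I (q(D) p)\<close>; the latter is computed from
  \<open>I (\<Delta> p) = k (k + 2\<lambda>) I p\<close>. This proves the formula for homogeneous polynomials.

  For smooth \<open>f\<close>, Hadamard's lemma splits off a Taylor polynomial and leaves a remainder in a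
  power of the ideal of smooth functions vanishing at the origin. Difference quotients of smooth
  functions are smooth, so each \<open>D\<^sub>j\<close> lowers that power by at most one, and the remainder contributes
  neither to the coefficients nor to the stated order. If \<open>f\<close> is analytic, the left-hand
  side is a power series in \<open>r\<close>, and its coefficients are determined by the asymptotic expansion.
\<close>

section \<open>Smooth functions\<close>

text \<open>For 0 < \<kappa> \<alpha> < 1/2 the weight is not differentiable on the mirror of
  \<alpha>, and its logarithmic derivative is singular there. The added \<epsilon> removes this, and
  the integrated identity is exact for every \<epsilon> before the limit. The radial factor is the
  square of max 0 (1 - |x|^2): squaring makes it C^1 across the unit sphere, so only derivatives of
  compactly supported functions are integrated and no boundary term occurs. With \<sigma> = d + (k -
  1) + 2 sum \<kappa> the two radial moments are 8/(\<sigma>(\<sigma>+2)(\<sigma>+4)) and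
  2/((\<sigma>+2)(\<sigma>+4)); comparing them leaves the factor \<sigma> = k + 2\<lambda> + 1. The
  normalisation by degree imitates the Gaussian measure e^(-|x|^2/2) h^2 dx. There the adjoint of
  D_k is x_k - D_k, and exp(-Lap/2) x_k = (x_k - D_k) exp(-Lap/2), so conjugating one argument makes
  D_k and x_k adjoint. Replacing the radial Gaussian integrals by their recursion keeps everything a
  finite sum of sphere integrals.\<close>

lemma higher_differentiable_on_cong:
  assumes "open S" "\<And>x. x \<in> S \<Longrightarrow> f x = g x" "higher_differentiable_on S f n"
  shows "higher_differentiable_on S g n"
  using assms(2,3)
proof (induction n arbitrary: f g)
  case 0
  then show ?case by (simp cong: continuous_on_cong_simp)
next
  case (Suc n)
  have *: "(g has_derivative frechet_derivative f (at x)) (at x)" if "x \<in> S" for x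
  proof -
    have "(f has_derivative frechet_derivative f (at x)) (at x)"
      using Suc.prems(2) that by (simp add: frechet_derivative_works)
    then show ?thesis
      by (rule has_derivative_transform_within_open[OF _ assms(1) that]) (simp add: Suc.prems(1))
  qed
  have eq: "frechet_derivative f (at x) v = frechet_derivative g (at x) v" if "x \<in> S" for x v
    using frechet_derivative_at[OF *[OF that]] by simp
  have "higher_differentiable_on S (\<lambda>x. frechet_derivative g (at x) v) n" for v
    by (rule Suc.IH[of "\<lambda>x. frechet_derivative f (at x) v"]) (use Suc.prems(2) eq in simp_all)
  with differentiableI[OF *] show ?case by simp
qed

text \<open>The definition is phrased with \<open>frechet_derivative\<close>, a choice term. Here
  any explicit derivative \<open>f'\<close> serves, since on an open set equal functions may be
  exchanged. The closure proofs below induct on the order through this rule.\<close>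

lemma higher_differentiable_on_SucI:
  assumes "open S" "\<And>x. x \<in> S \<Longrightarrow> (f has_derivative f' x) (at x)"
    and "\<And>v. higher_differentiable_on S (\<lambda>x. f' x v) n"
  shows "higher_differentiable_on S f (Suc n)"
proof -
  have "frechet_derivative f (at x) v = f' x v" if "x \<in> S" for x v
    using frechet_derivative_at[OF assms(2)[OF that]] by simp
  then have "higher_differentiable_on S (\<lambda>x. frechet_derivative f (at x) v) n" for v
    by (intro higher_differentiable_on_cong[OF assms(1) _ assms(3)[of v]]) simp
  with differentiableI[OF assms(2)] show ?thesis by simp
qed

lemma higher_differentiable_on_0I:
  assumes "\<And>x. x \<in> S \<Longrightarrow> (f has_derivative f' x) (at x)"
  shows "higher_differentiable_on S f 0"
  unfolding higher_differentiable_on.simps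
  by (rule continuous_at_imp_continuous_on) (metis assms has_derivative_continuous)

lemma smooth_on_cong:
  assumes "open S" "\<And>x. x \<in> S \<Longrightarrow> f x = g x" "smooth_on S f"
  shows "smooth_on S g"
  using assms(3) higher_differentiable_on_cong[OF assms(1,2)] by (simp add: smooth_on_def)

lemma smooth_on_has_derivative:
  assumes "smooth_on S f" "x \<in> S"
  shows "(f has_derivative frechet_derivative f (at x)) (at x)"
proof -
  have "higher_differentiable_on S f (Suc 0)" using assms(1) by (simp only: smooth_on_def)
  then show ?thesis using assms(2) by (simp add: frechet_derivative_works)
qed

lemma smooth_on_frechet_derivative:
  assumes "smooth_on S f"
  shows "smooth_on S (\<lambda>x. frechet_derivative f (at x) v)"
  unfolding smooth_on_def
proof
  fix n
  have "higher_differentiable_on S f (Suc n)" using assms by (simp only: smooth_on_def)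
  then show "higher_differentiable_on S (\<lambda>x. frechet_derivative f (at x) v) n" by simp
qed

lemma smooth_on_continuous: "smooth_on S f \<Longrightarrow> continuous_on S f"
  unfolding smooth_on_def by (drule spec[of _ 0]) simp

lemma smooth_on_imp_frechet_sum:
  assumes "smooth_on S f" "x \<in> S"
  shows "frechet_derivative f (at x) v = (\<Sum>i\<in>UNIV. v $ i * frechet_derivative f (at x) (axis i 1))"
proof -
  interpret linear "frechet_derivative f (at x)"
    using smooth_on_has_derivative[OF assms] by (rule has_derivative_linear)
  have "v = (\<Sum>i\<in>UNIV. v $ i *\<^sub>R axis i 1)"
    by (simp add: vec_eq_iff axis_def if_distrib cong: if_cong)
  then have "frechet_derivative f (at x) v = frechet_derivative f (at x) (\<Sum>i\<in>UNIV. v $ i *\<^sub>R axis i 1)"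
    by simp
  then show ?thesis by (simp add: sum scaleR)
qed

lemma smooth_on_const [simp]: "open S \<Longrightarrow> smooth_on S (\<lambda>x. c)"
  unfolding smooth_on_def
proof
  fix n assume "open S"
  then show "higher_differentiable_on S (\<lambda>x. c) n"
  proof (induction n arbitrary: c)
    case (Suc n)
    show ?case
      by (rule higher_differentiable_on_SucI[where f'="\<lambda>_ _. 0"]) (use Suc in auto)
  qed simp
qed

lemma higher_differentiable_on_add:
  assumes "open S" "higher_differentiable_on S f n" "higher_differentiable_on S g n"
  shows "higher_differentiable_on S (\<lambda>x. f x + g x) n"
  using assms(2,3)
proof (induction n arbitrary: f g)
  case 0
  then show ?case by (simp add: continuous_on_add)
next
  case (Suc n)
  show ?case
  proof (rule higher_differentiable_on_SucI[OF assms(1)])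
    show "((\<lambda>x. f x + g x) has_derivative (\<lambda>v. frechet_derivative f (at x) v + frechet_derivative g (at x) v)) (at x)"
      if "x \<in> S" for x
      using Suc.prems that by (intro has_derivative_add) (simp_all add: frechet_derivative_works)
  qed (use Suc in simp)
qed

lemma smooth_on_add:
  "open S \<Longrightarrow> smooth_on S f \<Longrightarrow> smooth_on S g \<Longrightarrow> smooth_on S (\<lambda>x. f x + g x)"
  by (simp add: smooth_on_def higher_differentiable_on_add)

text \<open>Both factors are smooth rather than differentiable to order \<open>n\<close>: the
  product rule leaves an undifferentiated factor beside a derivative, and smoothness passes to both
  without tracking orders.\<close>

lemma smooth_on_mult:
  assumes "open S" "smooth_on S f" "smooth_on S g"
  shows "smooth_on S (\<lambda>x. f x * g x)"
  unfolding smooth_on_def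
proof
  fix n
  show "higher_differentiable_on S (\<lambda>x. f x * g x) n"
    using assms(2,3)
  proof (induction n arbitrary: f g)
    case 0
    then show ?case by (simp add: continuous_on_mult smooth_on_continuous)
  next
    case (Suc n)
    show ?case
      by (rule higher_differentiable_on_SucI[OF assms(1) has_derivative_mult
            [OF smooth_on_has_derivative[OF Suc.prems(1)] smooth_on_has_derivative[OF Suc.prems(2)]]])
        (simp_all add: higher_differentiable_on_add[OF assms(1)] Suc.IH Suc.prems smooth_on_frechet_derivative)
  qed
qed

lemma smooth_on_linear:
  assumes "open S" "bounded_linear f"
  shows "smooth_on S f"
  unfolding smooth_on_def
proof
  fix n
  show "higher_differentiable_on S f n"
  proof (cases n)
    case 0
    then show ?thesis using assms by (simp add: linear_continuous_on)
  next
    case (Suc k)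
    show ?thesis unfolding Suc
      by (rule higher_differentiable_on_SucI[OF assms(1) bounded_linear_imp_has_derivative[OF assms(2)]])
        (use smooth_on_const[OF assms(1)] in \<open>simp add: smooth_on_def\<close>)
  qed
qed

lemma smooth_on_coord: "open S \<Longrightarrow> smooth_on S (\<lambda>x. x $ i)"
  by (intro smooth_on_linear bounded_linear_vec_nth)

lemma smooth_on_cmult: "open S \<Longrightarrow> smooth_on S f \<Longrightarrow> smooth_on S (\<lambda>x. c * f x)"
  by (intro smooth_on_mult smooth_on_const)

lemma smooth_on_sum:
  assumes "open S" "\<And>i. i \<in> I \<Longrightarrow> smooth_on S (f i)"
  shows "smooth_on S (\<lambda>x. \<Sum>i\<in>I. f i x)"
  using assms(2)
proof (induction I rule: infinite_finite_induct)
  case (insert i I)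
  then have "smooth_on S (\<lambda>x. f i x + (\<Sum>i\<in>I. f i x))"
    by (intro smooth_on_add assms(1)) simp_all
  with insert.hyps show ?case by simp
qed (simp_all add: assms(1))

lemma smooth_on_compose_linear:
  fixes L :: "real^'n \<Rightarrow> real^'n"
  assumes "open S" "bounded_linear L" "\<And>x. x \<in> S \<Longrightarrow> L x \<in> S" "smooth_on S f"
  shows "smooth_on S (\<lambda>x. f (L x))"
  unfolding smooth_on_def
proof
  fix n
  show "higher_differentiable_on S (\<lambda>x. f (L x)) n"
    using assms(4)
  proof (induction n arbitrary: f)
    case 0
    have "continuous_on (L ` S) f"
      using assms(3) by (intro continuous_on_subset[OF smooth_on_continuous[OF 0]]) auto
    then have "continuous_on S (\<lambda>x. f (L x))"
      by (rule continuous_on_compose2[OF _ linear_continuous_on[OF assms(2)]]) auto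
    then show ?case by simp
  next
    case (Suc n)
    show ?case
    proof (rule higher_differentiable_on_SucI[OF assms(1)])
      show "((\<lambda>x. f (L x)) has_derivative (\<lambda>v. frechet_derivative f (at (L x)) (L v))) (at x)" if "x \<in> S" for x
        by (rule has_derivative_compose[OF bounded_linear_imp_has_derivative[OF assms(2)]
              smooth_on_has_derivative[OF Suc.prems assms(3)[OF that]]])
      show "higher_differentiable_on S (\<lambda>x. frechet_derivative f (at (L x)) (L v)) n" for v
        by (rule Suc.IH[OF smooth_on_frechet_derivative[OF Suc.prems]])
    qed
  qed
qed

subsection \<open>Averages along segments\<close>

definition seg_avg :: "(real \<Rightarrow> real) \<Rightarrow> (real^'n \<Rightarrow> real^'n) \<Rightarrow> (real^'n \<Rightarrow> real) \<Rightarrow> real^'n \<Rightarrow> real" where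
  "seg_avg w L h x = integral {0..1} (\<lambda>t. w t * h (x - t *\<^sub>R L x))"

locale segment_map =
  fixes S :: "(real^'n) set" and L :: "real^'n \<Rightarrow> real^'n"
  assumes open_S: "open S" and convex_S: "convex S" and L: "bounded_linear L"
    and L_S: "\<And>x. x \<in> S \<Longrightarrow> x - L x \<in> S"
begin

lemma segment_in: "x \<in> S \<Longrightarrow> t \<in> {0..1} \<Longrightarrow> x - t *\<^sub>R L x \<in> S"
  using convexD[OF convex_S, of x "x - L x" "1 - t" t] L_S[of x]
  by (simp add: algebra_simps)

lemma continuous_on_segment:
  fixes h :: "real^'n \<Rightarrow> real" and w :: "real \<Rightarrow> real"
  assumes "continuous_on S h" "continuous_on {0..1} w"
  shows "continuous_on (S \<times> {0..1}) (\<lambda>(x,t). w t * h (x - t *\<^sub>R L x))"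
proof -
  have 1: "continuous_on (S \<times> {0..1}) (\<lambda>p. h (fst p - snd p *\<^sub>R L (fst p)))"
    by (rule continuous_on_compose2[OF assms(1)])
      (use segment_in in \<open>auto intro!: continuous_intros linear_continuous_on_compose[OF _ bounded_linear.linear[OF L]]\<close>)
  have 2: "continuous_on (S \<times> {0..1}) (\<lambda>p. w (snd p))"
    by (rule continuous_on_compose2[OF assms(2)]) (auto intro!: continuous_intros)
  show ?thesis using continuous_on_mult[OF 2 1] by (simp add: case_prod_unfold)
qed

lemma seg_avg_integrable:
  fixes h :: "real^'n \<Rightarrow> real" and w :: "real \<Rightarrow> real"
  assumes "continuous_on S h" "continuous_on {0..1} w" "x \<in> S"
  shows "(\<lambda>t. w t * h (x - t *\<^sub>R L x)) integrable_on {0..1}"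
proof -
  have "continuous_on {0..1} (\<lambda>t. (\<lambda>(x,t). w t * h (x - t *\<^sub>R L x)) (x, t))"
    by (rule continuous_on_compose2[OF continuous_on_segment[OF assms(1,2)]])
      (use assms(3) in \<open>auto intro!: continuous_intros\<close>)
  then show ?thesis unfolding prod.case by (rule integrable_continuous_real)
qed

lemma seg_avg_has_derivative:
  assumes h: "smooth_on S h" and w: "continuous_on {0..1} w" and x: "x \<in> S"
  shows "(seg_avg w L h has_derivative (\<lambda>v. seg_avg w L (\<lambda>y. frechet_derivative h (at y) v) x
           + seg_avg (\<lambda>t. - t * w t) L (\<lambda>y. frechet_derivative h (at y) (L v)) x)) (at x)"
proof -
  define d where "d = (\<lambda>x t v. w t * frechet_derivative h (at (x - t *\<^sub>R L x)) (v - t *\<^sub>R L v))"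
  \<comment> \<open>\<open>leibniz_rule\<close> wants the derivative as a jointly continuous map
    into the bounded linear maps. In finite dimension this continuity may be checked one direction v
    at a time.\<close>
  define D where "D = (\<lambda>x t. Blinfun (d x t))"
  have der: "((\<lambda>x. w t * h (x - t *\<^sub>R L x)) has_derivative d x t) (at x)"
    if "x \<in> S" "t \<in> {0..1}" for x t
  proof -
    have 1: "((\<lambda>x. x - t *\<^sub>R L x) has_derivative (\<lambda>v. v - t *\<^sub>R L v)) (at x)"
      by (intro derivative_intros bounded_linear_imp_has_derivative L)
    show ?thesis unfolding d_def
      by (intro has_derivative_mult_right has_derivative_compose[OF 1] smooth_on_has_derivative[OF h]
          segment_in that)
  qed
  have apply_D: "blinfun_apply (D x t) = d x t" if "x \<in> S" "t \<in> {0..1}" for x t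
    unfolding D_def using der[OF that] by (intro bounded_linear_Blinfun_apply has_derivative_bounded_linear)
  have d_eq: "d x t v = w t * frechet_derivative h (at (x - t *\<^sub>R L x)) v
      + (- t * w t) * frechet_derivative h (at (x - t *\<^sub>R L x)) (L v)" if "x \<in> S" "t \<in> {0..1}" for x t v
  proof -
    interpret linear "frechet_derivative h (at (x - t *\<^sub>R L x))"
      by (rule has_derivative_linear[OF smooth_on_has_derivative[OF h segment_in[OF that]]])
    show ?thesis by (simp add: d_def diff scaleR algebra_simps)
  qed
  have cont_h': "continuous_on S (\<lambda>y. frechet_derivative h (at y) v)" for v
    by (intro smooth_on_continuous smooth_on_frechet_derivative h)
  have w': "continuous_on {0..1} (\<lambda>t. - t * w t)" by (intro continuous_intros w)
  have cont_D: "continuous_on (S \<times> cbox 0 1) (\<lambda>(x, t). D x t)"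
  proof (rule continuous_on_blinfun_componentwise)
    fix v :: "real^'n"
    have "continuous_on (S \<times> {0..1}) (\<lambda>p. (\<lambda>(x,t). w t * frechet_derivative h (at (x - t *\<^sub>R L x)) v) p
      + (\<lambda>(x,t). (- t * w t) * frechet_derivative h (at (x - t *\<^sub>R L x)) (L v)) p)"
      by (intro continuous_on_add continuous_on_segment cont_h' w w')
    then show "continuous_on (S \<times> cbox 0 1) (\<lambda>p. blinfun_apply (case p of (x, t) \<Rightarrow> D x t) v)"
      unfolding cbox_interval by (rule continuous_on_eq) (auto simp: apply_D d_eq)
  qed
  have "((\<lambda>x. integral (cbox 0 1) (\<lambda>t. w t * h (x - t *\<^sub>R L x))) has_derivative
      blinfun_apply (integral (cbox 0 1) (D x))) (at x within S)"
  proof (rule leibniz_rule[OF _ _ cont_D x convex_S])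
    show "((\<lambda>x. w t * h (x - t *\<^sub>R L x)) has_derivative blinfun_apply (D x t)) (at x within S)"
      if "x \<in> S" "t \<in> cbox 0 1" for x t
      using der[of x t] apply_D[of x t] that by (auto intro: has_derivative_at_withinI)
    show "(\<lambda>t. w t * h (x - t *\<^sub>R L x)) integrable_on cbox 0 1" if "x \<in> S" for x
      using seg_avg_integrable[OF smooth_on_continuous[OF h] w that] by simp
  qed
  then have main: "(seg_avg w L h has_derivative blinfun_apply (integral {0..1} (D x))) (at x)"
    using at_within_open[OF x open_S] by (simp add: seg_avg_def[abs_def])
  have "blinfun_apply (integral {0..1} (D x)) v = seg_avg w L (\<lambda>y. frechet_derivative h (at y) v) x
           + seg_avg (\<lambda>t. - t * w t) L (\<lambda>y. frechet_derivative h (at y) (L v)) x" for v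
  proof -
    have "continuous_on {0..1} (\<lambda>t. (\<lambda>(x,t). D x t) (x, t))"
      by (rule continuous_on_compose2[OF cont_D]) (use x in \<open>auto intro!: continuous_intros\<close>)
    then have "D x integrable_on {0..1}" unfolding prod.case by (rule integrable_continuous_real)
    then have "blinfun_apply (integral {0..1} (D x)) v = integral {0..1} (\<lambda>t. blinfun_apply (D x t) v)"
      by (rule blinfun_apply_integral)
    also have "\<dots> = integral {0..1} (\<lambda>t. w t * frechet_derivative h (at (x - t *\<^sub>R L x)) v
      + (- t * w t) * frechet_derivative h (at (x - t *\<^sub>R L x)) (L v))"
      by (rule integral_cong) (simp add: apply_D x d_eq)
    also have "\<dots> = seg_avg w L (\<lambda>y. frechet_derivative h (at y) v) x
           + seg_avg (\<lambda>t. - t * w t) L (\<lambda>y. frechet_derivative h (at y) (L v)) x"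
      unfolding seg_avg_def by (intro integral_add seg_avg_integrable cont_h' w w' x)
    finally show ?thesis .
  qed
  then have "blinfun_apply (integral {0..1} (D x)) = (\<lambda>v. seg_avg w L (\<lambda>y. frechet_derivative h (at y) v) x
           + seg_avg (\<lambda>t. - t * w t) L (\<lambda>y. frechet_derivative h (at y) (L v)) x)" by blast
  with main show ?thesis by simp
qed

lemma smooth_on_seg_avg:
  assumes "smooth_on S h" "continuous_on {0..1} w"
  shows "smooth_on S (seg_avg w L h)"
  unfolding smooth_on_def
proof
  fix n
  show "higher_differentiable_on S (seg_avg w L h) n"
    using assms
  proof (induction n arbitrary: w h)
    case 0
    then show ?case by (rule higher_differentiable_on_0I[OF seg_avg_has_derivative])
  next
    case (Suc n)
    show ?case
      by (rule higher_differentiable_on_SucI[OF open_S seg_avg_has_derivative[OF Suc.prems]])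
        (auto intro!: higher_differentiable_on_add[OF open_S] Suc.IH continuous_intros
          simp: smooth_on_frechet_derivative Suc.prems)
  qed
qed

lemma segment_difference:
  assumes h: "smooth_on S h" and x: "x \<in> S"
  shows "h x - h (x - L x) = integral {0..1} (\<lambda>t. frechet_derivative h (at (x - t *\<^sub>R L x)) (L x))"
proof -
  have "((\<lambda>t. frechet_derivative h (at (x - t *\<^sub>R L x)) (L x)) has_integral
      (- h (x - 1 *\<^sub>R L x)) - (- h (x - 0 *\<^sub>R L x))) {0..1}"
  proof (rule fundamental_theorem_of_calculus)
    fix t :: real assume t: "t \<in> {0..1}"
    interpret linear "frechet_derivative h (at (x - t *\<^sub>R L x))"
      by (rule has_derivative_linear[OF smooth_on_has_derivative[OF h segment_in[OF x t]]])
    have 1: "((\<lambda>t. x - t *\<^sub>R L x) has_derivative (\<lambda>s. - (s *\<^sub>R L x))) (at t within {0..1})"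
      by (auto intro!: derivative_eq_intros)
    have "((\<lambda>t. - h (x - t *\<^sub>R L x)) has_derivative
        (\<lambda>s. - frechet_derivative h (at (x - t *\<^sub>R L x)) (- (s *\<^sub>R L x)))) (at t within {0..1})"
      by (intro has_derivative_minus has_derivative_compose[OF 1] smooth_on_has_derivative[OF h] segment_in x t)
    then show "((\<lambda>t. - h (x - t *\<^sub>R L x)) has_vector_derivative
        frechet_derivative h (at (x - t *\<^sub>R L x)) (L x)) (at t within {0..1})"
      by (simp add: has_vector_derivative_def neg scaleR)
  qed simp
  then show ?thesis by (simp add: integral_unique)
qed

end


section \<open>Reflections and Dunkl operators\<close>

lemma bounded_linear_refl: "bounded_linear (refl \<alpha>)"
  unfolding refl_def[abs_def] linear_conv_bounded_linear[symmetric]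
  by (rule linearI) (simp_all add: algebra_simps inner_add_right add_divide_distrib)

lemma refl_refl [simp]: "refl \<alpha> (refl \<alpha> x) = x"
  by (cases "\<alpha> = 0") (simp_all add: refl_def inner_diff_right)

lemma inner_refl_refl [simp]: "inner (refl \<alpha> x) (refl \<alpha> y) = inner x y"
  by (cases "\<alpha> = 0")
    (simp_all add: refl_def inner_diff_right inner_diff_left inner_commute[of x \<alpha>] field_simps)

lemma inner_refl_left: "inner (refl \<alpha> x) y = inner x (refl \<alpha> y)"
  using inner_refl_refl[of \<alpha> x "refl \<alpha> y"] by simp

lemma norm_refl [simp]: "norm (refl \<alpha> x) = norm x"
  by (simp add: norm_eq_sqrt_inner)

lemma refl_self: "\<alpha> \<noteq> 0 \<Longrightarrow> refl \<alpha> \<alpha> = - \<alpha>"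
  by (simp add: refl_def algebra_simps scaleR_2)

lemma refl_minus [simp]: "refl \<alpha> (- x) = - refl \<alpha> x"
  by (simp add: refl_def algebra_simps)

lemma refl_minus_root [simp]: "refl (- \<alpha>) x = refl \<alpha> x"
  by (simp add: refl_def algebra_simps)

lemma refl_fixed: "inner \<alpha> x = 0 \<Longrightarrow> refl \<alpha> x = x"
  by (simp add: refl_def)

lemma refl_conjugate: "refl \<beta> (refl \<alpha> x) = refl (refl \<beta> \<alpha>) (refl \<beta> x)"
proof -
  interpret bounded_linear "refl \<beta>" by (rule bounded_linear_refl)
  show ?thesis unfolding refl_def[of \<alpha>] refl_def[of "refl \<beta> \<alpha>"]
    by (simp add: diff scaleR)
qed

lemma ddir_eq:
  assumes "(f has_derivative f') (at x)"
  shows "ddir f \<xi> x = f' \<xi>"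
proof -
  interpret linear f' using assms by (rule has_derivative_linear)
  have "((\<lambda>t. x + t *\<^sub>R \<xi>) has_derivative (\<lambda>s. s *\<^sub>R \<xi>)) (at 0)"
    by (auto intro!: derivative_eq_intros)
  then have "((\<lambda>t::real. f (x + t *\<^sub>R \<xi>)) has_derivative (\<lambda>s. f' (s *\<^sub>R \<xi>))) (at 0)"
    by (rule has_derivative_compose) (use assms in simp)
  then have "((\<lambda>t::real. f (x + t *\<^sub>R \<xi>)) has_field_derivative f' \<xi>) (at 0)"
    by (simp add: has_field_derivative_def scaleR mult.commute[of "f' \<xi>"] mult_commute_abs)
  then show ?thesis
    unfolding ddir_def DERIV_def by (intro tendsto_Lim) simp_all
qed

text \<open>Invariance is asked for every reflection, which holds for the whole space and for balls
  centred at the origin, the two domains used later. Convexity keeps the segment from a point to its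
  mirror image inside \<open>S\<close>, and with \<open>zero_S\<close> also the segment to the
  origin.\<close>

locale symmetric_domain =
  fixes S :: "(real^'n) set"
  assumes open_S: "open S" and convex_S: "convex S" and zero_S: "0 \<in> S"
    and refl_S: "\<And>\<alpha> x. x \<in> S \<Longrightarrow> refl \<alpha> x \<in> S"
begin

abbreviation refl_shift :: "real^'n \<Rightarrow> real^'n \<Rightarrow> real^'n" where
  "refl_shift \<alpha> x \<equiv> (2 * inner \<alpha> x / inner \<alpha> \<alpha>) *\<^sub>R \<alpha>"

lemma segment_refl: "segment_map S (refl_shift \<alpha>)"
proof (rule segment_map.intro[OF open_S convex_S])
  show "bounded_linear (refl_shift \<alpha>)"
    unfolding linear_conv_bounded_linear[symmetric]
    by (rule linearI) (simp_all add: algebra_simps inner_add_right add_divide_distrib)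
  show "x - refl_shift \<alpha> x \<in> S" if "x \<in> S" for x
    using refl_S[OF that, of \<alpha>] by (simp add: refl_def)
qed

lemma segment_id: "segment_map S (\<lambda>x. x)"
  by (rule segment_map.intro[OF open_S convex_S bounded_linear_ident]) (simp add: zero_S)

text \<open>Along the segment from x to its mirror image the velocity is \<alpha> times a factor
  proportional to \<open>inner \<alpha> x\<close>. Dividing this factor out under the integral gives
  a form of the divided difference without singularity on the mirror.\<close>

definition sdquot :: "real^'n \<Rightarrow> (real^'n \<Rightarrow> real) \<Rightarrow> real^'n \<Rightarrow> real" where
  "sdquot \<alpha> f x = 2 / inner \<alpha> \<alpha> *
     seg_avg (\<lambda>_. 1) (refl_shift \<alpha>) (\<lambda>y. frechet_derivative f (at y) \<alpha>) x"

lemma smooth_on_sdquot: "smooth_on S f \<Longrightarrow> smooth_on S (sdquot \<alpha> f)"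
  unfolding sdquot_def[abs_def]
  by (intro smooth_on_cmult open_S segment_map.smooth_on_seg_avg[OF segment_refl]
      smooth_on_frechet_derivative continuous_on_const)

lemma difference_refl_eq:
  assumes f: "smooth_on S f" and x: "x \<in> S" and \<alpha>: "\<alpha> \<noteq> 0"
  shows "f x - f (refl \<alpha> x) = inner \<alpha> x * sdquot \<alpha> f x"
proof -
  interpret segment_map S "refl_shift \<alpha>" by (rule segment_refl)
  have "f x - f (refl \<alpha> x) = integral {0..1}
      (\<lambda>t. frechet_derivative f (at (x - t *\<^sub>R refl_shift \<alpha> x)) (refl_shift \<alpha> x))"
    unfolding refl_def by (rule segment_difference[OF f x])
  also have "\<dots> = integral {0..1}
      (\<lambda>t. (2 * inner \<alpha> x / inner \<alpha> \<alpha>) * frechet_derivative f (at (x - t *\<^sub>R refl_shift \<alpha> x)) \<alpha>)"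
  proof (rule integral_cong)
    fix t :: real assume "t \<in> {0..1}"
    then interpret linear "frechet_derivative f (at (x - t *\<^sub>R refl_shift \<alpha> x))"
      by (intro has_derivative_linear[OF smooth_on_has_derivative[OF f segment_in[OF x]]])
    show "frechet_derivative f (at (x - t *\<^sub>R refl_shift \<alpha> x)) (refl_shift \<alpha> x) =
      (2 * inner \<alpha> x / inner \<alpha> \<alpha>) * frechet_derivative f (at (x - t *\<^sub>R refl_shift \<alpha> x)) \<alpha>"
      by (simp only: scaleR real_scaleR_def)
  qed
  also have "\<dots> = inner \<alpha> x * sdquot \<alpha> f x"
    unfolding integral_mult_right sdquot_def seg_avg_def by simp
  finally show ?thesis .
qed

text \<open>Off the mirror both are the same quotient. On the mirror \<open>dquot\<close> is a limit
  through points off it, and continuity of \<open>sdquot\<close> gives its value once x is known to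
  be a limit point of the complement of the mirror; moving a little along \<alpha> shows
  that.\<close>

lemma dquot_eq_sdquot:
  assumes f: "smooth_on S f" and x: "x \<in> S" and \<alpha>: "\<alpha> \<noteq> 0"
  shows "dquot \<alpha> f x = sdquot \<alpha> f x"
proof (cases "inner \<alpha> x = 0")
  case False
  then show ?thesis using difference_refl_eq[OF assms] by (simp add: dquot_def)
next
  case True
  let ?F = "at x within {y. inner \<alpha> y \<noteq> 0}"
  have "x islimpt {y. inner \<alpha> y \<noteq> 0}"
    unfolding islimpt_approachable
  proof (intro allI impI)
    fix e :: real assume e: "e > 0"
    let ?y = "x + (e / (2 * norm \<alpha>)) *\<^sub>R \<alpha>"
    have "inner \<alpha> ?y \<noteq> 0" using True e \<alpha> by (simp add: inner_add_right)
    moreover have "dist ?y x < e" using e \<alpha> by (simp add: dist_norm)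
    ultimately show "\<exists>x'\<in>{y. inner \<alpha> y \<noteq> 0}. x' \<noteq> x \<and> dist x' x < e"
      using True by (intro bexI[of _ ?y]) auto
  qed
  then have ne: "?F \<noteq> bot" by (simp add: trivial_limit_within)
  have "isCont (sdquot \<alpha> f) x"
    using smooth_on_continuous[OF smooth_on_sdquot[OF f]] x open_S
    by (simp add: continuous_on_eq_continuous_at)
  then have "(sdquot \<alpha> f \<longlongrightarrow> sdquot \<alpha> f x) ?F"
    by (simp add: isCont_def tendsto_within_subset[of _ _ _ UNIV])
  moreover have "\<forall>\<^sub>F y in ?F. (f y - f (refl \<alpha> y)) / inner \<alpha> y = sdquot \<alpha> f y"
  proof -
    have "\<forall>\<^sub>F y in ?F. y \<in> S"
      by (rule eventually_at_in_open'[OF open_S x, THEN filter_leD[rotated]]) (simp add: at_le)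
    moreover have "\<forall>\<^sub>F y in ?F. inner \<alpha> y \<noteq> 0" by (auto simp: eventually_at_filter)
    ultimately show ?thesis
      by eventually_elim (simp add: difference_refl_eq[OF f _ \<alpha>])
  qed
  ultimately have "((\<lambda>y. (f y - f (refl \<alpha> y)) / inner \<alpha> y) \<longlongrightarrow> sdquot \<alpha> f x) ?F"
    by (simp cong: tendsto_cong)
  then show ?thesis using True ne by (simp add: dquot_def tendsto_Lim)
qed

text \<open>On the mirror the segment degenerates to a point, so the average is the directional
  derivative itself. The case split reduces the identities that follow to algebra off the mirror and
  to a derivative rule on it.\<close>

lemma dquot_smooth:
  assumes f: "smooth_on S f" and x: "x \<in> S" and \<alpha>: "\<alpha> \<noteq> 0"
  shows "dquot \<alpha> f x = (if inner \<alpha> x = 0 then 2 / inner \<alpha> \<alpha> * frechet_derivative f (at x) \<alpha>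
           else (f x - f (refl \<alpha> x)) / inner \<alpha> x)"
  using dquot_eq_sdquot[OF assms] by (auto simp: sdquot_def seg_avg_def) (simp add: dquot_def)

lemma dquot_cong:
  assumes f: "smooth_on S f" and fg: "\<And>y. y \<in> S \<Longrightarrow> f y = g y" and x: "x \<in> S" and \<alpha>: "\<alpha> \<noteq> 0"
  shows "dquot \<alpha> f x = dquot \<alpha> g x"
proof -
  have g: "smooth_on S g" by (rule smooth_on_cong[OF open_S fg f])
  have "(g has_derivative frechet_derivative f (at x)) (at x)"
    by (rule has_derivative_transform_within_open[OF smooth_on_has_derivative[OF f x] open_S x fg])
  then have "frechet_derivative g (at x) = frechet_derivative f (at x)"
    using frechet_derivative_at by metis
  then show ?thesis using f g fg x refl_S[OF x, of \<alpha>] by (simp add: dquot_smooth \<alpha>)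
qed

lemma dquot_add:
  assumes "smooth_on S f" "smooth_on S g" "x \<in> S" "\<alpha> \<noteq> 0"
  shows "dquot \<alpha> (\<lambda>x. f x + g x) x = dquot \<alpha> f x + dquot \<alpha> g x"
proof -
  have "frechet_derivative (\<lambda>x. f x + g x) (at x) = (\<lambda>v. frechet_derivative f (at x) v + frechet_derivative g (at x) v)"
    using frechet_derivative_at[OF has_derivative_add[OF smooth_on_has_derivative[OF assms(1,3)]
          smooth_on_has_derivative[OF assms(2,3)]]] by simp
  then show ?thesis
    using assms by (simp add: dquot_smooth smooth_on_add open_S divide_simps algebra_simps)
qed

text \<open>A twisted Leibniz rule: reflecting changes x_j by 2 <\<alpha>,x> \<alpha>_j /
  <\<alpha>,\<alpha>>, and the factor <\<alpha>,x> cancels against the denominator, leaving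
  \<open>f\<close> at the mirror image.\<close>

lemma dquot_coord_mult:
  assumes f: "smooth_on S f" and x: "x \<in> S" and \<alpha>: "\<alpha> \<noteq> 0"
  shows "dquot \<alpha> (\<lambda>x. x $ j * f x) x = x $ j * dquot \<alpha> f x + 2 * \<alpha> $ j / inner \<alpha> \<alpha> * f (refl \<alpha> x)"
proof -
  have "frechet_derivative (\<lambda>x. x $ j * f x) (at x) = (\<lambda>v. x $ j * frechet_derivative f (at x) v + v $ j * f x)"
    using frechet_derivative_at[OF has_derivative_mult[OF
          bounded_linear_imp_has_derivative[OF bounded_linear_vec_nth] smooth_on_has_derivative[OF f x]]] by simp
  moreover define k where "k = \<alpha> $ j / inner \<alpha> \<alpha>"
  then have "refl \<alpha> x $ j = x $ j - 2 * inner \<alpha> x * k" by (simp add: refl_def)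
  moreover have "(x $ j * a - (x $ j - 2 * i * k) * b) / i = x $ j * ((a - b) / i) + 2 * k * b"
    if "i \<noteq> 0" for i a b :: real using that by (simp add: field_simps)
  moreover have "2 * \<alpha> $ j / inner \<alpha> \<alpha> = 2 * k" by (simp add: k_def)
  moreover have "2 / inner \<alpha> \<alpha> * (a + \<alpha> $ j * b) = 2 / inner \<alpha> \<alpha> * a + 2 * k * b" for a b
    by (simp add: k_def algebra_simps add_divide_distrib)
  ultimately show ?thesis
    using f x \<alpha> by (simp add: dquot_smooth smooth_on_mult smooth_on_coord open_S refl_fixed)
qed

lemma dquot_refl:
  assumes f: "smooth_on S f" and x: "x \<in> S" and \<alpha>: "\<alpha> \<noteq> 0"
  shows "dquot \<alpha> (\<lambda>x. f (refl \<beta> x)) x = dquot (refl \<beta> \<alpha>) f (refl \<beta> x)"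
proof -
  have "frechet_derivative (\<lambda>x. f (refl \<beta> x)) (at x) = (\<lambda>v. frechet_derivative f (at (refl \<beta> x)) (refl \<beta> v))"
    using frechet_derivative_at[OF has_derivative_compose[OF
          bounded_linear_imp_has_derivative[OF bounded_linear_refl] smooth_on_has_derivative[OF f refl_S[OF x]]]]
    by simp
  moreover have "smooth_on S (\<lambda>x. f (refl \<beta> x))"
    by (rule smooth_on_compose_linear[OF open_S bounded_linear_refl refl_S f])
  moreover have "refl \<beta> \<alpha> \<noteq> 0" using \<alpha> norm_refl[of \<beta> \<alpha>] by (metis norm_eq_zero)
  ultimately show ?thesis
    using f x \<alpha> refl_S[OF x] by (simp add: dquot_smooth refl_conjugate[of \<beta> \<alpha> x])
qed

lemma dquot_minus_root:
  assumes f: "smooth_on S f" and x: "x \<in> S" and \<alpha>: "\<alpha> \<noteq> 0"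
  shows "dquot (- \<alpha>) f x = - dquot \<alpha> f x"
proof -
  interpret linear "frechet_derivative f (at x)"
    by (rule has_derivative_linear[OF smooth_on_has_derivative[OF f x]])
  show ?thesis using f x \<alpha> by (simp add: dquot_smooth neg)
qed

end

section \<open>Root systems and sums over positive roots\<close>

locale dunkl_setting =
  fixes R Rp :: "(real^'n) set" and \<kappa> :: "real^'n \<Rightarrow> real"
  assumes root_system: "reduced_root_system R"
    and positive: "positive_system R Rp"
    and multiplicity: "multiplicity_fn R \<kappa>"
begin

lemma finite_Rp: "finite Rp"
  using root_system positive by (auto simp: reduced_root_system_def positive_system_def)

lemma Rp_subset: "Rp \<subseteq> R"
  using positive by (auto simp: positive_system_def)

lemma root_nonzero: "\<alpha> \<in> R \<Longrightarrow> \<alpha> \<noteq> 0"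
  using root_system by (auto simp: reduced_root_system_def)

lemma refl_root: "\<beta> \<in> R \<Longrightarrow> \<alpha> \<in> R \<Longrightarrow> refl \<beta> \<alpha> \<in> R"
  using root_system by (auto simp: reduced_root_system_def)

lemma minus_root: "\<alpha> \<in> R \<Longrightarrow> - \<alpha> \<in> R"
  using refl_root[of \<alpha> \<alpha>] refl_self[OF root_nonzero] by simp

lemma kappa_nonneg: "\<alpha> \<in> R \<Longrightarrow> \<kappa> \<alpha> \<ge> 0"
  using multiplicity by (auto simp: multiplicity_fn_def)

lemma kappa_refl: "\<beta> \<in> R \<Longrightarrow> \<alpha> \<in> R \<Longrightarrow> \<kappa> (refl \<beta> \<alpha>) = \<kappa> \<alpha>"
  using multiplicity refl_group.step[OF refl_group.id, of \<beta> R] by (fastforce simp: multiplicity_fn_def)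

lemma kappa_minus: "\<alpha> \<in> R \<Longrightarrow> \<kappa> (- \<alpha>) = \<kappa> \<alpha>"
  using kappa_refl[of \<alpha> \<alpha>] refl_self[OF root_nonzero] by simp

lemma minus_root_notin_Rp: "\<alpha> \<in> Rp \<Longrightarrow> - \<alpha> \<notin> Rp"
  using positive by (auto simp: positive_system_def)

lemma root_cases: "\<alpha> \<in> R \<Longrightarrow> \<alpha> \<notin> Rp \<Longrightarrow> - \<alpha> \<in> Rp"
  using positive minus_root by (fastforce simp: positive_system_def)

text \<open>A reflection permutes \<open>R\<close> but not \<open>Rp\<close>. Changing the sign of
  an image that leaves \<open>Rp\<close> repairs this, so sums and products over \<open>Rp\<close>
  of functions even in the root are invariant under reflections.\<close>

lemma Rp_refl_involution:
  assumes "\<beta> \<in> R"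
  defines "\<sigma> \<equiv> \<lambda>\<alpha>. if refl \<beta> \<alpha> \<in> Rp then refl \<beta> \<alpha> else - refl \<beta> \<alpha>"
  assumes "\<alpha> \<in> Rp"
  shows "\<sigma> \<alpha> \<in> Rp" "\<sigma> (\<sigma> \<alpha>) = \<alpha>"
  using root_cases[of "refl \<beta> \<alpha>"] refl_root[of \<beta> \<alpha>] minus_root_notin_Rp[of \<alpha>] assms Rp_subset
  by (auto simp: \<sigma>_def)

lemma sum_Rp_refl:
  fixes F :: "real^'n \<Rightarrow> real"
  assumes "\<beta> \<in> R" "\<And>\<alpha>. \<alpha> \<in> R \<Longrightarrow> F (- \<alpha>) = F \<alpha>"
  shows "(\<Sum>\<alpha>\<in>Rp. F (refl \<beta> \<alpha>)) = (\<Sum>\<alpha>\<in>Rp. F \<alpha>)"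
  using Rp_refl_involution[OF assms(1)] assms refl_root[of \<beta>] Rp_subset
  by (intro sum.reindex_bij_witness[of Rp "\<lambda>\<alpha>. if refl \<beta> \<alpha> \<in> Rp then refl \<beta> \<alpha> else - refl \<beta> \<alpha>"
      "\<lambda>\<alpha>. if refl \<beta> \<alpha> \<in> Rp then refl \<beta> \<alpha> else - refl \<beta> \<alpha>"]) (auto split: if_splits)

lemma prod_Rp_refl:
  fixes F :: "real^'n \<Rightarrow> real"
  assumes "\<beta> \<in> R" "\<And>\<alpha>. \<alpha> \<in> R \<Longrightarrow> F (- \<alpha>) = F \<alpha>"
  shows "(\<Prod>\<alpha>\<in>Rp. F (refl \<beta> \<alpha>)) = (\<Prod>\<alpha>\<in>Rp. F \<alpha>)"
  using Rp_refl_involution[OF assms(1)] assms refl_root[of \<beta>] Rp_subset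
  by (intro prod.reindex_bij_witness[of Rp "\<lambda>\<alpha>. if refl \<beta> \<alpha> \<in> Rp then refl \<beta> \<alpha> else - refl \<beta> \<alpha>"
      "\<lambda>\<alpha>. if refl \<beta> \<alpha> \<in> Rp then refl \<beta> \<alpha> else - refl \<beta> \<alpha>"]) (auto split: if_splits)

abbreviation D :: "real^'n \<Rightarrow> (real^'n \<Rightarrow> real) \<Rightarrow> real^'n \<Rightarrow> real" where
  "D \<equiv> dunkl Rp \<kappa>"

abbreviation Lap :: "(real^'n \<Rightarrow> real) \<Rightarrow> real^'n \<Rightarrow> real" where
  "Lap \<equiv> dunkl_lap Rp \<kappa>"

text \<open>The commutator of \<open>D \<xi>\<close> with multiplication by the \<open>j\<close>-th coordinate.\<close>
definition dunkl_comm :: "real^'n \<Rightarrow> 'n \<Rightarrow> (real^'n \<Rightarrow> real) \<Rightarrow> real^'n \<Rightarrow> real" where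
  "dunkl_comm \<xi> j f x = \<xi> $ j * f x +
     (\<Sum>\<alpha>\<in>Rp. (2 * \<kappa> \<alpha> * inner \<alpha> \<xi> * \<alpha> $ j / inner \<alpha> \<alpha>) * f (refl \<alpha> x))"

end

section \<open>Calculus of Dunkl operators on smooth functions\<close>

locale dunkl_domain = dunkl_setting R Rp \<kappa> + symmetric_domain S
  for R Rp :: "(real^'n) set" and \<kappa> and S :: "(real^'n) set"
begin

lemma Rp_nonzero: "\<alpha> \<in> Rp \<Longrightarrow> \<alpha> \<noteq> 0"
  using root_nonzero Rp_subset by blast

lemma D_smooth:
  assumes "smooth_on S f" "x \<in> S"
  shows "D \<xi> f x = frechet_derivative f (at x) \<xi> + (\<Sum>\<alpha>\<in>Rp. \<kappa> \<alpha> * inner \<alpha> \<xi> * dquot \<alpha> f x)"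
  unfolding dunkl_def using ddir_eq[OF smooth_on_has_derivative[OF assms]] by simp

lemma smooth_on_D:
  assumes f: "smooth_on S f"
  shows "smooth_on S (D \<xi> f)"
proof (rule smooth_on_cong[OF open_S])
  show "smooth_on S (\<lambda>x. frechet_derivative f (at x) \<xi> + (\<Sum>\<alpha>\<in>Rp. (\<kappa> \<alpha> * inner \<alpha> \<xi>) * sdquot \<alpha> f x))"
    by (intro smooth_on_add open_S smooth_on_sum smooth_on_cmult smooth_on_sdquot
        smooth_on_frechet_derivative f)
  show "frechet_derivative f (at x) \<xi> + (\<Sum>\<alpha>\<in>Rp. (\<kappa> \<alpha> * inner \<alpha> \<xi>) * sdquot \<alpha> f x) = D \<xi> f x"
    if "x \<in> S" for x
    using that f by (simp add: D_smooth dquot_eq_sdquot Rp_nonzero)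
qed

lemma D_cong:
  assumes f: "smooth_on S f" and fg: "\<And>y. y \<in> S \<Longrightarrow> f y = g y" and x: "x \<in> S"
  shows "D \<xi> f x = D \<xi> g x"
proof -
  have g: "smooth_on S g" by (rule smooth_on_cong[OF open_S fg f])
  have "(g has_derivative frechet_derivative f (at x)) (at x)"
    by (rule has_derivative_transform_within_open[OF smooth_on_has_derivative[OF f x] open_S x fg])
  then have "frechet_derivative g (at x) = frechet_derivative f (at x)"
    using frechet_derivative_at by metis
  moreover have "dquot \<alpha> f x = dquot \<alpha> g x" if "\<alpha> \<in> Rp" for \<alpha>
    by (rule dquot_cong[OF f fg x Rp_nonzero[OF that]])
  ultimately show ?thesis using f g x by (simp add: D_smooth)
qed

lemma D_add:
  assumes "smooth_on S f" "smooth_on S g" "x \<in> S"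
  shows "D \<xi> (\<lambda>x. f x + g x) x = D \<xi> f x + D \<xi> g x"
proof -
  have "frechet_derivative (\<lambda>x. f x + g x) (at x) \<xi> = frechet_derivative f (at x) \<xi> + frechet_derivative g (at x) \<xi>"
    using frechet_derivative_at[OF has_derivative_add[OF smooth_on_has_derivative[OF assms(1,3)]
          smooth_on_has_derivative[OF assms(2,3)]]] by (metis (no_types))
  then show ?thesis
    using assms by (simp add: D_smooth smooth_on_add open_S dquot_add Rp_nonzero algebra_simps sum.distrib)
qed

lemma D_const: "x \<in> S \<Longrightarrow> D \<xi> (\<lambda>x. c) x = 0"
  using frechet_derivative_at[OF has_derivative_const[of c "at x"]]
  by (simp add: D_smooth open_S dquot_smooth Rp_nonzero sum.neutral)

lemma D_cmult:
  assumes "smooth_on S f" "x \<in> S"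
  shows "D \<xi> (\<lambda>x. c * f x) x = c * D \<xi> f x"
proof -
  have fd: "frechet_derivative (\<lambda>x. c * f x) (at x) = (\<lambda>v. c * frechet_derivative f (at x) v)"
    using frechet_derivative_at[OF has_derivative_mult_right[OF smooth_on_has_derivative[OF assms]]] by simp
  then have "dquot \<alpha> (\<lambda>x. c * f x) x = c * dquot \<alpha> f x" if "\<alpha> \<in> Rp" for \<alpha>
    using assms Rp_nonzero[OF that]
    by (simp add: dquot_smooth smooth_on_cmult open_S right_diff_distrib)
  then show ?thesis using fd assms
    by (simp add: D_smooth smooth_on_cmult open_S distrib_left sum_distrib_left mult.left_commute)
qed

lemma D_sum:
  assumes "\<And>i. i \<in> I \<Longrightarrow> smooth_on S (f i)" "x \<in> S"
  shows "D \<xi> (\<lambda>x. \<Sum>i\<in>I. f i x) x = (\<Sum>i\<in>I. D \<xi> (f i) x)"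
  using assms(1)
proof (induction I rule: infinite_finite_induct)
  case (insert i I)
  then have "D \<xi> (\<lambda>x. f i x + (\<Sum>i\<in>I. f i x)) x = D \<xi> (f i) x + D \<xi> (\<lambda>x. \<Sum>i\<in>I. f i x) x"
    by (intro D_add smooth_on_sum open_S assms(2)) simp_all
  with insert show ?case by simp
qed (simp_all add: D_const assms(2))

lemma D_direction:
  assumes "smooth_on S f" "x \<in> S"
  shows "D \<xi> f x = (\<Sum>i\<in>UNIV. \<xi> $ i * D (axis i 1) f x)"
proof -
  have "(\<Sum>i\<in>UNIV. \<xi> $ i * D (axis i 1) f x) = (\<Sum>i\<in>UNIV. \<xi> $ i * frechet_derivative f (at x) (axis i 1))
     + (\<Sum>i\<in>UNIV. \<Sum>\<alpha>\<in>Rp. \<xi> $ i * (\<kappa> \<alpha> * inner \<alpha> (axis i 1) * dquot \<alpha> f x))"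
    using assms by (simp add: D_smooth distrib_left sum.distrib sum_distrib_left)
  also have "(\<Sum>i\<in>UNIV. \<Sum>\<alpha>\<in>Rp. \<xi> $ i * (\<kappa> \<alpha> * inner \<alpha> (axis i 1) * dquot \<alpha> f x))
      = (\<Sum>\<alpha>\<in>Rp. \<kappa> \<alpha> * inner \<alpha> \<xi> * dquot \<alpha> f x)"
  proof -
    have "inner \<alpha> \<xi> = (\<Sum>i\<in>UNIV. \<xi> $ i * inner \<alpha> (axis i 1))" for \<alpha>
      by (simp add: inner_axis) (simp add: inner_vec_def mult.commute)
    then show ?thesis
      by (subst sum.swap) (simp add: sum_distrib_left sum_distrib_right mult_ac)
  qed
  finally show ?thesis using assms by (simp add: D_smooth smooth_on_imp_frechet_sum[symmetric])
qed

lemma D_coord_mult: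
  assumes f: "smooth_on S f" and x: "x \<in> S"
  shows "D \<xi> (\<lambda>x. x $ j * f x) x = x $ j * D \<xi> f x + dunkl_comm \<xi> j f x"
proof -
  have "frechet_derivative (\<lambda>x. x $ j * f x) (at x) \<xi> = x $ j * frechet_derivative f (at x) \<xi> + \<xi> $ j * f x"
    using frechet_derivative_at[OF has_derivative_mult[OF
          bounded_linear_imp_has_derivative[OF bounded_linear_vec_nth] smooth_on_has_derivative[OF f x]]]
    by (metis (no_types))
  moreover have "(\<Sum>\<alpha>\<in>Rp. \<kappa> \<alpha> * inner \<alpha> \<xi> * dquot \<alpha> (\<lambda>x. x $ j * f x) x)
      = (\<Sum>\<alpha>\<in>Rp. x $ j * (\<kappa> \<alpha> * inner \<alpha> \<xi> * dquot \<alpha> f x)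
          + (2 * \<kappa> \<alpha> * inner \<alpha> \<xi> * \<alpha> $ j / inner \<alpha> \<alpha>) * f (refl \<alpha> x))"
  proof (rule sum.cong)
    fix \<alpha> assume "\<alpha> \<in> Rp"
    show "\<kappa> \<alpha> * inner \<alpha> \<xi> * dquot \<alpha> (\<lambda>x. x $ j * f x) x = x $ j * (\<kappa> \<alpha> * inner \<alpha> \<xi> * dquot \<alpha> f x)
          + (2 * \<kappa> \<alpha> * inner \<alpha> \<xi> * \<alpha> $ j / inner \<alpha> \<alpha>) * f (refl \<alpha> x)"
      unfolding dquot_coord_mult[OF f x Rp_nonzero[OF \<open>\<alpha> \<in> Rp\<close>]] by (simp add: algebra_simps)
  qed simp
  ultimately show ?thesis
    using f x by (simp add: D_smooth smooth_on_mult smooth_on_coord open_S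
        dunkl_comm_def sum.distrib sum_distrib_left distrib_left)
qed

text \<open>Equivariance: each divided difference moves from the root \<alpha> to
  \<open>refl \<beta> \<alpha>\<close>. Since \<open>dquot\<close> and the inner product are both
  odd in the root, the summand is even and the sum can be re-indexed over \<open>Rp\<close>.\<close>

lemma D_refl:
  assumes f: "smooth_on S f" and x: "x \<in> S" and \<beta>: "\<beta> \<in> R"
  shows "D \<xi> (\<lambda>x. f (refl \<beta> x)) x = D (refl \<beta> \<xi>) f (refl \<beta> x)"
proof -
  have "frechet_derivative (\<lambda>x. f (refl \<beta> x)) (at x) \<xi> = frechet_derivative f (at (refl \<beta> x)) (refl \<beta> \<xi>)"
    using frechet_derivative_at[OF has_derivative_compose[OF
          bounded_linear_imp_has_derivative[OF bounded_linear_refl] smooth_on_has_derivative[OF f refl_S[OF x]]]]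
    by (metis (no_types))
  moreover have "(\<Sum>\<alpha>\<in>Rp. \<kappa> \<alpha> * inner \<alpha> \<xi> * dquot \<alpha> (\<lambda>x. f (refl \<beta> x)) x)
     = (\<Sum>\<alpha>\<in>Rp. \<kappa> \<alpha> * inner \<alpha> (refl \<beta> \<xi>) * dquot \<alpha> f (refl \<beta> x))"
  proof -
    have "(\<Sum>\<alpha>\<in>Rp. \<kappa> \<alpha> * inner \<alpha> \<xi> * dquot \<alpha> (\<lambda>x. f (refl \<beta> x)) x)
      = (\<Sum>\<alpha>\<in>Rp. \<kappa> (refl \<beta> \<alpha>) * inner (refl \<beta> \<alpha>) (refl \<beta> \<xi>) * dquot (refl \<beta> \<alpha>) f (refl \<beta> x))"
    proof (rule sum.cong)
      fix \<alpha> assume "\<alpha> \<in> Rp"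
      then show "\<kappa> \<alpha> * inner \<alpha> \<xi> * dquot \<alpha> (\<lambda>x. f (refl \<beta> x)) x =
         \<kappa> (refl \<beta> \<alpha>) * inner (refl \<beta> \<alpha>) (refl \<beta> \<xi>) * dquot (refl \<beta> \<alpha>) f (refl \<beta> x)"
        using kappa_refl[OF \<beta>, of \<alpha>] Rp_subset by (auto simp: dquot_refl[OF f x Rp_nonzero])
    qed simp
    also have "\<dots> = (\<Sum>\<alpha>\<in>Rp. \<kappa> \<alpha> * inner \<alpha> (refl \<beta> \<xi>) * dquot \<alpha> f (refl \<beta> x))"
      by (rule sum_Rp_refl[OF \<beta>]) (simp add: kappa_minus dquot_minus_root f refl_S x root_nonzero)
    finally show ?thesis .
  qed
  ultimately show ?thesis
    using f x by (simp add: D_smooth smooth_on_compose_linear[OF open_S bounded_linear_refl refl_S] refl_S)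
qed

lemma D_comm:
  assumes f: "smooth_on S f" and x: "x \<in> S"
  shows "D \<eta> (dunkl_comm \<xi> j f) x = \<xi> $ j * D \<eta> f x +
     (\<Sum>\<alpha>\<in>Rp. (2 * \<kappa> \<alpha> * inner \<alpha> \<xi> * \<alpha> $ j / inner \<alpha> \<alpha>) * D (refl \<alpha> \<eta>) f (refl \<alpha> x))"
proof -
  have r: "smooth_on S (\<lambda>x. f (refl \<alpha> x))" for \<alpha>
    by (rule smooth_on_compose_linear[OF open_S bounded_linear_refl refl_S f])
  then have c: "smooth_on S (\<lambda>x. c * f (refl \<alpha> x))" for c \<alpha>
    by (intro smooth_on_cmult open_S)
  have "D \<eta> (dunkl_comm \<xi> j f) x = D \<eta> (\<lambda>x. \<xi> $ j * f x) x + D \<eta> (\<lambda>x.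
     (\<Sum>\<alpha>\<in>Rp. (2 * \<kappa> \<alpha> * inner \<alpha> \<xi> * \<alpha> $ j / inner \<alpha> \<alpha>) * f (refl \<alpha> x))) x"
    unfolding dunkl_comm_def[abs_def]
    by (intro D_add smooth_on_cmult smooth_on_sum open_S f c x)
  also have "\<dots> = \<xi> $ j * D \<eta> f x +
     (\<Sum>\<alpha>\<in>Rp. (2 * \<kappa> \<alpha> * inner \<alpha> \<xi> * \<alpha> $ j / inner \<alpha> \<alpha>) * D (refl \<alpha> \<eta>) f (refl \<alpha> x))"
    using Rp_subset by (subst D_sum[OF c x]) (auto simp only: D_cmult[OF f x] D_cmult[OF r x] D_refl[OF f x]
        intro!: arg_cong2[where f="(+)"] sum.cong)
  finally show ?thesis .
qed

lemma Lap_eq: "Lap f = (\<lambda>x. \<Sum>j\<in>UNIV. D (axis j 1) (D (axis j 1) f) x)"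
  by (simp add: fun_eq_iff dunkl_lap_def)

lemma smooth_on_Lap: "smooth_on S f \<Longrightarrow> smooth_on S (Lap f)"
  unfolding Lap_eq by (intro smooth_on_sum open_S smooth_on_D)

lemma smooth_on_Lap_pow: "smooth_on S f \<Longrightarrow> smooth_on S ((Lap ^^ n) f)"
  by (induction n) (simp_all add: smooth_on_Lap)

lemma smooth_on_dunkl_list: "smooth_on S f \<Longrightarrow> smooth_on S (dunkl_list Rp \<kappa> ks f)"
  by (induction ks) (simp_all add: smooth_on_D)

lemma Lap_cong:
  assumes f: "smooth_on S f" and fg: "\<And>y. y \<in> S \<Longrightarrow> f y = g y" and x: "x \<in> S"
  shows "Lap f x = Lap g x"
  unfolding dunkl_lap_def by (intro sum.cong refl D_cong smooth_on_D f fg x)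

lemma Lap_add:
  assumes "smooth_on S f" "smooth_on S g" "x \<in> S"
  shows "Lap (\<lambda>x. f x + g x) x = Lap f x + Lap g x"
proof -
  have "D v (D v (\<lambda>x. f x + g x)) x = D v (D v f) x + D v (D v g) x" for v
    using assms by (subst D_cong[of _ "\<lambda>x. D v f x + D v g x"])
      (auto simp: D_add smooth_on_D smooth_on_add open_S)
  then show ?thesis by (simp add: dunkl_lap_def sum.distrib)
qed

end


section \<open>Functions graded by their order at the origin\<close>

text \<open>For \<open>B\<close> the constants these are the homogeneous polynomials, for \<open>B\<close> the smooth
  functions on \<open>S\<close> they are the powers of the maximal ideal at the origin.\<close>

inductive graded :: "(real^'n) set \<Rightarrow> ((real^'n \<Rightarrow> real) \<Rightarrow> bool) \<Rightarrow> nat \<Rightarrow> (real^'n \<Rightarrow> real) \<Rightarrow> bool"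
  for S B where
  base: "B f \<Longrightarrow> graded S B 0 f"
| coord: "graded S B n f \<Longrightarrow> graded S B (Suc n) (\<lambda>x. x $ j * f x)"
| add: "graded S B n f \<Longrightarrow> graded S B n g \<Longrightarrow> graded S B n (\<lambda>x. f x + g x)"
| cong: "graded S B n f \<Longrightarrow> (\<And>x. x \<in> S \<Longrightarrow> f x = g x) \<Longrightarrow> graded S B n g"

context dunkl_domain
begin

lemma D_refl_direction:
  assumes "smooth_on S f" "x \<in> S"
  shows "D (refl \<alpha> \<xi>) f x = D \<xi> f x - 2 * inner \<alpha> \<xi> / inner \<alpha> \<alpha> * D \<alpha> f x"
  unfolding D_direction[OF assms, of "refl \<alpha> \<xi>"] D_direction[OF assms, of \<xi>] D_direction[OF assms, of \<alpha>]
  by (simp add: refl_def left_diff_distrib sum_subtractf sum_distrib_left mult.assoc)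

lemma smooth_on_dunkl_comm: "smooth_on S f \<Longrightarrow> smooth_on S (dunkl_comm \<xi> j f)"
  unfolding dunkl_comm_def[abs_def]
  by (intro smooth_on_add smooth_on_cmult smooth_on_sum open_S
      smooth_on_compose_linear[OF open_S bounded_linear_refl refl_S]) auto

lemma D_D_coord_mult:
  assumes f: "smooth_on S f" and x: "x \<in> S"
  shows "D \<xi> (D \<eta> (\<lambda>x. x $ k * f x)) x =
    x $ k * D \<xi> (D \<eta> f) x + dunkl_comm \<xi> k (D \<eta> f) x + D \<xi> (dunkl_comm \<eta> k f) x"
proof -
  have s: "smooth_on S (\<lambda>x. x $ k * f x)" by (intro smooth_on_mult smooth_on_coord open_S f)
  have s': "smooth_on S (\<lambda>x. x $ k * D \<eta> f x)" by (intro smooth_on_mult smooth_on_coord open_S smooth_on_D f)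
  have "D \<xi> (D \<eta> (\<lambda>x. x $ k * f x)) x = D \<xi> (\<lambda>x. x $ k * D \<eta> f x + dunkl_comm \<eta> k f x) x"
    by (rule D_cong[OF smooth_on_D[OF s] _ x]) (rule D_coord_mult[OF f])
  also have "\<dots> = D \<xi> (\<lambda>x. x $ k * D \<eta> f x) x + D \<xi> (dunkl_comm \<eta> k f) x"
    by (rule D_add[OF s' smooth_on_dunkl_comm[OF f] x])
  finally show ?thesis using D_coord_mult[OF smooth_on_D[OF f] x] by simp
qed

text \<open>Expanding \<open>D (refl \<alpha> \<xi>)\<close> as D \<xi> minus a multiple of D
  \<alpha>, the correction carries the product <\<alpha>,\<xi>><\<alpha>,\<eta>>, which is
  symmetric; the remaining terms are exchanged by swapping \<xi> and \<eta>. Hence the commutator of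
  D \<xi> and D \<eta> commutes with coordinates.\<close>

lemma D_D_coord_mult_symmetric:
  assumes f: "smooth_on S f" and x: "x \<in> S"
  shows "dunkl_comm \<xi> k (D \<eta> f) x + D \<xi> (dunkl_comm \<eta> k f) x =
    dunkl_comm \<eta> k (D \<xi> f) x + D \<eta> (dunkl_comm \<xi> k f) x"
proof -
  have *: "(2 * \<kappa> \<alpha> * inner \<alpha> \<xi> * \<alpha> $ k / inner \<alpha> \<alpha>) * D \<eta> f (refl \<alpha> x)
      + (2 * \<kappa> \<alpha> * inner \<alpha> \<eta> * \<alpha> $ k / inner \<alpha> \<alpha>) * D (refl \<alpha> \<xi>) f (refl \<alpha> x)
    = (2 * \<kappa> \<alpha> * inner \<alpha> \<eta> * \<alpha> $ k / inner \<alpha> \<alpha>) * D \<xi> f (refl \<alpha> x)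
      + (2 * \<kappa> \<alpha> * inner \<alpha> \<xi> * \<alpha> $ k / inner \<alpha> \<alpha>) * D (refl \<alpha> \<eta>) f (refl \<alpha> x)" for \<alpha>
    unfolding D_refl_direction[OF f refl_S[OF x]] by (simp add: algebra_simps)
  have "(\<Sum>\<alpha>\<in>Rp. (2 * \<kappa> \<alpha> * inner \<alpha> \<xi> * \<alpha> $ k / inner \<alpha> \<alpha>) * D \<eta> f (refl \<alpha> x))
      + (\<Sum>\<alpha>\<in>Rp. (2 * \<kappa> \<alpha> * inner \<alpha> \<eta> * \<alpha> $ k / inner \<alpha> \<alpha>) * D (refl \<alpha> \<xi>) f (refl \<alpha> x))
    = (\<Sum>\<alpha>\<in>Rp. (2 * \<kappa> \<alpha> * inner \<alpha> \<eta> * \<alpha> $ k / inner \<alpha> \<alpha>) * D \<xi> f (refl \<alpha> x))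
      + (\<Sum>\<alpha>\<in>Rp. (2 * \<kappa> \<alpha> * inner \<alpha> \<xi> * \<alpha> $ k / inner \<alpha> \<alpha>) * D (refl \<alpha> \<eta>) f (refl \<alpha> x))"
    unfolding sum.distrib[symmetric] using * by (intro sum.cong HOL.refl)
  then show ?thesis
    unfolding D_comm[OF f x] unfolding dunkl_comm_def by linarith
qed

lemma Lap_coord_mult:
  assumes f: "smooth_on S f" and x: "x \<in> S"
  shows "Lap (\<lambda>x. x $ k * f x) x = x $ k * Lap f x + 2 * D (axis k 1) f x"
proof -
  let ?c = "\<lambda>\<alpha> j. 2 * \<kappa> \<alpha> * inner \<alpha> (axis j 1) * \<alpha> $ k / inner \<alpha> \<alpha>"
  \<comment> \<open>The weights \<alpha>_j assemble the D_j into D \<alpha> and the reflected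
    directions into D (refl \<alpha> \<alpha>) = - D \<alpha>, so all reflection terms cancel after
    summing over j.\<close>
  have 1: "(\<Sum>j\<in>UNIV. \<alpha> $ j * D (axis j 1) f y + \<alpha> $ j * D (refl \<alpha> (axis j 1)) f y) = 0"
    if "y \<in> S" "\<alpha> \<in> Rp" for \<alpha> y
  proof -
    have a: "inner \<alpha> \<alpha> \<noteq> 0" using Rp_nonzero[OF that(2)] by simp
    have "(\<Sum>j\<in>UNIV. \<alpha> $ j * D (axis j 1) f y + \<alpha> $ j * D (refl \<alpha> (axis j 1)) f y)
       = 2 * (\<Sum>j\<in>UNIV. \<alpha> $ j * D (axis j 1) f y) - 2 * (\<Sum>j\<in>UNIV. \<alpha> $ j * \<alpha> $ j) / inner \<alpha> \<alpha> * D \<alpha> f y"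
      unfolding D_refl_direction[OF f that(1)]
      by (simp add: inner_axis algebra_simps sum_subtractf sum.distrib sum_distrib_left sum_divide_distrib sum_distrib_right)
    also have "(\<Sum>j\<in>UNIV. \<alpha> $ j * \<alpha> $ j) = inner \<alpha> \<alpha>" by (simp add: inner_vec_def)
    finally show ?thesis using a D_direction[OF f that(1), of \<alpha>] by simp
  qed
  have "(\<Sum>j\<in>UNIV. \<Sum>\<alpha>\<in>Rp. ?c \<alpha> j * D (axis j 1) f (refl \<alpha> x) + ?c \<alpha> j * D (refl \<alpha> (axis j 1)) f (refl \<alpha> x))
     = (\<Sum>\<alpha>\<in>Rp. (2 * \<kappa> \<alpha> * \<alpha> $ k / inner \<alpha> \<alpha>) *
          (\<Sum>j\<in>UNIV. \<alpha> $ j * D (axis j 1) f (refl \<alpha> x) + \<alpha> $ j * D (refl \<alpha> (axis j 1)) f (refl \<alpha> x)))"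
    by (subst sum.swap) (simp add: sum_distrib_left inner_axis algebra_simps)
  then have 2: "(\<Sum>j\<in>UNIV. \<Sum>\<alpha>\<in>Rp. ?c \<alpha> j * D (axis j 1) f (refl \<alpha> x) + ?c \<alpha> j * D (refl \<alpha> (axis j 1)) f (refl \<alpha> x)) = 0"
    using 1[OF refl_S[OF x]] by simp
  have "Lap (\<lambda>x. x $ k * f x) x = (\<Sum>j\<in>UNIV. x $ k * D (axis j 1) (D (axis j 1) f) x
      + 2 * (axis j 1 $ k * D (axis j 1) f x)
      + (\<Sum>\<alpha>\<in>Rp. ?c \<alpha> j * D (axis j 1) f (refl \<alpha> x) + ?c \<alpha> j * D (refl \<alpha> (axis j 1)) f (refl \<alpha> x)))"
    unfolding dunkl_lap_def D_D_coord_mult[OF f x] D_comm[OF f x]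
    by (intro sum.cong HOL.refl) (simp add: dunkl_comm_def sum.distrib)
  also have "\<dots> = x $ k * Lap f x + 2 * (\<Sum>j\<in>UNIV. axis j 1 $ k * D (axis j 1) f x)"
    unfolding sum.distrib[of _ _ UNIV] 2 by (simp add: dunkl_lap_def sum_distrib_left)
  also have "(\<Sum>j\<in>UNIV. axis j 1 $ k * D (axis j 1) f x) = D (axis k 1) f x"
  proof -
    have "(\<Sum>j\<in>UNIV. axis j 1 $ k * D (axis j 1) f x) = (\<Sum>j\<in>UNIV. if j = k then D (axis j 1) f x else 0)"
      by (intro sum.cong HOL.refl) (simp add: axis_def)
    then show ?thesis by simp
  qed
  finally show ?thesis .
qed

end

text \<open>\<open>B\<close> is the layer of order zero. The axiom \<open>B_coord_D\<close> serves
  the lowest step of \<open>graded_D\<close>: for f in \<open>B\<close>, D maps x_j f to x_j D f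
  plus reflected copies of f, and this has to lie in \<open>B\<close> again. For constants the first
  term is zero.\<close>

locale graded_setting = dunkl_domain R Rp \<kappa> S
  for R Rp :: "(real^'n) set" and \<kappa> and S :: "(real^'n) set" +
  fixes B :: "(real^'n \<Rightarrow> real) \<Rightarrow> bool"
  assumes B_smooth: "B f \<Longrightarrow> smooth_on S f"
    and B_cong: "B f \<Longrightarrow> (\<And>x. x \<in> S \<Longrightarrow> f x = g x) \<Longrightarrow> B g"
    and B_zero: "B (\<lambda>_. 0)"
    and B_add: "B f \<Longrightarrow> B g \<Longrightarrow> B (\<lambda>x. f x + g x)"
    and B_cmult: "B f \<Longrightarrow> B (\<lambda>x. c * f x)"
    and B_refl: "B f \<Longrightarrow> B (\<lambda>x. f (refl \<alpha> x))"
    and B_D: "B f \<Longrightarrow> B (D \<xi> f)"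
    and B_coord_D: "B f \<Longrightarrow> B (\<lambda>x. x $ j * D \<xi> f x)"
begin

lemma graded_smooth: "graded S B n f \<Longrightarrow> smooth_on S f"
proof (induction rule: graded.induct)
  case (cong n f g)
  then show ?case using smooth_on_cong[OF open_S] by blast
qed (simp_all add: B_smooth smooth_on_add smooth_on_mult smooth_on_coord open_S)

lemma graded_zero: "graded S B n (\<lambda>_. 0)"
proof (induction n)
  case 0
  show ?case by (rule graded.base) (rule B_zero)
next
  case (Suc n)
  show ?case by (rule graded.cong[OF graded.coord[OF Suc]]) simp
qed

lemma graded_cmult: "graded S B n f \<Longrightarrow> graded S B n (\<lambda>x. c * f x)"
proof (induction rule: graded.induct)
  case (base f)
  then show ?case by (intro graded.base B_cmult)
next
  case (coord n f j)
  show ?case by (rule graded.cong[OF graded.coord[OF coord.IH, of j]]) simp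
next
  case (add n f g)
  show ?case by (rule graded.cong[OF graded.add[OF add.IH]]) (simp add: distrib_left)
next
  case (cong n f g)
  show ?case by (rule graded.cong[OF cong.IH]) (simp add: cong)
qed

lemma graded_sum: "(\<And>i. i \<in> I \<Longrightarrow> graded S B n (f i)) \<Longrightarrow> graded S B n (\<lambda>x. \<Sum>i\<in>I. f i x)"
proof (induction I rule: infinite_finite_induct)
  case (insert i I)
  then have "graded S B n (\<lambda>x. f i x + (\<Sum>i\<in>I. f i x))" by (intro graded.add) simp_all
  with insert.hyps show ?case by simp
qed (simp_all add: graded_zero)

lemma graded_inner_mult: "graded S B n f \<Longrightarrow> graded S B (Suc n) (\<lambda>x. inner a x * f x)"
  by (rule graded.cong[OF graded_sum[of UNIV _ "\<lambda>j x. a $ j * (x $ j * f x)"]])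
    (auto intro: graded_cmult graded.coord simp: inner_vec_def sum_distrib_right mult.assoc)

lemma graded_refl: "graded S B n f \<Longrightarrow> graded S B n (\<lambda>x. f (refl \<alpha> x))"
proof (induction rule: graded.induct)
  case (base f)
  then show ?case by (intro graded.base B_refl)
next
  case (coord n f j)
  have "refl \<alpha> x $ j = inner (refl \<alpha> (axis j 1)) x" for x
    unfolding inner_refl_left by (simp add: inner_axis' )
  with graded_inner_mult[OF coord.IH, of "refl \<alpha> (axis j 1)"] show ?case by simp
next
  case (add n f g)
  then show ?case by (intro graded.add)
next
  case (cong n f g)
  show ?case by (rule graded.cong[OF cong.IH]) (simp add: cong refl_S)
qed

lemma graded_0: "graded S B n f \<Longrightarrow> n = 0 \<Longrightarrow> B f"
proof (induction rule: graded.induct)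
  case (cong n f g)
  then show ?case using B_cong by blast
qed (simp_all add: B_add)

text \<open>The commutator with a coordinate consists of reflected copies of \<open>f\<close>, which
  keep the order, so one application of D costs one order at most. Subtraction is truncated: order
  zero stays order zero.\<close>

lemma graded_D: "graded S B n f \<Longrightarrow> graded S B (n - 1) (D \<xi> f)"
proof (induction rule: graded.induct)
  case (base f)
  then show ?case by (simp add: graded.base B_D)
next
  case (coord n f j)
  have f: "smooth_on S f" by (rule graded_smooth[OF coord.hyps])
  have 1: "graded S B n (\<lambda>x. x $ j * D \<xi> f x)"
  proof (cases n)
    case 0
    then show ?thesis using graded_0[OF coord.hyps] by (simp add: graded.base B_coord_D)
  next
    case (Suc m)
    then show ?thesis using graded.coord[OF coord.IH, of j] by simp
  qed
  have 2: "graded S B n (dunkl_comm \<xi> j f)"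
    unfolding dunkl_comm_def[abs_def]
    by (rule graded.add[OF graded_cmult[OF coord.hyps] graded_sum[OF graded_cmult[OF graded_refl[OF coord.hyps]]]])
  have "graded S B n (D \<xi> (\<lambda>x. x $ j * f x))"
    by (rule graded.cong[OF graded.add[OF 1 2]]) (simp add: D_coord_mult f)
  then show ?case by simp
next
  case (add n f g)
  show ?case
    by (rule graded.cong[OF graded.add[OF add.IH]]) (simp add: D_add graded_smooth[OF add.hyps(1)] graded_smooth[OF add.hyps(2)])
next
  case (cong n f g)
  show ?case
    by (rule graded.cong[OF cong.IH]) (rule D_cong[OF graded_smooth[OF cong.hyps(1)] cong.hyps(2)])
qed

lemma graded_Lap: "graded S B n f \<Longrightarrow> graded S B (n - 2) (Lap f)"
proof -
  assume "graded S B n f"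
  then have "graded S B (n - 1 - 1) (D v (D v f))" for v by (intro graded_D)
  then have "graded S B (n - 2) (D v (D v f))" for v by (simp add: numeral_2_eq_2)
  then show ?thesis unfolding Lap_eq by (intro graded_sum)
qed

lemma graded_Lap_pow: "graded S B n f \<Longrightarrow> graded S B (n - 2 * k) ((Lap ^^ k) f)"
proof (induction k)
  case (Suc k)
  then show ?case using graded_Lap[of "n - 2 * k"] by (simp add: diff_diff_add[symmetric] add.commute)
qed simp

lemma graded_dunkl_list: "graded S B n f \<Longrightarrow> graded S B (n - length ks) (dunkl_list Rp \<kappa> ks f)"
proof (induction ks)
  case (Cons k ks)
  then show ?case using graded_D[of "n - length ks"] by simp
qed simp

lemma graded_at_0: "graded S B n f \<Longrightarrow> n > 0 \<Longrightarrow> f 0 = 0"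
  by (induction rule: graded.induct) (auto simp: zero_S)

lemma graded_bound:
  assumes "graded S B n f" "cball 0 \<delta> \<subseteq> S"
  shows "\<exists>C. \<forall>x\<in>cball 0 \<delta>. \<bar>f x\<bar> \<le> C * norm x ^ n"
  using assms(1)
proof (induction rule: graded.induct)
  case (base f)
  have "compact (f ` cball 0 \<delta>)"
    by (intro compact_continuous_image compact_cball
        continuous_on_subset[OF smooth_on_continuous[OF B_smooth[OF base]] assms(2)])
  then have "bounded (f ` cball 0 \<delta>)" by (rule compact_imp_bounded)
  then show ?case by (auto simp: bounded_iff)
next
  case (coord n f j)
  then obtain C where C: "\<And>x. x \<in> cball 0 \<delta> \<Longrightarrow> \<bar>f x\<bar> \<le> C * norm x ^ n" by blast
  have "\<bar>x $ j * f x\<bar> \<le> C * norm x ^ Suc n" if "x \<in> cball 0 \<delta>" for x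
    using mult_mono[OF component_le_norm_cart[of x j] C[OF that]] by (simp add: abs_mult mult_ac)
  then show ?case by blast
next
  case (add n f g)
  then obtain C C' where C: "\<And>x. x \<in> cball 0 \<delta> \<Longrightarrow> \<bar>f x\<bar> \<le> C * norm x ^ n"
    "\<And>x. x \<in> cball 0 \<delta> \<Longrightarrow> \<bar>g x\<bar> \<le> C' * norm x ^ n" by blast
  have "\<bar>f x + g x\<bar> \<le> (C + C') * norm x ^ n" if "x \<in> cball 0 \<delta>" for x
    using C[OF that] by (simp add: distrib_right)
  then show ?case by blast
next
  case (cong n f g)
  then show ?case using assms(2) by (metis subsetD)
qed

end

section \<open>Dunkl operators on homogeneous polynomials\<close>

definition is_const :: "(real^'n \<Rightarrow> real) \<Rightarrow> bool" where
  "is_const f \<longleftrightarrow> (\<exists>c. f = (\<lambda>_. c))"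

abbreviation hpoly :: "nat \<Rightarrow> (real^'n \<Rightarrow> real) \<Rightarrow> bool" where
  "hpoly \<equiv> graded UNIV is_const"

lemma hpoly_const: "hpoly 0 (\<lambda>_. c)"
  by (rule graded.base) (auto simp: is_const_def)

lemma hpoly_homogeneous: "hpoly k f \<Longrightarrow> f (t *\<^sub>R x) = t ^ k * f x"
proof (induction rule: graded.induct)
  case (cong n f g)
  then show ?case by (simp add: fun_eq_iff[symmetric])
qed (auto simp: is_const_def algebra_simps)

context dunkl_setting
begin

lemma dunkl_domain_UNIV: "dunkl_domain R Rp \<kappa> UNIV"
  by unfold_locales simp_all

lemma dunkl_domain_ball: "\<epsilon> > 0 \<Longrightarrow> dunkl_domain R Rp \<kappa> (ball 0 \<epsilon>)"
  by unfold_locales simp_all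

sublocale hp: graded_setting R Rp \<kappa> UNIV is_const
proof -
  interpret dunkl_domain R Rp \<kappa> UNIV by (rule dunkl_domain_UNIV)
  have const_D: "D \<xi> (\<lambda>_. c) = (\<lambda>_. 0)" for \<xi> c by (simp add: fun_eq_iff D_const)
  show "graded_setting R Rp \<kappa> UNIV is_const"
  proof unfold_locales
    show "is_const g" if "is_const f" "\<And>x. x \<in> UNIV \<Longrightarrow> f x = g x" for f g :: "real^'n \<Rightarrow> real"
      using that by (auto simp: is_const_def fun_eq_iff)
  qed (auto simp: is_const_def const_D)
qed

lemma graded_setting_ball:
  assumes "\<epsilon> > 0"
  shows "graded_setting R Rp \<kappa> (ball 0 \<epsilon>) (smooth_on (ball 0 \<epsilon>))"
proof -
  interpret dunkl_domain R Rp \<kappa> "ball 0 \<epsilon>" by (rule dunkl_domain_ball[OF assms])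
  show ?thesis
  proof unfold_locales
    show "smooth_on (ball 0 \<epsilon>) g" if "smooth_on (ball 0 \<epsilon>) f" "\<And>x. x \<in> ball 0 \<epsilon> \<Longrightarrow> f x = g x"
      for f g :: "real^'n \<Rightarrow> real"
      by (rule smooth_on_cong[OF open_ball that(2,1)])
    show "smooth_on (ball 0 \<epsilon>) (\<lambda>x. x $ j * D \<xi> f x)" if "smooth_on (ball 0 \<epsilon>) f" for f j \<xi>
      by (intro smooth_on_mult smooth_on_coord smooth_on_D that open_ball)
  qed (auto intro: smooth_on_add smooth_on_cmult smooth_on_D
        smooth_on_compose_linear[OF open_S bounded_linear_refl refl_S])
qed

lemmas hpoly_smooth = hp.graded_smooth

lemma hpoly_continuous: "hpoly k (f :: real^'n \<Rightarrow> real) \<Longrightarrow> continuous_on UNIV f"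
  by (rule smooth_on_continuous[OF hpoly_smooth])

lemma hpoly_mult: "hpoly a (f :: real^'n \<Rightarrow> real) \<Longrightarrow> hpoly b g \<Longrightarrow> hpoly (a + b) (\<lambda>x. f x * g x)"
proof (induction rule: graded.induct)
  case (base f)
  then obtain c where "f = (\<lambda>_. c)" by (auto simp: is_const_def)
  with hp.graded_cmult[OF base.prems, of c] show ?case by simp
next
  case (coord n f j)
  from graded.coord[OF coord.IH[OF coord.prems], of j] show ?case by (simp add: mult.assoc)
next
  case (add n f g)
  from graded.add[OF add.IH[OF add.prems]] show ?case by (simp add: distrib_right)
next
  case (cong n f g)
  then show ?case by (metis UNIV_I ext)
qed

lemma D_hpoly_0: "hpoly 0 f \<Longrightarrow> D \<xi> f = (\<lambda>_. 0)"
  using hp.graded_0[of 0 f] hp.D_const[OF UNIV_I] by (auto simp: is_const_def)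

lemma D_zero: "D \<xi> (\<lambda>_. 0) = (\<lambda>_. 0)"
  by (simp add: fun_eq_iff hp.D_const)

lemma Lap_zero: "Lap (\<lambda>_. 0) = (\<lambda>_. 0)"
  by (simp add: hp.Lap_eq D_zero)

lemma Lap_pow_zero: "(Lap ^^ n) (\<lambda>_. 0) = (\<lambda>_. 0)"
  by (induction n) (simp_all add: Lap_zero)

text \<open>\<open>graded_dunkl_list\<close> records only the truncated degree 0 here. The vanishing
  comes from the first operator that meets a constant.\<close>

lemma dunkl_list_hpoly_eq_0:
  assumes "hpoly n f" "n < length ks"
  shows "dunkl_list Rp \<kappa> ks f = (\<lambda>_. 0)"
  using assms(2)
proof (induction ks)
  case (Cons k ks)
  show ?case
  proof (cases "n < length ks")
    case True
    then show ?thesis using Cons.IH by (simp add: D_zero)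
  next
    case False
    then show ?thesis
      using Cons.prems hp.graded_dunkl_list[OF assms(1), of ks] by (simp add: D_hpoly_0)
  qed
qed simp

lemma Lap_hpoly_low:
  assumes "hpoly n f" "n < 2"
  shows "Lap f = (\<lambda>_. 0)"
proof -
  have "hpoly 0 (D v f)" for v using hp.graded_D[OF assms(1), of v] assms(2) by (simp add: less_Suc_eq numeral_2_eq_2 split: nat.splits)
  then show ?thesis by (simp add: hp.Lap_eq D_hpoly_0)
qed

lemma Lap_pow_hpoly_eq_0:
  assumes "hpoly n f" "n < 2 * k"
  shows "(Lap ^^ k) f = (\<lambda>_. 0)"
  using assms(2)
proof (induction k)
  case (Suc k)
  show ?case
  proof (cases "n < 2 * k")
    case True
    then show ?thesis using Suc.IH by (simp add: Lap_zero)
  next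
    case False
    then show ?thesis
      using Suc.prems Lap_hpoly_low[OF hp.graded_Lap_pow[OF assms(1), of k]] by simp
  qed
qed simp

text \<open>The commutator \<open>[D \<xi>, D \<eta>]\<close> commutes with all coordinate multiplications, so it
  vanishes because it kills the constants.\<close>
lemma D_commute: "hpoly k f \<Longrightarrow> D \<xi> (D \<eta> f) = D \<eta> (D \<xi> f)"
proof (induction rule: graded.induct)
  case (base f)
  then show ?case using D_hpoly_0[of f] graded.base[of is_const f UNIV] D_zero by simp
next
  case (coord n f j)
  have "smooth_on UNIV f" by (rule hpoly_smooth[OF coord.hyps])
  from hp.D_D_coord_mult[OF this UNIV_I] hp.D_D_coord_mult_symmetric[OF this UNIV_I, of \<xi> j \<eta>] coord.IH
  show ?case by (simp add: fun_eq_iff)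
next
  case (add n f g)
  note fg = hpoly_smooth[OF add.hyps(1)] hpoly_smooth[OF add.hyps(2)]
  have "D v (\<lambda>x. f x + g x) = (\<lambda>x. D v f x + D v g x)" for v
    using fg by (simp add: fun_eq_iff hp.D_add)
  then show ?case using fg add.IH by (simp add: fun_eq_iff hp.D_add hp.smooth_on_D)
next
  case (cong n f g)
  then show ?case by (metis UNIV_I ext)
qed

lemma Lap_D_commute:
  assumes "hpoly k f"
  shows "Lap (D \<xi> f) = D \<xi> (Lap f)"
proof -
  have "D v (D v (D \<xi> f)) = D \<xi> (D v (D v f))" for v
    using D_commute[OF assms, of v \<xi>] D_commute[OF hp.graded_D[OF assms], of v \<xi> v] by simp
  then show ?thesis
    unfolding hp.Lap_eq by (simp add: fun_eq_iff hp.D_sum hp.smooth_on_D hpoly_smooth[OF assms])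
qed

lemma Lap_dunkl_list_commute:
  assumes "hpoly k f"
  shows "Lap (dunkl_list Rp \<kappa> ks f) = dunkl_list Rp \<kappa> ks (Lap f)"
  by (induction ks) (simp_all add: Lap_D_commute[OF hp.graded_dunkl_list[OF assms]])

lemma Lap_pow_dunkl_list_commute:
  assumes "hpoly k f"
  shows "(Lap ^^ n) (dunkl_list Rp \<kappa> ks f) = dunkl_list Rp \<kappa> ks ((Lap ^^ n) f)"
  by (induction n) (simp_all add: Lap_dunkl_list_commute[OF hp.graded_Lap_pow[OF assms]])

text \<open>Moving x_k past n copies of the Laplacian produces 2 D_k once per copy, and D_k commutes
  with the other copies. At n = 0 the coefficient vanishes, so the truncated exponent
  \<open>n - 1\<close> does no harm.\<close>

lemma Lap_pow_coord_mult:
  assumes "hpoly a f"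
  shows "(Lap ^^ n) (\<lambda>x. x $ k * f x) x =
    x $ k * (Lap ^^ n) f x + 2 * real n * D (axis k 1) ((Lap ^^ (n - 1)) f) x"
proof (induction n arbitrary: x)
  case (Suc n)
  note f = hpoly_smooth[OF hp.graded_Lap_pow[OF assms]]
  have "(Lap ^^ Suc n) (\<lambda>x. x $ k * f x) x = Lap (\<lambda>x. x $ k * (Lap ^^ n) f x
      + 2 * real n * D (axis k 1) ((Lap ^^ (n - 1)) f) x) x"
  proof -
    have "(Lap ^^ n) (\<lambda>x. x $ k * f x) = (\<lambda>x. x $ k * (Lap ^^ n) f x
      + 2 * real n * D (axis k 1) ((Lap ^^ (n - 1)) f) x)" by (rule ext) (rule Suc)
    then show ?thesis by simp
  qed
  also have "\<dots> = Lap (\<lambda>x. x $ k * (Lap ^^ n) f x) x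
      + Lap (\<lambda>x. 2 * real n * D (axis k 1) ((Lap ^^ (n - 1)) f) x) x"
    by (intro hp.Lap_add smooth_on_mult smooth_on_coord smooth_on_cmult hp.smooth_on_D f) simp_all
  also have "Lap (\<lambda>x. x $ k * (Lap ^^ n) f x) x = x $ k * (Lap ^^ Suc n) f x + 2 * D (axis k 1) ((Lap ^^ n) f) x"
    using hp.Lap_coord_mult[OF f UNIV_I] by simp
  also have "Lap (\<lambda>x. 2 * real n * D (axis k 1) ((Lap ^^ (n - 1)) f) x) x
     = 2 * real n * D (axis k 1) ((Lap ^^ n) f) x"
  proof -
    have "D v (D v (\<lambda>x. c * g x)) x = c * D v (D v g) x" if "smooth_on UNIV g" for v c g
    proof -
      have "D v (\<lambda>x. c * g x) = (\<lambda>x. c * D v g x)" using that by (simp add: fun_eq_iff hp.D_cmult)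
      then show ?thesis using that by (simp add: hp.D_cmult hp.smooth_on_D)
    qed
    then have "Lap (\<lambda>x. 2 * real n * D (axis k 1) ((Lap ^^ (n - 1)) f) x) x
      = 2 * real n * Lap (D (axis k 1) ((Lap ^^ (n - 1)) f)) x"
      by (simp add: dunkl_lap_def sum_distrib_left hp.smooth_on_D f)
    also have "\<dots> = 2 * real n * D (axis k 1) ((Lap ^^ n) f) x"
      unfolding Lap_D_commute[OF hp.graded_Lap_pow[OF assms]] by (cases n) simp_all
    finally show ?thesis .
  qed
  finally show ?case by (simp add: algebra_simps)
qed simp

end


section \<open>Lebesgue and spherical integrals\<close>

lemma nn_integral_lborel_shift:
  fixes f :: "'a::euclidean_space \<Rightarrow> ennreal"
  assumes [measurable]: "f \<in> borel_measurable borel"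
  shows "(\<integral>\<^sup>+x. f (x + c) \<partial>lborel) = (\<integral>\<^sup>+x. f x \<partial>lborel)"
proof -
  have "(\<integral>\<^sup>+x. f x \<partial>lborel) = (\<integral>\<^sup>+x. f x \<partial>(distr lborel borel ((+) c)))"
    by (simp add: lborel_distr_plus)
  also have "\<dots> = (\<integral>\<^sup>+x. f (c + x) \<partial>lborel)" by (rule nn_integral_distr) simp_all
  finally show ?thesis by (simp add: add.commute)
qed

lemma measurable_refl [measurable]: "refl \<alpha> \<in> borel_measurable borel"
  by (intro borel_measurable_continuous_onI linear_continuous_on bounded_linear_refl)

text \<open>Uniqueness of translation invariant measures, specialised: by Tonelli, the mass of the unit
  ball times \<open>\<integral>\<^sup>+ g \<circ> refl \<alpha>\<close> is the mass of the reflected unit ball times \<open>\<integral>\<^sup>+ g\<close>.\<close>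
lemma nn_integral_lborel_refl:
  fixes g :: "real^'n \<Rightarrow> ennreal"
  assumes [measurable]: "g \<in> borel_measurable borel"
  shows "(\<integral>\<^sup>+y. g (refl \<alpha> y) \<partial>lborel) = (\<integral>\<^sup>+y. g y \<partial>lborel)"
proof -
  interpret bounded_linear "refl \<alpha>" by (rule bounded_linear_refl)
  define f :: "real^'n \<Rightarrow> ennreal" where "f = indicator (ball 0 1)"
  have [measurable]: "f \<in> borel_measurable borel" unfolding f_def by (rule borel_measurable_indicator) simp
  let ?A = "\<integral>\<^sup>+x. f x \<partial>lborel"
  have A: "?A = emeasure lborel (ball 0 1 :: (real^'n) set)" by (simp add: f_def)
  have "emeasure lborel (ball 0 1 :: (real^'n) set) \<noteq> 0"
    using open_not_negligible[of "ball 0 1 :: (real^'n) set"]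
    by (auto simp: negligible_iff_null_sets null_sets_def)
  moreover have "emeasure lborel (ball 0 1 :: (real^'n) set) < \<infinity>"
    by (rule emeasure_bounded_finite) simp
  ultimately have A0: "?A \<noteq> 0" "?A \<noteq> top" using A by auto
  have "?A * (\<integral>\<^sup>+y. g (refl \<alpha> y) \<partial>lborel) = (\<integral>\<^sup>+x. f x * (\<integral>\<^sup>+y. g (refl \<alpha> y) \<partial>lborel) \<partial>lborel)"
    by (rule nn_integral_multc[symmetric]) simp
  also have "\<dots> = (\<integral>\<^sup>+x. (\<integral>\<^sup>+y. f x * g (refl \<alpha> y + x) \<partial>lborel) \<partial>lborel)"
  proof (rule nn_integral_cong)
    fix x
    have "(\<integral>\<^sup>+y. g (refl \<alpha> y) \<partial>lborel) = (\<integral>\<^sup>+y. g (refl \<alpha> (y + refl \<alpha> x)) \<partial>lborel)"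
      by (rule nn_integral_lborel_shift[symmetric]) simp
    then show "f x * (\<integral>\<^sup>+y. g (refl \<alpha> y) \<partial>lborel) = (\<integral>\<^sup>+y. f x * g (refl \<alpha> y + x) \<partial>lborel)"
      by (simp add: nn_integral_cmult add)
  qed
  also have "\<dots> = (\<integral>\<^sup>+y. (\<integral>\<^sup>+x. f x * g (refl \<alpha> y + x) \<partial>lborel) \<partial>lborel)"
    by (rule lborel_pair.Fubini'[symmetric]) measurable
  also have "\<dots> = (\<integral>\<^sup>+y. (\<integral>\<^sup>+x. f (x - refl \<alpha> y) * g x \<partial>lborel) \<partial>lborel)"
  proof (rule nn_integral_cong)
    fix y
    have "(\<integral>\<^sup>+x. f (x - refl \<alpha> y) * g x \<partial>lborel) = (\<integral>\<^sup>+x. f (x + refl \<alpha> y - refl \<alpha> y) * g (x + refl \<alpha> y) \<partial>lborel)"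
      by (rule nn_integral_lborel_shift[symmetric]) measurable
    then show "(\<integral>\<^sup>+x. f x * g (refl \<alpha> y + x) \<partial>lborel) = (\<integral>\<^sup>+x. f (x - refl \<alpha> y) * g x \<partial>lborel)"
      by (simp add: add.commute)
  qed
  also have "\<dots> = (\<integral>\<^sup>+x. (\<integral>\<^sup>+y. f (x - refl \<alpha> y) * g x \<partial>lborel) \<partial>lborel)"
    by (rule lborel_pair.Fubini') measurable
  also have "\<dots> = (\<integral>\<^sup>+x. ?A * g x \<partial>lborel)"
  proof (rule nn_integral_cong)
    fix x
    \<comment> \<open>Because the reflection is an isometric involution, the reflected translate of
      the unit ball is again a translate of it. Both masses in the comparison therefore agree and
      cancel.\<close>
    have "norm (x - refl \<alpha> y) = norm (y - refl \<alpha> x)" for y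
      using norm_refl[of \<alpha> "x - refl \<alpha> y"] by (simp add: diff norm_minus_commute)
    then have "f (x - refl \<alpha> y) = f (y + (- refl \<alpha> x))" for y
      by (simp add: f_def indicator_def)
    then have "(\<integral>\<^sup>+y. f (x - refl \<alpha> y) \<partial>lborel) = ?A"
      using nn_integral_lborel_shift[of f "- refl \<alpha> x"] by simp
    then show "(\<integral>\<^sup>+y. f (x - refl \<alpha> y) * g x \<partial>lborel) = ?A * g x"
      by (subst nn_integral_multc) simp_all
  qed
  also have "\<dots> = ?A * (\<integral>\<^sup>+x. g x \<partial>lborel)" by (rule nn_integral_cmult) simp
  finally show ?thesis using A0 by (simp add: ennreal_mult_cancel_left)
qed

lemma distr_lborel_refl: "distr lborel borel (refl \<alpha>) = lborel"
proof (rule measure_eqI)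
  fix X assume "X \<in> sets (distr lborel borel (refl \<alpha>))"
  then have X: "X \<in> sets borel" by simp
  have "emeasure (distr lborel borel (refl \<alpha>)) X = (\<integral>\<^sup>+x. indicator X x \<partial>distr lborel borel (refl \<alpha>))"
    using X by simp
  also have "\<dots> = (\<integral>\<^sup>+x. indicator X (refl \<alpha> x) \<partial>lborel)" using X by (intro nn_integral_distr) simp_all
  also have "\<dots> = emeasure lborel X" using X nn_integral_lborel_refl[of "indicator X" \<alpha>] by simp
  finally show "emeasure (distr lborel borel (refl \<alpha>)) X = emeasure lborel X" .
qed simp

lemma integral_lborel_refl:
  fixes f :: "real^'n \<Rightarrow> real"
  assumes "f \<in> borel_measurable borel"
  shows "(\<integral>x. f (refl \<alpha> x) \<partial>lborel) = (\<integral>x. f x \<partial>lborel)"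
  using integral_distr[of "refl \<alpha>" lborel borel f] assms by (simp add: distr_lborel_refl)

lemma integral_lborel_scale:
  fixes f :: "real^'n \<Rightarrow> real"
  assumes [measurable]: "f \<in> borel_measurable borel" and t: "t > 0"
  shows "(\<integral>x. f x \<partial>lborel) = t ^ CARD('n) * (\<integral>x. f (t *\<^sub>R x) \<partial>lborel)"
proof -
  have "(\<integral>x. f x \<partial>lborel) = (\<integral>x. f x \<partial>density (distr lborel borel (\<lambda>x. 0 + t *\<^sub>R x)) (\<lambda>_. ennreal (t ^ CARD('n))))"
    using lborel_affine[of t "0 :: real^'n"] t by (simp add: ennreal_power)
  also have "\<dots> = (\<integral>x. t ^ CARD('n) *\<^sub>R f x \<partial>distr lborel borel (\<lambda>x. 0 + t *\<^sub>R x))"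
    using t by (intro integral_density) auto
  also have "\<dots> = (\<integral>x. t ^ CARD('n) *\<^sub>R f (t *\<^sub>R x) \<partial>lborel)"
    by (subst integral_distr) simp_all
  finally show ?thesis by simp
qed

lemma integrable_indicator_bounded:
  fixes f :: "real^'n \<Rightarrow> real"
  assumes "bounded S" "S \<in> sets borel" "continuous_on S f" "\<And>x. x \<in> S \<Longrightarrow> \<bar>f x\<bar> \<le> C"
  shows "integrable lborel (\<lambda>x. indicator S x * f x)"
proof -
  have "integrable lborel (\<lambda>x. indicator S x *\<^sub>R (indicator S x *\<^sub>R f x))"
  proof (rule integrableI_bounded_set_indicator)
    show "(\<lambda>x. indicator S x *\<^sub>R f x) \<in> borel_measurable lborel"
      using borel_measurable_continuous_on_indicator[OF assms(2,3)] by simp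
    show "emeasure lborel S < \<infinity>" by (rule emeasure_bounded_finite[OF assms(1)])
    show "AE x in lborel. x \<in> S \<longrightarrow> norm (indicator S x *\<^sub>R f x) \<le> C" using assms(4) by simp
  qed (use assms(2) in simp)
  then show ?thesis by (simp add: mult.assoc[symmetric] indicator_inter_arith[symmetric])
qed

lemma integrable_continuous_on_bounded:
  fixes f :: "real^'n \<Rightarrow> real"
  assumes "bounded S" "S \<in> sets borel" "continuous_on UNIV f"
  shows "integrable lborel (\<lambda>x. indicator S x * f x)"
proof -
  have "compact (f ` closure S)"
    using assms by (intro compact_continuous_image continuous_on_subset[OF assms(3)])
      (auto simp: compact_closure)
  then obtain C where "\<And>x. x \<in> closure S \<Longrightarrow> \<bar>f x\<bar> \<le> C"
    using compact_imp_bounded bounded_iff by (metis imageI real_norm_def)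
  then show ?thesis
    using closure_subset[of S] by (intro integrable_indicator_bounded[OF assms(1,2) continuous_on_subset[OF assms(3)]]) auto
qed

lemma integrable_continuous_support:
  fixes f :: "real^'n \<Rightarrow> real"
  assumes "continuous_on UNIV f" "\<And>x. x \<notin> cball 0 r \<Longrightarrow> f x = 0"
  shows "integrable lborel f"
proof -
  have "(\<lambda>x. indicator (cball 0 r) x * f x) = f" using assms(2) by (auto simp: fun_eq_iff indicator_def)
  then show ?thesis using integrable_continuous_on_bounded[of "cball 0 r" f] assms(1) by simp
qed

section \<open>Integrals over the unit sphere and polar coordinates\<close>

definition sphere_integrable :: "(real^'n \<Rightarrow> real) \<Rightarrow> bool" where
  "sphere_integrable g \<longleftrightarrow> integrable lborel (\<lambda>x. indicator (ball 0 1 - {0}) x * g (x /\<^sub>R norm x))"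

lemma continuous_on_radial:
  assumes "continuous_on (sphere 0 1) g"
  shows "continuous_on (- {0}) (\<lambda>x :: real^'n. g (x /\<^sub>R norm x))"
  by (rule continuous_on_compose2[OF assms]) (auto intro!: continuous_intros, metis left_inverse norm_eq_zero)

lemma sphere_integrable_continuous:
  fixes g :: "real^'n \<Rightarrow> real"
  assumes "continuous_on (sphere 0 1) g"
  shows "sphere_integrable g"
proof -
  have "bounded (g ` sphere 0 1)"
    by (intro compact_imp_bounded compact_continuous_image assms compact_sphere)
  then obtain C where "\<forall>y\<in>g ` sphere 0 1. norm y \<le> C" unfolding bounded_iff by blast
  then have "\<bar>g (x /\<^sub>R norm x)\<bar> \<le> C" if "x \<noteq> 0" for x using that by simp
  then show ?thesis unfolding sphere_integrable_def
    by (intro integrable_indicator_bounded[where C=C] continuous_on_subset[OF continuous_on_radial[OF assms]])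
      (auto intro: bounded_subset[OF bounded_ball])
qed

lemma sphere_integral_add:
  assumes "sphere_integrable f" "sphere_integrable g"
  shows "sphere_integral (\<lambda>x. f x + g x) = sphere_integral f + sphere_integral g"
  using assms by (simp add: sphere_integral_def sphere_integrable_def distrib_left)

lemma sphere_integral_cmult: "sphere_integral (\<lambda>x. c * f x) = c * sphere_integral f"
  by (simp add: sphere_integral_def mult.left_commute)

lemma sphere_integral_cong:
  assumes "\<And>x. norm x = 1 \<Longrightarrow> f x = g x"
  shows "sphere_integral f = sphere_integral g"
proof -
  have "(\<lambda>x. indicator (ball 0 1 - {0}) x * f (x /\<^sub>R norm x)) = (\<lambda>x. indicator (ball 0 1 - {0}) x * g (x /\<^sub>R norm x))"
  proof
    fix x
    show "indicator (ball 0 1 - {0}) x * f (x /\<^sub>R norm x) = indicator (ball 0 1 - {0}) x * g (x /\<^sub>R norm x)"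
      using assms[of "x /\<^sub>R norm x"] by (cases "x = 0") simp_all
  qed
  then show ?thesis by (simp only: sphere_integral_def)
qed

lemma sphere_integral_bound:
  fixes g :: "real^'n \<Rightarrow> real"
  assumes "\<And>x. norm x = 1 \<Longrightarrow> \<bar>g x\<bar> \<le> C" "sphere_integrable g"
  shows "\<bar>sphere_integral g\<bar> \<le> C * (real CARD('n) * measure lborel (ball 0 1 :: (real^'n) set))"
proof -
  have C: "C \<ge> 0" using assms(1)[of "axis undefined 1"] by simp
  have fin: "emeasure lborel (ball 0 1 :: (real^'n) set) < \<infinity>" by (rule emeasure_bounded_finite) simp
  have "norm (\<integral>x. indicator (ball 0 1 - {0}) x * g (x /\<^sub>R norm x) \<partial>lborel)
      \<le> (\<integral>x. C * indicator (ball 0 1) x \<partial>(lborel :: (real^'n) measure))"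
  proof (rule Bochner_Integration.integral_norm_bound_integral)
    show "integrable lborel (\<lambda>x. indicator (ball 0 1 - {0}) x * g (x /\<^sub>R norm x))"
      using assms(2) by (simp add: sphere_integrable_def)
    show "integrable lborel (\<lambda>x :: real^'n. C * indicator (ball 0 1) x)" using fin by simp
    show "norm (indicator (ball 0 1 - {0}) x * g (x /\<^sub>R norm x)) \<le> C * indicator (ball 0 1) x" for x
      using assms(1)[of "x /\<^sub>R norm x"] C by (auto simp: indicator_def)
  qed
  then show ?thesis
    using mult_left_mono[of _ _ "real CARD('n)"] by (simp add: sphere_integral_def abs_mult mult_ac)
qed

lemma sphere_integral_refl:
  fixes g :: "real^'n \<Rightarrow> real"
  assumes "continuous_on (sphere 0 1) g"
  shows "sphere_integral (\<lambda>x. g (refl \<alpha> x)) = sphere_integral g"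
proof -
  interpret bounded_linear "refl \<alpha>" by (rule bounded_linear_refl)
  let ?G = "\<lambda>x. indicator (ball 0 1 - {0}) x * g (x /\<^sub>R norm x)"
  have "?G \<in> borel_measurable lborel"
    using sphere_integrable_continuous[OF assms] by (auto simp: sphere_integrable_def)
  then have "(\<integral>x. ?G (refl \<alpha> x) \<partial>lborel) = (\<integral>x. ?G x \<partial>lborel)" by (intro integral_lborel_refl) simp
  moreover have "refl \<alpha> x = 0 \<longleftrightarrow> x = 0" for x by (metis norm_eq_zero norm_refl)
  then have "?G (refl \<alpha> x) = indicator (ball 0 1 - {0}) x * g (refl \<alpha> (x /\<^sub>R norm x))" for x
    by (auto simp: indicator_def scaleR)
  ultimately show ?thesis by (simp add: sphere_integral_def)
qed

text \<open>Polar coordinates for homogeneous functions: compare \<open>g\<close> with its radially constant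
  counterpart on the thin shell \<open>1 \<le> norm x < t\<close> and let \<open>t\<close> tend to \<open>1\<close>.\<close>
lemma sphere_integral_homogeneous:
  fixes g :: "real^'n \<Rightarrow> real"
  assumes g: "continuous_on UNIV g" and hom: "\<And>t x. t > 0 \<Longrightarrow> g (t *\<^sub>R x) = t powr s * g x" and s: "s \<ge> 0"
  shows "sphere_integral g = (real CARD('n) + s) * (\<integral>x. indicator (ball 0 1) x * g x \<partial>lborel)"
proof -
  let ?d = "CARD('n)"
  define g0 where "g0 = (\<lambda>x :: real^'n. g (x /\<^sub>R norm x))"
  define a where "a = (\<integral>x. indicator (ball 0 1) x * g x \<partial>lborel)"
  define b where "b = (\<integral>x. indicator (ball 0 1 - {0}) x * g0 x \<partial>lborel)"
  have "bounded (g ` sphere 0 1)"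
    by (intro compact_imp_bounded compact_continuous_image continuous_on_subset[OF g] compact_sphere) simp
  then obtain M where "\<forall>y\<in>g ` sphere 0 1. norm y \<le> M" unfolding bounded_iff by blast
  then have M: "\<And>x. norm x = 1 \<Longrightarrow> \<bar>g x\<bar> \<le> M" by simp
  have M0: "M \<ge> 0" using M[of "axis undefined 1"] by simp
  have g0_M: "\<bar>g0 x\<bar> \<le> M" if "x \<noteq> 0" for x using M[of "x /\<^sub>R norm x"] that by (simp add: g0_def)
  have g0: "continuous_on (- {0}) g0"
    unfolding g0_def by (intro continuous_on_radial continuous_on_subset[OF g]) simp
  define V where "V = measure lborel (ball 0 1 :: (real^'n) set)"
  have [measurable]: "g \<in> borel_measurable borel" by (rule borel_measurable_continuous_onI[OF g])
  have int_g: "integrable lborel (\<lambda>x. indicator (ball 0 t) x * g x)" for t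
    by (rule integrable_continuous_on_bounded[OF _ _ g]) simp_all
  have int_g0: "integrable lborel (\<lambda>x. indicator (ball 0 t - {0}) x * g0 x)" for t
    by (rule integrable_indicator_bounded[where C=M])
      (auto intro: bounded_subset[OF bounded_ball] continuous_on_subset[OF g0] g0_M)
  have 1: "(\<integral>x. indicator (ball 0 t) x * g x \<partial>lborel) = t ^ ?d * t powr s * a" if "t > 0" for t
  proof -
    have "(\<integral>x. indicator (ball 0 t) x * g x \<partial>lborel) = t ^ ?d * (\<integral>x. indicator (ball 0 t) (t *\<^sub>R x) * g (t *\<^sub>R x) \<partial>lborel)"
      using that borel_measurable_integrable[OF int_g[of t]] by (intro integral_lborel_scale) simp_all
    also have "(\<lambda>x. indicator (ball 0 t) (t *\<^sub>R x) * g (t *\<^sub>R x)) = (\<lambda>x. t powr s * (indicator (ball 0 1) x * g x))"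
      using that by (auto simp: fun_eq_iff indicator_def hom)
    finally show ?thesis by (simp add: a_def)
  qed
  have 2: "(\<integral>x. indicator (ball 0 t - {0}) x * g0 x \<partial>lborel) = t ^ ?d * b" if "t > 0" for t
  proof -
    have "(\<integral>x. indicator (ball 0 t - {0}) x * g0 x \<partial>lborel)
        = t ^ ?d * (\<integral>x. indicator (ball 0 t - {0}) (t *\<^sub>R x) * g0 (t *\<^sub>R x) \<partial>lborel)"
      using that int_g0[of t] by (intro integral_lborel_scale) (auto dest: borel_measurable_integrable)
    also have "(\<lambda>x. indicator (ball 0 t - {0}) (t *\<^sub>R x) * g0 (t *\<^sub>R x)) = (\<lambda>x. indicator (ball 0 1 - {0}) x * g0 x)"
    proof -
      have "(t *\<^sub>R x) /\<^sub>R norm (t *\<^sub>R x) = x /\<^sub>R norm x" for x :: "real^'n"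
        using that by (simp add: mult.commute[of _ t] mult.assoc[symmetric])
      then have "g0 (t *\<^sub>R x) = g0 x" for x by (simp only: g0_def)
      then show ?thesis using that by (auto simp: fun_eq_iff indicator_def)
    qed
    finally show ?thesis by (simp add: b_def)
  qed
  have 3: "measure lborel (ball 0 t :: (real^'n) set) = t ^ ?d * V" if "t > 0" for t
  proof -
    have "(\<integral>x. indicator (ball 0 t) x \<partial>(lborel :: (real^'n) measure)) = t ^ ?d * (\<integral>x. indicator (ball 0 t) (t *\<^sub>R x) \<partial>(lborel :: (real^'n) measure))"
      using that by (intro integral_lborel_scale borel_measurable_indicator) simp_all
    also have "(\<lambda>x :: real^'n. indicator (ball 0 t) (t *\<^sub>R x) :: real) = indicator (ball 0 1)"
      using that by (auto simp: fun_eq_iff indicator_def)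
    finally show ?thesis by (simp add: V_def)
  qed
  have fin: "emeasure lborel (ball 0 t :: (real^'n) set) < \<infinity>" for t by (rule emeasure_bounded_finite) simp
  \<comment> \<open>Off the shell the differences of indicators vanish. On it the error of replacing
    \<open>g\<close> by \<open>g0\<close> is at most (t^s - 1) M, and the shell has volume (t^d - 1)
    V; so the error is of second order in t - 1.\<close>
  have key: "\<bar>(t ^ ?d * t powr s - 1) * a - (t ^ ?d - 1) * b\<bar> \<le> (t powr s - 1) * M * ((t ^ ?d - 1) * V)"
    if t: "t > 1" for t
  proof -
    let ?F = "\<lambda>x. (indicator (ball 0 t) x * g x - indicator (ball 0 1) x * g x)
       - (indicator (ball 0 t - {0}) x * g0 x - indicator (ball 0 1 - {0}) x * g0 x)"
    have "(t ^ ?d * t powr s - 1) * a - (t ^ ?d - 1) * b = (\<integral>x. ?F x \<partial>lborel)"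
      using 1[of t] 1[of 1] 2[of t] 2[of 1] t
      by (simp add: int_g int_g0 left_diff_distrib)
    also have "\<bar>\<dots>\<bar> \<le> (\<integral>x. ((t powr s - 1) * M) * (indicator (ball 0 t) x - indicator (ball 0 1) x) \<partial>(lborel :: (real^'n) measure))"
      unfolding real_norm_def[symmetric]
    proof (rule Bochner_Integration.integral_norm_bound_integral)
      show "integrable lborel ?F" by (intro Bochner_Integration.integrable_diff int_g int_g0)
      show "integrable lborel (\<lambda>x :: real^'n. ((t powr s - 1) * M) * (indicator (ball 0 t) x - indicator (ball 0 1) x))"
        using fin by (intro integrable_mult_right Bochner_Integration.integrable_diff) (auto simp: integrable_indicator_iff)
      fix x :: "real^'n"
      show "norm (?F x) \<le> ((t powr s - 1) * M) * (indicator (ball 0 t) x - indicator (ball 0 1) x)"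
      proof (cases "1 \<le> norm x \<and> norm x < t")
        case True
        then have x: "x \<noteq> 0" by auto
        have "g x = norm x powr s * g0 x" using hom[of "norm x" "x /\<^sub>R norm x"] x by (simp add: g0_def)
        then have "g x - g0 x = (norm x powr s - 1) * g0 x" by (simp add: algebra_simps)
        moreover have "norm x powr s \<ge> 1" using True s by (simp add: ge_one_powr_ge_zero)
        moreover have "norm x powr s \<le> t powr s" using True s by (intro powr_mono2) auto
        ultimately have "\<bar>g x - g0 x\<bar> \<le> (t powr s - 1) * M"
          using g0_M[OF x] by (simp add: abs_mult) (intro mult_mono, auto)
        then show ?thesis using True x by (simp add: indicator_def)
      next
        case False
        then show ?thesis using t by (auto simp: indicator_def)
      qed
    qed
    also have "\<dots> = ((t powr s - 1) * M) * ((t ^ ?d - 1) * V)"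
      using 3[of t] 3[of 1] t fin by (simp add: integrable_indicator_iff left_diff_distrib)
    finally show ?thesis by simp
  qed
  have lim: "((\<lambda>t::real. (t powr p - 1) / (t - 1)) \<longlongrightarrow> p) (at_right 1)" for p :: real
  proof -
    have "((\<lambda>t::real. t powr p) has_real_derivative p * 1 powr (p - 1)) (at 1)"
      by (rule has_real_derivative_powr) simp
    then have "((\<lambda>t::real. (t powr p - 1) / (t - 1)) \<longlongrightarrow> p) (at 1)"
      by (simp add: has_field_derivative_iff)
    then show ?thesis by (rule tendsto_within_subset) simp
  qed
  have pw: "t ^ ?d = t powr real ?d" if "t > 1" for t :: real using that by (simp add: powr_realpow)
  have lim_L: "((\<lambda>t. ((t powr (real ?d + s) - 1) / (t - 1)) * a - ((t powr real ?d - 1) / (t - 1)) * b)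
      \<longlongrightarrow> (real ?d + s) * a - real ?d * b) (at_right 1)"
    by (intro tendsto_intros lim)
  \<comment> \<open>After division by t - 1 the bound still contains the factor t^s - 1, which tends
    to 0, while the left-hand side tends to the difference of the two claimed expressions.\<close>
  have "((\<lambda>t::real. t powr s) \<longlongrightarrow> 1 powr s) (at_right 1)"
    by (intro tendsto_intros) simp_all
  then have lim_R: "((\<lambda>t. (t powr s - 1) * M * (((t powr real ?d - 1) / (t - 1)) * V)) \<longlongrightarrow> (1 powr s - 1) * M * (real ?d * V)) (at_right 1)"
    by (intro tendsto_intros lim) simp
  have ev: "\<forall>\<^sub>F t in at_right (1::real). \<bar>((t powr (real ?d + s) - 1) / (t - 1)) * a - ((t powr real ?d - 1) / (t - 1)) * b\<bar>
      \<le> (t powr s - 1) * M * (((t powr real ?d - 1) / (t - 1)) * V)"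
    using eventually_at_right_less[of 1]
  proof eventually_elim
    case (elim t)
    have "((t powr (real ?d + s) - 1) / (t - 1)) * a - ((t powr real ?d - 1) / (t - 1)) * b
       = ((t ^ ?d * t powr s - 1) * a - (t ^ ?d - 1) * b) / (t - 1)"
      using elim by (simp add: pw powr_add diff_divide_distrib left_diff_distrib)
    also have "\<bar>\<dots>\<bar> \<le> (t powr s - 1) * M * ((t ^ ?d - 1) * V) / (t - 1)"
      using key[OF elim] elim by (simp add: divide_right_mono)
    also have "\<dots> = (t powr s - 1) * M * (((t powr real ?d - 1) / (t - 1)) * V)"
      using elim by (simp add: pw)
    finally show ?case .
  qed
  have "\<bar>(real ?d + s) * a - real ?d * b\<bar> \<le> (1 powr s - 1) * M * (real ?d * V)"
    by (rule tendsto_le[OF _ lim_R tendsto_rabs[OF lim_L] ev]) simp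
  then have "real ?d * b = (real ?d + s) * a" by simp
  then show ?thesis by (simp add: sphere_integral_def a_def b_def g0_def)
qed

text \<open>Multiplying a homogeneous function by |x|^(2k) leaves its values on the sphere unchanged
  and raises the degree by 2k, so the ball integral becomes the sphere integral over \<sigma> + 2k.
  The constants are 1/\<sigma> - 1/(\<sigma>+2) and 1/\<sigma> - 2/(\<sigma>+2) +
  1/(\<sigma>+4).\<close>

lemma sphere_integral_weighted:
  fixes g :: "real^'n \<Rightarrow> real"
  assumes g: "continuous_on UNIV g" and hom: "\<And>t x. t > 0 \<Longrightarrow> g (t *\<^sub>R x) = t powr s * g x" and s: "s \<ge> 0"
  defines "\<sigma> \<equiv> real CARD('n) + s"
  shows "(\<integral>x. max 0 (1 - (norm x)\<^sup>2) * g x \<partial>lborel) = 2 * sphere_integral g / (\<sigma> * (\<sigma> + 2))"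
    and "(\<integral>x. (max 0 (1 - (norm x)\<^sup>2))\<^sup>2 * g x \<partial>lborel) = 8 * sphere_integral g / (\<sigma> * (\<sigma> + 2) * (\<sigma> + 4))"
proof -
  have "\<sigma> > 0" using s by (simp add: \<sigma>_def add_pos_nonneg)
  have I: "(\<integral>x. indicator (ball 0 1) x * (norm x ^ (2 * k) * g x) \<partial>lborel) = sphere_integral g / (\<sigma> + 2 * real k)" for k
  proof -
    have "sphere_integral (\<lambda>x. norm x ^ (2 * k) * g x)
       = (real CARD('n) + (s + 2 * real k)) * (\<integral>x. indicator (ball 0 1) x * (norm x ^ (2 * k) * g x) \<partial>lborel)"
    proof (rule sphere_integral_homogeneous)
      show "norm (t *\<^sub>R x) ^ (2 * k) * g (t *\<^sub>R x) = t powr (s + 2 * real k) * (norm x ^ (2 * k) * g x)"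
        if "t > 0" for t and x :: "real^'n"
        using that powr_realpow[OF that, of "2 * k"] by (simp add: hom power_mult_distrib powr_add)
    qed (use s in \<open>auto intro!: continuous_intros g\<close>)
    moreover have "sphere_integral (\<lambda>x. norm x ^ (2 * k) * g x) = sphere_integral g"
      by (rule sphere_integral_cong) simp
    moreover have "\<sigma> + 2 * real k > 0" using \<open>\<sigma> > 0\<close> by simp
    ultimately show ?thesis by (simp add: \<sigma>_def field_simps)
  qed
  have int: "integrable lborel (\<lambda>x. indicator (ball 0 1) x * (norm x ^ (2 * k) * g x))" for k
    by (rule integrable_continuous_on_bounded) (auto intro!: continuous_intros g)
  have max_eq: "max 0 (1 - (norm x)\<^sup>2) = (if norm x < 1 then 1 - (norm x)\<^sup>2 else 0)" for x :: "real^'n"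
    using power_le_one[of "norm x" 2] one_le_power[of "norm x" 2] by auto
  have "max 0 (1 - (norm x)\<^sup>2) * g x = indicator (ball 0 1) x * (norm x ^ (2 * 0) * g x)
     - indicator (ball 0 1) x * (norm x ^ (2 * 1) * g x)" for x
    unfolding max_eq by (simp add: indicator_def algebra_simps power2_eq_square)
  then have "(\<integral>x. max 0 (1 - (norm x)\<^sup>2) * g x \<partial>lborel) = sphere_integral g / \<sigma> - sphere_integral g / (\<sigma> + 2)"
    using I[of 0] I[of 1] int[of 0] int[of 1] by simp
  also have "\<dots> = 2 * sphere_integral g / (\<sigma> * (\<sigma> + 2))" using \<open>\<sigma> > 0\<close> by (simp add: field_simps)
  finally show "(\<integral>x. max 0 (1 - (norm x)\<^sup>2) * g x \<partial>lborel) = 2 * sphere_integral g / (\<sigma> * (\<sigma> + 2))" .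
  have "(max 0 (1 - (norm x)\<^sup>2))\<^sup>2 * g x = indicator (ball 0 1) x * (norm x ^ (2 * 0) * g x)
     - 2 * (indicator (ball 0 1) x * (norm x ^ (2 * 1) * g x)) + indicator (ball 0 1) x * (norm x ^ (2 * 2) * g x)" for x
    unfolding max_eq by (simp add: indicator_def algebra_simps power2_eq_square power4_eq_xxxx)
  then have "(\<integral>x. (max 0 (1 - (norm x)\<^sup>2))\<^sup>2 * g x \<partial>lborel)
      = sphere_integral g / \<sigma> - 2 * (sphere_integral g / (\<sigma> + 2)) + sphere_integral g / (\<sigma> + 4)"
    using I[of 0] I[of 1] I[of 2] int[of 0] int[of 1] int[of 2] by simp
  also have "\<dots> = 8 * sphere_integral g / (\<sigma> * (\<sigma> + 2) * (\<sigma> + 4))"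
  proof -
    have "\<sigma> \<noteq> 0" "\<sigma> + 2 \<noteq> 0" "\<sigma> + 4 \<noteq> 0" using \<open>\<sigma> > 0\<close> by auto
    then show ?thesis by (simp add: divide_simps) (simp add: algebra_simps)
  qed
  finally show "(\<integral>x. (max 0 (1 - (norm x)\<^sup>2))\<^sup>2 * g x \<partial>lborel) = 8 * sphere_integral g / (\<sigma> * (\<sigma> + 2) * (\<sigma> + 4))" .
qed

text \<open>By translation invariance every difference quotient of \<open>F\<close> integrates to
  zero. The mean value theorem bounds the quotients by the maximum of the derivative, and as the
  step sizes are at most 1 they all vanish outside the ball of radius 1 + |v|; dominated convergence
  gives the claim.\<close>

lemma integral_directional_derivative_eq_0:
  fixes F :: "real^'n \<Rightarrow> real"
  assumes der: "\<And>x. (F has_derivative F' x) (at x)"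
    and supp: "\<And>x. x \<notin> cball 0 1 \<Longrightarrow> F x = 0" "\<And>x. x \<notin> cball 0 1 \<Longrightarrow> F' x v = 0"
    and cont: "continuous_on UNIV (\<lambda>x. F' x v)"
  shows "(\<integral>x. F' x v \<partial>lborel) = 0"
proof -
  have "bounded ((\<lambda>x. F' x v) ` cball 0 1)"
    by (intro compact_imp_bounded compact_continuous_image continuous_on_subset[OF cont]) simp_all
  then obtain M where "\<forall>y\<in>(\<lambda>x. F' x v) ` cball 0 1. norm y \<le> M" unfolding bounded_iff by blast
  then have M: "\<And>x. x \<in> cball 0 1 \<Longrightarrow> \<bar>F' x v\<bar> \<le> M" by simp
  have M0: "M \<ge> 0" using M[of 0] by simp
  have M': "\<bar>F' x v\<bar> \<le> M" for x using M[of x] supp(2)[of x] M0 by (cases "x \<in> cball 0 1") auto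
  have F_cont: "continuous_on UNIV F"
    using der by (auto intro!: continuous_at_imp_continuous_on has_derivative_continuous)
  then have [measurable]: "F \<in> borel_measurable borel" by (rule borel_measurable_continuous_onI)
  have F_int: "integrable lborel F" by (rule integrable_continuous_support[OF F_cont supp(1)])
  define h where "h = (\<lambda>n::nat. 1 / real (Suc n))"
  have h: "h n > 0" "h n \<le> 1" for n by (simp_all add: h_def)
  define q where "q = (\<lambda>n x. (F (x + h n *\<^sub>R v) - F x) / h n)"
  have q_M: "\<bar>q n x\<bar> \<le> M" for n x
  proof -
    have d: "((\<lambda>t. F (x + t *\<^sub>R v)) has_real_derivative F' (x + t *\<^sub>R v) v) (at t)" for t
    proof -
      interpret linear "F' (x + t *\<^sub>R v)" by (rule has_derivative_linear[OF der])
      have "((\<lambda>t. x + t *\<^sub>R v) has_derivative (\<lambda>s. s *\<^sub>R v)) (at t)" by (auto intro!: derivative_eq_intros)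
      from has_derivative_compose[OF this der] show ?thesis
        by (simp add: has_field_derivative_def scaleR mult_commute_abs)
    qed
    obtain z where "F (x + h n *\<^sub>R v) - F (x + 0 *\<^sub>R v) = (h n - 0) * F' (x + z *\<^sub>R v) v"
      using MVT2[of 0 "h n" "\<lambda>t. F (x + t *\<^sub>R v)", OF h(1) d] by blast
    then have "q n x = F' (x + z *\<^sub>R v) v" using h(1)[of n] by (simp add: q_def)
    then show ?thesis using M' by simp
  qed
  have q_0: "q n x = 0" if "x \<notin> cball 0 (1 + norm v)" for n x
  proof -
    have "norm x \<le> norm (x + h n *\<^sub>R v) + norm (h n *\<^sub>R v)" using norm_triangle_ineq4[of "x + h n *\<^sub>R v" "h n *\<^sub>R v"] by simp
    moreover have "norm (h n *\<^sub>R v) \<le> norm v" using h[of n] by (simp add: mult_left_le_one_le)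
    moreover have "norm x > 1 + norm v" using that by simp
    ultimately have "\<not> norm (x + h n *\<^sub>R v) \<le> 1" "\<not> norm x \<le> 1" using norm_ge_zero[of v] by linarith+
    then show ?thesis by (simp add: q_def supp)
  qed
  have "(\<lambda>n. \<integral>x. q n x \<partial>lborel) \<longlonglongrightarrow> (\<integral>x. F' x v \<partial>lborel)"
  proof (rule integral_dominated_convergence[where w="\<lambda>x. M * indicator (cball 0 (1 + norm v)) x"])
    show "(\<lambda>x. F' x v) \<in> borel_measurable lborel"
      using borel_measurable_continuous_onI[OF cont] by simp
    show "q n \<in> borel_measurable lborel" for n unfolding q_def by measurable
    have "emeasure lborel (cball 0 (1 + norm v) :: (real^'n) set) < \<infinity>" by (rule emeasure_bounded_finite) simp
    then show "integrable lborel (\<lambda>x :: real^'n. M * indicator (cball 0 (1 + norm v)) x)" by simp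
    show "AE x in lborel. norm (q n x) \<le> M * indicator (cball 0 (1 + norm v)) x" for n
      using q_M[of n] q_0[of _ n] by (auto simp: indicator_def)
    show "AE x in lborel. (\<lambda>n. q n x) \<longlonglongrightarrow> F' x v"
    proof (rule AE_I2)
      fix x
      interpret linear "F' x" by (rule has_derivative_linear[OF der])
      have "((\<lambda>t. x + t *\<^sub>R v) has_derivative (\<lambda>s. s *\<^sub>R v)) (at 0)" by (auto intro!: derivative_eq_intros)
      from has_derivative_compose[OF this, of F "F' x"] der
      have "((\<lambda>t. F (x + t *\<^sub>R v)) has_real_derivative F' x v) (at 0)"
        by (simp add: has_field_derivative_def scaleR mult_commute_abs)
      then have "((\<lambda>t. (F (x + t *\<^sub>R v) - F x) / t) \<longlongrightarrow> F' x v) (at 0)" by (simp add: DERIV_def)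
      moreover have "filterlim h (at 0) sequentially"
        using h LIMSEQ_inverse_real_of_nat by (auto simp: filterlim_at h_def inverse_eq_divide)
      ultimately show "(\<lambda>n. q n x) \<longlonglongrightarrow> F' x v"
        unfolding q_def by (rule filterlim_compose)
    qed
  qed
  moreover have "(\<integral>x. q n x \<partial>lborel) = 0" for n
  proof -
    have eq: "(\<integral>x. F (x + h n *\<^sub>R v) \<partial>lborel) = (\<integral>x. F x \<partial>lborel)"
      using integral_distr[of "(+) (h n *\<^sub>R v)" lborel borel F] by (simp add: lborel_distr_plus add.commute)
    have "integrable lborel (\<lambda>x. F (x + h n *\<^sub>R v))"
      using integrable_distr_eq[of "(+) (h n *\<^sub>R v)" lborel borel F] F_int by (simp add: lborel_distr_plus add.commute)
    then show ?thesis using F_int eq by (simp add: q_def)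
  qed
  ultimately show ?thesis by (simp add: LIMSEQ_const_iff)
qed


section \<open>Integration by parts for Dunkl operators\<close>

text \<open>The square removes the corner at u = 1, where the quotient is bounded by |h|.\<close>

lemma has_real_derivative_max_square:
  "((\<lambda>u::real. (max 0 (1 - u))\<^sup>2) has_real_derivative - 2 * max 0 (1 - u)) (at u)"
proof (cases u "1::real" rule: linorder_cases)
  case less
  have "((\<lambda>u::real. (1 - u)\<^sup>2) has_real_derivative - 2 * (1 - u)) (at u)"
    by (auto intro!: derivative_eq_intros)
  then have "((\<lambda>u::real. (max 0 (1 - u))\<^sup>2) has_real_derivative - 2 * (1 - u)) (at u)"
    by (rule has_field_derivative_transform_within_open[of _ _ _ "{..<1}"]) (use less in auto)
  with less show ?thesis by simp
next
  case greater
  have "((\<lambda>u::real. (max 0 (1 - u))\<^sup>2) has_real_derivative 0) (at u)"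
    by (rule has_field_derivative_transform_within_open[of "\<lambda>_. 0" _ _ "{1<..}"]) (use greater in auto)
  with greater show ?thesis by simp
next
  case equal
  have "((\<lambda>h::real. (max 0 (1 - (1 + h)))\<^sup>2 / h) \<longlongrightarrow> 0) (at 0)"
  proof (rule Lim_null_comparison)
    show "\<forall>\<^sub>F h in at (0::real). norm ((max 0 (1 - (1 + h)))\<^sup>2 / h) \<le> \<bar>h\<bar>"
      by (intro always_eventually allI) (auto simp: max_def power2_eq_square)
    show "((\<lambda>h::real. \<bar>h\<bar>) \<longlongrightarrow> 0) (at 0)" by (auto intro!: tendsto_eq_intros)
  qed
  with equal show ?thesis by (simp add: DERIV_def)
qed

context dunkl_setting
begin

abbreviation wt :: "real^'n \<Rightarrow> real" where
  "wt x \<equiv> (hk Rp \<kappa> x)\<^sup>2"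

text \<open>Written as an exponential so that its derivative in direction v is itself times the sum
  over roots of 2 \<kappa> \<alpha> <\<alpha>,v> <\<alpha>,x> / (<\<alpha>,x>^2 + \<epsilon>), the
  quantity that the difference part of D has to match.\<close>

definition wt_reg :: "real \<Rightarrow> real^'n \<Rightarrow> real" where
  "wt_reg \<epsilon> x = exp (\<Sum>\<alpha>\<in>Rp. \<kappa> \<alpha> * ln ((inner \<alpha> x)\<^sup>2 + \<epsilon>))"

lemma kappa_Rp_nonneg: "\<alpha> \<in> Rp \<Longrightarrow> \<kappa> \<alpha> \<ge> 0"
  using kappa_nonneg Rp_subset by blast

lemma wt_eq: "wt x = (\<Prod>\<alpha>\<in>Rp. if \<kappa> \<alpha> = 0 then 1 else (inner \<alpha> x)\<^sup>2 powr \<kappa> \<alpha>)"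
proof -
  have "(\<bar>i\<bar> powr k)\<^sup>2 = i\<^sup>2 powr k" for i k :: real
    by (simp add: power2_eq_square powr_mult[symmetric])
  then show ?thesis unfolding hk_def prod_power_distrib
    by (intro prod.cong HOL.refl) simp
qed

lemma wt_reg_eq:
  assumes "\<epsilon> > 0"
  shows "wt_reg \<epsilon> x = (\<Prod>\<alpha>\<in>Rp. ((inner \<alpha> x)\<^sup>2 + \<epsilon>) powr \<kappa> \<alpha>)"
proof -
  have "(inner \<alpha> x)\<^sup>2 + \<epsilon> \<noteq> 0" for \<alpha> using assms by (smt (verit) zero_le_power2)
  then show ?thesis unfolding wt_reg_def exp_sum[OF finite_Rp] by (simp add: powr_def)
qed

lemma continuous_on_wt: "continuous_on S wt"
  unfolding wt_eq
proof (rule continuous_on_prod)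
  fix \<alpha> assume "\<alpha> \<in> Rp"
  then show "continuous_on S (\<lambda>x. if \<kappa> \<alpha> = 0 then 1 else (inner \<alpha> x)\<^sup>2 powr \<kappa> \<alpha>)"
    using kappa_Rp_nonneg[of \<alpha>]
    by (cases "\<kappa> \<alpha> = 0") (simp, simp, intro continuous_on_powr' continuous_on_const ballI conjI impI
        continuous_on_power continuous_on_inner continuous_on_id, simp_all)
qed

lemma wt_homogeneous:
  assumes "t > 0"
  shows "wt (t *\<^sub>R x) = t powr (2 * sum \<kappa> Rp) * wt x"
proof -
  have *: "(t * i)\<^sup>2 powr k = t powr (2 * k) * i\<^sup>2 powr k" for i k :: real
  proof -
    have "(t * i)\<^sup>2 powr k = t\<^sup>2 powr k * i\<^sup>2 powr k" by (simp add: power_mult_distrib powr_mult)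
    moreover have "t\<^sup>2 = t powr 2" using assms by (simp add: powr_numeral)
    ultimately show ?thesis by (simp add: powr_powr)
  qed
  have "wt (t *\<^sub>R x) = (\<Prod>\<alpha>\<in>Rp. t powr (2 * \<kappa> \<alpha>) * (if \<kappa> \<alpha> = 0 then 1 else (inner \<alpha> x)\<^sup>2 powr \<kappa> \<alpha>))"
    unfolding wt_eq using assms by (intro prod.cong HOL.refl) (simp add: *)
  also have "\<dots> = t powr (\<Sum>\<alpha>\<in>Rp. 2 * \<kappa> \<alpha>) * wt x"
    unfolding prod.distrib wt_eq using assms finite_Rp by (simp add: powr_sum)
  finally show ?thesis by (simp add: sum_distrib_left)
qed

lemma wt_refl:
  assumes "\<beta> \<in> R"
  shows "wt (refl \<beta> x) = wt x"
proof -
  have "wt (refl \<beta> x) = (\<Prod>\<alpha>\<in>Rp. (\<lambda>\<alpha>. if \<kappa> \<alpha> = 0 then 1 else (inner \<alpha> x)\<^sup>2 powr \<kappa> \<alpha>) (refl \<beta> \<alpha>))"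
    unfolding wt_eq using kappa_refl[OF assms] Rp_subset
    by (intro prod.cong HOL.refl) (auto simp: inner_refl_left)
  also have "\<dots> = wt x" unfolding wt_eq by (rule prod_Rp_refl[OF assms]) (simp add: kappa_minus)
  finally show ?thesis .
qed

lemma wt_reg_refl:
  assumes "\<beta> \<in> R"
  shows "wt_reg \<epsilon> (refl \<beta> x) = wt_reg \<epsilon> x"
proof -
  have "(\<Sum>\<alpha>\<in>Rp. \<kappa> \<alpha> * ln ((inner \<alpha> (refl \<beta> x))\<^sup>2 + \<epsilon>)) =
      (\<Sum>\<alpha>\<in>Rp. (\<lambda>\<alpha>. \<kappa> \<alpha> * ln ((inner \<alpha> x)\<^sup>2 + \<epsilon>)) (refl \<beta> \<alpha>))"
    using kappa_refl[OF assms] Rp_subset by (intro sum.cong HOL.refl) (auto simp: inner_refl_left)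
  also have "\<dots> = (\<Sum>\<alpha>\<in>Rp. \<kappa> \<alpha> * ln ((inner \<alpha> x)\<^sup>2 + \<epsilon>))"
    by (rule sum_Rp_refl[OF assms]) (simp add: kappa_minus)
  finally show ?thesis by (simp add: wt_reg_def)
qed

lemma sq_add_pos: "\<epsilon> > 0 \<Longrightarrow> (u::real)\<^sup>2 + \<epsilon> > 0"
  by (smt (verit) zero_le_power2)

lemma wt_reg_mono:
  assumes "0 < \<epsilon>" "\<epsilon> \<le> 1"
  shows "0 \<le> wt_reg \<epsilon> x" "wt_reg \<epsilon> x \<le> wt_reg 1 x"
  unfolding wt_reg_def exp_le_cancel_iff
  by (simp, intro sum_mono mult_left_mono kappa_Rp_nonneg,
      use assms sq_add_pos[of \<epsilon>] sq_add_pos[of 1] in \<open>simp_all add: ln_le_cancel_iff\<close>)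

lemma continuous_on_wt_reg: "\<epsilon> > 0 \<Longrightarrow> continuous_on S (wt_reg \<epsilon>)"
  unfolding wt_reg_def using sq_add_pos[of \<epsilon>] less_imp_neq
  by (auto intro!: continuous_intros simp: less_imp_neq[symmetric])

lemma wt_reg_has_derivative:
  assumes "\<epsilon> > 0"
  shows "(wt_reg \<epsilon> has_derivative (\<lambda>v. wt_reg \<epsilon> x *
    (\<Sum>\<alpha>\<in>Rp. \<kappa> \<alpha> * (inner \<alpha> v * (2 * inner \<alpha> x / ((inner \<alpha> x)\<^sup>2 + \<epsilon>)))))) (at x)"
proof -
  have 1: "((\<lambda>x. ln ((inner \<alpha> x)\<^sup>2 + \<epsilon>)) has_derivative
      (\<lambda>v. inner \<alpha> v * (2 * inner \<alpha> x / ((inner \<alpha> x)\<^sup>2 + \<epsilon>)))) (at x)" for \<alpha>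
  proof -
    have "((\<lambda>u::real. ln (u\<^sup>2 + \<epsilon>)) has_real_derivative (2 * u / (u\<^sup>2 + \<epsilon>))) (at u)" for u
      using sq_add_pos[OF assms, of u] by (auto intro!: derivative_eq_intros)
    then have "((\<lambda>u::real. ln (u\<^sup>2 + \<epsilon>)) has_derivative (\<lambda>s. s * (2 * u / (u\<^sup>2 + \<epsilon>)))) (at u)" for u
      by (simp only: has_field_derivative_def mult_commute_abs)
    from has_derivative_compose[OF bounded_linear_imp_has_derivative[OF bounded_linear_inner_right] this]
    show ?thesis .
  qed
  have 2: "((\<lambda>x. \<Sum>\<alpha>\<in>Rp. \<kappa> \<alpha> * ln ((inner \<alpha> x)\<^sup>2 + \<epsilon>)) has_derivative
      (\<lambda>v. \<Sum>\<alpha>\<in>Rp. \<kappa> \<alpha> * (inner \<alpha> v * (2 * inner \<alpha> x / ((inner \<alpha> x)\<^sup>2 + \<epsilon>))))) (at x)"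
    by (intro has_derivative_sum has_derivative_mult_right 1)
  have "(exp has_derivative (\<lambda>s. exp u * s)) (at u)" for u :: real
    using DERIV_exp[of u] by (simp add: has_field_derivative_def)
  from has_derivative_compose[OF 2 this] show ?thesis by (simp add: wt_reg_def[abs_def])
qed

lemma wt_reg_tendsto:
  assumes "\<epsilon> \<longlonglongrightarrow> 0" "\<And>n. \<epsilon> n > 0"
  shows "(\<lambda>n. wt_reg (\<epsilon> n) x) \<longlonglongrightarrow> wt x"
  unfolding wt_reg_eq[OF assms(2)] wt_eq
proof (rule tendsto_prod)
  fix \<alpha> assume \<alpha>: "\<alpha> \<in> Rp"
  have pos: "(inner \<alpha> x)\<^sup>2 + \<epsilon> n \<noteq> 0" for n using sq_add_pos[OF assms(2), of "inner \<alpha> x" n] by simp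
  show "(\<lambda>n. ((inner \<alpha> x)\<^sup>2 + \<epsilon> n) powr \<kappa> \<alpha>) \<longlonglongrightarrow> (if \<kappa> \<alpha> = 0 then 1 else (inner \<alpha> x)\<^sup>2 powr \<kappa> \<alpha>)"
  proof (cases "\<kappa> \<alpha> = 0")
    case True
    then show ?thesis using pos by simp
  next
    case False
    have "(\<lambda>n. (inner \<alpha> x)\<^sup>2 + \<epsilon> n) \<longlonglongrightarrow> (inner \<alpha> x)\<^sup>2 + 0" by (intro tendsto_intros assms(1))
    then have "(\<lambda>n. ((inner \<alpha> x)\<^sup>2 + \<epsilon> n) powr \<kappa> \<alpha>) \<longlonglongrightarrow> ((inner \<alpha> x)\<^sup>2 + 0) powr \<kappa> \<alpha>"
      using False kappa_Rp_nonneg[OF \<alpha>] less_imp_le[OF sq_add_pos[OF assms(2)]]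
      by (intro tendsto_powr'[OF _ tendsto_const] disjI2 conjI always_eventually allI) simp_all
    with False show ?thesis by simp
  qed
qed

abbreviation cutoff :: "real^'n \<Rightarrow> real" where
  "cutoff x \<equiv> max 0 (1 - (norm x)\<^sup>2)"

lemma cutoff_eq_0: "x \<notin> cball 0 1 \<Longrightarrow> cutoff x = 0"
  using one_le_power[of "norm x" 2] by auto

lemma cutoff_sq_has_derivative:
  "((\<lambda>x. (cutoff x)\<^sup>2) has_derivative (\<lambda>v. - 4 * cutoff x * inner v x)) (at x)"
proof -
  have "((\<lambda>x. inner x x) has_derivative (\<lambda>v. 2 * inner v x)) (at x)"
    by (auto intro!: derivative_eq_intros simp: inner_commute)
  moreover have "((\<lambda>u::real. (max 0 (1 - u))\<^sup>2) has_derivative (\<lambda>s. s * (- 2 * max 0 (1 - u)))) (at u)" for u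
    using has_real_derivative_max_square[of u] by (simp only: has_field_derivative_def mult_commute_abs)
  ultimately have "((\<lambda>x. (max 0 (1 - inner x x))\<^sup>2) has_derivative (\<lambda>v. 2 * inner v x * (- 2 * max 0 (1 - inner x x)))) (at x)"
    by (rule has_derivative_compose)
  then show ?thesis by (simp add: power2_norm_eq_inner mult_ac)
qed

lemma smooth_frechet_continuous:
  "smooth_on UNIV p \<Longrightarrow> continuous_on UNIV (\<lambda>x. frechet_derivative p (at x) v)"
  by (intro smooth_on_continuous smooth_on_frechet_derivative)

lemma dquot_continuous:
  assumes "smooth_on UNIV p" "\<alpha> \<in> Rp"
  shows "continuous_on UNIV (dquot \<alpha> p)"
  using smooth_on_continuous[OF hp.smooth_on_sdquot[OF assms(1)], of \<alpha>]
  by (rule continuous_on_eq) (simp add: hp.dquot_eq_sdquot assms hp.Rp_nonzero)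

text \<open>The factor <\<alpha>,x>^2 / (<\<alpha>,x>^2 + \<epsilon>) on the difference part is
  exactly what balances the derivative of the regularised weight, so the identity holds for every
  \<epsilon> > 0 and not only in the limit, where the factor tends to 1 off the mirror.\<close>

lemma integral_by_parts_reg:
  assumes p: "smooth_on UNIV p" and \<epsilon>: "\<epsilon> > 0"
  shows "(\<integral>x. wt_reg \<epsilon> x * (((cutoff x)\<^sup>2 * frechet_derivative p (at x) v - 4 * (cutoff x * (inner v x * p x)))
     + (\<Sum>\<alpha>\<in>Rp. ((cutoff x)\<^sup>2 * (\<kappa> \<alpha> * inner \<alpha> v * dquot \<alpha> p x)) * ((inner \<alpha> x)\<^sup>2 / ((inner \<alpha> x)\<^sup>2 + \<epsilon>)))) \<partial>lborel) = 0"
proof -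
  have pc: "continuous_on UNIV p" by (rule smooth_on_continuous[OF p])
  have cc: "continuous_on UNIV cutoff" by (intro continuous_intros)
  note wc = continuous_on_wt_reg[OF \<epsilon>, of UNIV]
  have ne: "(inner \<alpha> x)\<^sup>2 + \<epsilon> \<noteq> 0" for \<alpha> x using sq_add_pos[OF \<epsilon>, of "inner \<alpha> x"] by simp
  define T where "T = (\<lambda>\<alpha> x. wt_reg \<epsilon> x * ((cutoff x)\<^sup>2 * p x) * (inner \<alpha> x / ((inner \<alpha> x)\<^sup>2 + \<epsilon>)))"
  define A where "A = (\<lambda>x. wt_reg \<epsilon> x * ((cutoff x)\<^sup>2 * frechet_derivative p (at x) v - 4 * (cutoff x * (inner v x * p x))))"
  define Q where "Q = (\<lambda>\<alpha> x. wt_reg \<epsilon> x * (((cutoff x)\<^sup>2 * (\<kappa> \<alpha> * inner \<alpha> v * dquot \<alpha> p x)) * ((inner \<alpha> x)\<^sup>2 / ((inner \<alpha> x)\<^sup>2 + \<epsilon>))))"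
  have T_cont: "continuous_on UNIV (T \<alpha>)" for \<alpha>
    unfolding T_def by (intro continuous_intros wc pc) (simp add: ne)
  have T_int: "integrable lborel (T \<alpha>)" for \<alpha>
    by (rule integrable_continuous_support[OF T_cont, of 1]) (simp add: T_def cutoff_eq_0)
  have A_int: "integrable lborel A"
    by (rule integrable_continuous_support[of _ 1]) (auto simp: A_def cutoff_eq_0
        intro!: continuous_intros wc pc smooth_frechet_continuous[OF p])
  have Q_int: "integrable lborel (Q \<alpha>)" if "\<alpha> \<in> Rp" for \<alpha>
    by (rule integrable_continuous_support[of _ 1]) (auto simp: Q_def cutoff_eq_0 ne
        intro!: continuous_intros wc pc dquot_continuous[OF p that])
  \<comment> \<open>\<open>T\<close> contains <\<alpha>,x> / (<\<alpha>,x>^2 + \<epsilon>), which is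
    odd under the reflection, while weight and cutoff are invariant. Hence T(x) + T(refl \<alpha> x)
    carries p(x) - p(refl \<alpha> x), that is <\<alpha>,x> times \<open>dquot\<close>, and both
    summands have the same integral.\<close>
  have QT: "(\<integral>x. Q \<alpha> x \<partial>lborel) = \<kappa> \<alpha> * inner \<alpha> v * (2 * (\<integral>x. T \<alpha> x \<partial>lborel))" if \<alpha>: "\<alpha> \<in> Rp" for \<alpha>
  proof -
    have \<alpha>R: "\<alpha> \<in> R" and \<alpha>0: "\<alpha> \<noteq> 0" using \<alpha> Rp_subset hp.Rp_nonzero by auto
    have Tm: "T \<alpha> \<in> borel_measurable borel" by (rule borel_measurable_continuous_onI[OF T_cont])
    have "continuous_on UNIV (\<lambda>x. T \<alpha> (refl \<alpha> x))"
      by (rule continuous_on_compose2[OF T_cont linear_continuous_on[OF bounded_linear_refl]]) simp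
    then have Tr_int: "integrable lborel (\<lambda>x. T \<alpha> (refl \<alpha> x))"
      by (rule integrable_continuous_support[of _ 1]) (simp add: T_def cutoff_eq_0)
    have inv: "inner \<alpha> (refl \<alpha> x) = - inner \<alpha> x" for x
      using inner_refl_left[of \<alpha> \<alpha> x] refl_self[OF \<alpha>0] by simp
    have "Q \<alpha> x = \<kappa> \<alpha> * inner \<alpha> v * (T \<alpha> x + T \<alpha> (refl \<alpha> x))" for x
    proof -
      have "p x - p (refl \<alpha> x) = inner \<alpha> x * dquot \<alpha> p x"
        using hp.difference_refl_eq[OF p UNIV_I \<alpha>0] hp.dquot_eq_sdquot[OF p UNIV_I \<alpha>0] by simp
      moreover have "T \<alpha> x + T \<alpha> (refl \<alpha> x) = wt_reg \<epsilon> x * (cutoff x)\<^sup>2 * (p x - p (refl \<alpha> x)) * (inner \<alpha> x / ((inner \<alpha> x)\<^sup>2 + \<epsilon>))"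
        unfolding T_def wt_reg_refl[OF \<alpha>R] inv by (simp add: algebra_simps diff_divide_distrib)
      ultimately have "T \<alpha> x + T \<alpha> (refl \<alpha> x) = wt_reg \<epsilon> x * (cutoff x)\<^sup>2 * (inner \<alpha> x * dquot \<alpha> p x) * (inner \<alpha> x / ((inner \<alpha> x)\<^sup>2 + \<epsilon>))"
        by simp
      then show ?thesis by (simp add: Q_def power2_eq_square)
    qed
    then have "(\<integral>x. Q \<alpha> x \<partial>lborel) = \<kappa> \<alpha> * inner \<alpha> v * ((\<integral>x. T \<alpha> x \<partial>lborel) + (\<integral>x. T \<alpha> (refl \<alpha> x) \<partial>lborel))"
      using T_int Tr_int by simp
    then show ?thesis using integral_lborel_refl[OF Tm, of \<alpha>] by simp
  qed
  define F' where "F' = (\<lambda>x u. p x * ((cutoff x)\<^sup>2 * (wt_reg \<epsilon> x *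
       (\<Sum>\<alpha>\<in>Rp. \<kappa> \<alpha> * (inner \<alpha> u * (2 * inner \<alpha> x / ((inner \<alpha> x)\<^sup>2 + \<epsilon>)))))
       + (- 4 * cutoff x * inner u x) * wt_reg \<epsilon> x)
     + frechet_derivative p (at x) u * ((cutoff x)\<^sup>2 * wt_reg \<epsilon> x))"
  have F'_eq: "F' x v = A x + (\<Sum>\<alpha>\<in>Rp. \<kappa> \<alpha> * inner \<alpha> v * (2 * T \<alpha> x))" for x
    by (simp add: F'_def A_def T_def algebra_simps sum_distrib_left)
  have "(\<integral>x. F' x v \<partial>lborel) = 0"
  proof (rule integral_directional_derivative_eq_0)
    show "((\<lambda>x. p x * ((cutoff x)\<^sup>2 * wt_reg \<epsilon> x)) has_derivative F' x) (at x)" for x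
      unfolding F'_def
      by (intro has_derivative_mult smooth_on_has_derivative[OF p] cutoff_sq_has_derivative
          wt_reg_has_derivative[OF \<epsilon>]) simp
    show "continuous_on UNIV (\<lambda>x. F' x v)"
      unfolding F'_def by (intro continuous_intros wc pc smooth_frechet_continuous[OF p]) (simp add: ne)
  qed (simp_all add: cutoff_eq_0 F'_def)
  also have "(\<integral>x. F' x v \<partial>lborel) = (\<integral>x. A x \<partial>lborel) + (\<Sum>\<alpha>\<in>Rp. \<kappa> \<alpha> * inner \<alpha> v * (2 * (\<integral>x. T \<alpha> x \<partial>lborel)))"
    unfolding F'_eq by (subst Bochner_Integration.integral_add) (auto simp: A_int T_int)
  also have "\<dots> = (\<integral>x. A x + (\<Sum>\<alpha>\<in>Rp. Q \<alpha> x) \<partial>lborel)"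
    using A_int Q_int by (simp add: QT)
  finally show ?thesis by (simp add: A_def Q_def distrib_left sum_distrib_left)
qed

lemma integral_by_parts:
  assumes p: "smooth_on UNIV p"
  shows "(\<integral>x. (cutoff x)\<^sup>2 * (D v p x * wt x) \<partial>lborel) = 4 * (\<integral>x. cutoff x * (inner v x * p x * wt x) \<partial>lborel)"
proof -
  have pc: "continuous_on UNIV p" by (rule smooth_on_continuous[OF p])
  define a where "a = (\<lambda>x. (cutoff x)\<^sup>2 * frechet_derivative p (at x) v - 4 * (cutoff x * (inner v x * p x)))"
  define c where "c = (\<lambda>\<alpha> x. (cutoff x)\<^sup>2 * (\<kappa> \<alpha> * inner \<alpha> v * dquot \<alpha> p x))"
  define \<epsilon> where "\<epsilon> = (\<lambda>n. inverse (real (Suc n)))"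
  have \<epsilon>: "\<epsilon> n > 0" "\<epsilon> n \<le> 1" for n by (simp_all add: \<epsilon>_def inverse_le_1_iff)
  have \<epsilon>0: "\<epsilon> \<longlonglongrightarrow> 0" unfolding \<epsilon>_def by (rule LIMSEQ_inverse_real_of_nat)
  have a_cont: "continuous_on UNIV a"
    unfolding a_def by (intro continuous_intros pc smooth_frechet_continuous[OF p])
  have c_cont: "continuous_on UNIV (c \<alpha>)" if "\<alpha> \<in> Rp" for \<alpha>
    unfolding c_def by (intro continuous_intros dquot_continuous[OF p that])
  let ?r = "\<lambda>n \<alpha> x. (inner \<alpha> x)\<^sup>2 / ((inner \<alpha> x)\<^sup>2 + \<epsilon> n)"
  let ?G = "\<lambda>n x. wt_reg (\<epsilon> n) x * (a x + (\<Sum>\<alpha>\<in>Rp. c \<alpha> x * ?r n \<alpha> x))"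
  \<comment> \<open>For the dominating function: the quotients \<open>?r\<close> lie between 0 and
    1, and since \<kappa> is nonnegative on \<open>Rp\<close> the regularised weight increases with
    \<epsilon>, so its value at \<epsilon> = 1 bounds all others.\<close>
  have "(\<lambda>n. \<integral>x. ?G n x \<partial>lborel) \<longlonglongrightarrow> (\<integral>x. wt x * (a x + (\<Sum>\<alpha>\<in>Rp. c \<alpha> x)) \<partial>lborel)"
  proof (rule integral_dominated_convergence[where w="\<lambda>x. wt_reg 1 x * (\<bar>a x\<bar> + (\<Sum>\<alpha>\<in>Rp. \<bar>c \<alpha> x\<bar>))"])
    have "continuous_on UNIV (\<lambda>x. wt x * (a x + (\<Sum>\<alpha>\<in>Rp. c \<alpha> x)))"
      by (intro continuous_on_mult continuous_on_wt continuous_on_add a_cont continuous_on_sum c_cont)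
    then show "(\<lambda>x. wt x * (a x + (\<Sum>\<alpha>\<in>Rp. c \<alpha> x))) \<in> borel_measurable lborel"
      using borel_measurable_continuous_onI by simp
    have "continuous_on UNIV (?G n)" for n
      using sq_add_pos[OF \<epsilon>(1)] less_imp_neq
      by (intro continuous_on_mult continuous_on_wt_reg[OF \<epsilon>(1)] continuous_on_add a_cont continuous_on_sum c_cont
          continuous_on_divide continuous_intros) (auto simp: less_imp_neq[symmetric])
    then have G: "?G n \<in> borel_measurable borel" for n by (rule borel_measurable_continuous_onI)
    show "?G n \<in> borel_measurable lborel" for n using G[of n] by simp
    show "integrable lborel (\<lambda>x. wt_reg 1 x * (\<bar>a x\<bar> + (\<Sum>\<alpha>\<in>Rp. \<bar>c \<alpha> x\<bar>)))"
    proof (rule integrable_continuous_support[of _ 1])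
      show "continuous_on UNIV (\<lambda>x. wt_reg 1 x * (\<bar>a x\<bar> + (\<Sum>\<alpha>\<in>Rp. \<bar>c \<alpha> x\<bar>)))"
        by (intro continuous_on_mult continuous_on_wt_reg continuous_on_add continuous_on_rabs a_cont
            continuous_on_sum c_cont) simp
    qed (simp add: a_def c_def cutoff_eq_0)
    show "AE x in lborel. norm (?G n x) \<le> wt_reg 1 x * (\<bar>a x\<bar> + (\<Sum>\<alpha>\<in>Rp. \<bar>c \<alpha> x\<bar>))" for n
    proof (rule AE_I2)
      fix x :: "real^'n"
      have r: "\<bar>?r n \<alpha> x\<bar> \<le> 1" for \<alpha>
        using sq_add_pos[OF \<epsilon>(1), of "inner \<alpha> x" n] \<epsilon>(1)[of n] by simp
      have "\<bar>\<Sum>\<alpha>\<in>Rp. c \<alpha> x * ?r n \<alpha> x\<bar> \<le> (\<Sum>\<alpha>\<in>Rp. \<bar>c \<alpha> x\<bar>)"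
        by (rule order_trans[OF sum_abs sum_mono])
          (use mult_left_mono[OF r] in \<open>fastforce simp: abs_mult\<close>)
      then have "\<bar>a x + (\<Sum>\<alpha>\<in>Rp. c \<alpha> x * ?r n \<alpha> x)\<bar> \<le> \<bar>a x\<bar> + (\<Sum>\<alpha>\<in>Rp. \<bar>c \<alpha> x\<bar>)" by linarith
      then show "norm (?G n x) \<le> wt_reg 1 x * (\<bar>a x\<bar> + (\<Sum>\<alpha>\<in>Rp. \<bar>c \<alpha> x\<bar>))"
        using wt_reg_mono[OF \<epsilon>, of n x] by (simp add: abs_mult mult_mono)
    qed
    show "AE x in lborel. (\<lambda>n. ?G n x) \<longlonglongrightarrow> wt x * (a x + (\<Sum>\<alpha>\<in>Rp. c \<alpha> x))"
    proof (rule AE_I2)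
      fix x :: "real^'n"
      note w = wt_reg_tendsto[OF \<epsilon>0 \<epsilon>(1), of x]
      \<comment> \<open>On the mirror of \<alpha> the quotient is constantly 0 instead of tending to
        1. The limit is still right because there either \<kappa> \<alpha> = 0, which makes
        \<open>c\<close> vanish, or the weight itself vanishes.\<close>
      have "(\<lambda>n. wt_reg (\<epsilon> n) x * (c \<alpha> x * ?r n \<alpha> x)) \<longlonglongrightarrow> wt x * c \<alpha> x" if \<alpha>: "\<alpha> \<in> Rp" for \<alpha>
      proof (cases "inner \<alpha> x = 0")
        case True
        have z: "wt x * c \<alpha> x = 0"
        proof (cases "\<kappa> \<alpha> = 0")
          case False
          then have "wt x = 0" unfolding wt_eq using True \<alpha> finite_Rp by (intro prod_zero) auto
          then show ?thesis by simp
        qed (simp add: c_def)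
        show ?thesis unfolding z using True by simp
      next
        case False
        have "(\<lambda>n. ?r n \<alpha> x) \<longlonglongrightarrow> (inner \<alpha> x)\<^sup>2 / ((inner \<alpha> x)\<^sup>2 + 0)"
          using False by (intro tendsto_intros \<epsilon>0) simp
        then have "(\<lambda>n. ?r n \<alpha> x) \<longlonglongrightarrow> 1" using False by simp
        from tendsto_mult[OF w tendsto_mult[OF tendsto_const this]] show ?thesis by simp
      qed
      then have "(\<lambda>n. wt_reg (\<epsilon> n) x * a x + (\<Sum>\<alpha>\<in>Rp. wt_reg (\<epsilon> n) x * (c \<alpha> x * ?r n \<alpha> x)))
         \<longlonglongrightarrow> wt x * a x + (\<Sum>\<alpha>\<in>Rp. wt x * c \<alpha> x)"
        by (rule tendsto_add[OF tendsto_mult[OF w tendsto_const] tendsto_sum])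
      then show "(\<lambda>n. ?G n x) \<longlonglongrightarrow> wt x * (a x + (\<Sum>\<alpha>\<in>Rp. c \<alpha> x))"
        by (simp add: distrib_left sum_distrib_left)
    qed
  qed
  moreover have "(\<integral>x. ?G n x \<partial>lborel) = 0" for n
    unfolding a_def c_def by (rule integral_by_parts_reg[OF p \<epsilon>(1)])
  ultimately have 0: "(\<integral>x. wt x * (a x + (\<Sum>\<alpha>\<in>Rp. c \<alpha> x)) \<partial>lborel) = 0"
    by (simp add: LIMSEQ_const_iff)
  have "wt x * (a x + (\<Sum>\<alpha>\<in>Rp. c \<alpha> x)) = (cutoff x)\<^sup>2 * (D v p x * wt x) - 4 * (cutoff x * (inner v x * p x * wt x))" for x
    unfolding hp.D_smooth[OF p UNIV_I] a_def c_def sum_distrib_left[symmetric] by (simp add: algebra_simps)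
  moreover have "integrable lborel (\<lambda>x. (cutoff x)\<^sup>2 * (D v p x * wt x))"
    by (rule integrable_continuous_support[of _ 1])
      (auto simp: cutoff_eq_0 intro!: continuous_intros continuous_on_wt smooth_on_continuous[OF hp.smooth_on_D[OF p]])
  moreover have "integrable lborel (\<lambda>x. cutoff x * (inner v x * p x * wt x))"
    by (rule integrable_continuous_support[of _ 1])
      (auto simp: cutoff_eq_0 intro!: continuous_intros continuous_on_wt pc)
  ultimately show ?thesis using 0 by simp
qed

subsection \<open>The spherical functional\<close>

definition sint :: "(real^'n \<Rightarrow> real) \<Rightarrow> real" where
  "sint g = sphere_integral (\<lambda>y. g y * wt y)"

lemma sphere_integrable_wt: "continuous_on (sphere 0 1) g \<Longrightarrow> sphere_integrable (\<lambda>y. g y * wt y)"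
  by (intro sphere_integrable_continuous continuous_on_mult continuous_on_wt)

lemma sint_add:
  "continuous_on (sphere 0 1) f \<Longrightarrow> continuous_on (sphere 0 1) g \<Longrightarrow> sint (\<lambda>x. f x + g x) = sint f + sint g"
  unfolding sint_def by (simp add: distrib_right sphere_integral_add sphere_integrable_wt)

lemma sint_cmult: "sint (\<lambda>x. c * f x) = c * sint f"
  unfolding sint_def using sphere_integral_cmult[of c "\<lambda>y. f y * wt y"] by (simp add: mult.assoc)

lemma sint_sum:
  "(\<And>i. i \<in> I \<Longrightarrow> continuous_on (sphere 0 1) (f i)) \<Longrightarrow> sint (\<lambda>x. \<Sum>i\<in>I. f i x) = (\<Sum>i\<in>I. sint (f i))"
proof (induction I rule: infinite_finite_induct)
  case (insert i I)
  then have "sint (\<lambda>x. f i x + (\<Sum>i\<in>I. f i x)) = sint (f i) + sint (\<lambda>x. \<Sum>i\<in>I. f i x)"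
    by (intro sint_add continuous_on_sum) auto
  with insert show ?case by simp
qed (use sint_cmult[of 0] in simp_all)

lemma sint_refl:
  assumes "\<beta> \<in> R" "continuous_on (sphere 0 1) g"
  shows "sint (\<lambda>x. g (refl \<beta> x)) = sint g"
  using sphere_integral_refl[of "\<lambda>y. g y * wt y" \<beta>] assms
  by (simp add: sint_def wt_refl continuous_on_mult continuous_on_wt)

lemma hpoly_wt_homogeneous:
  assumes "hpoly k p" "t > 0"
  shows "p (t *\<^sub>R x) * wt (t *\<^sub>R x) = t powr (real k + 2 * sum \<kappa> Rp) * (p x * wt x)"
  using assms by (simp add: hpoly_homogeneous wt_homogeneous powr_add powr_realpow)

lemma sum_kappa_nonneg: "0 \<le> sum \<kappa> Rp"
  by (intro sum_nonneg kappa_Rp_nonneg)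

text \<open>The degree \<open>j\<close> of D v p is kept apart from k - 1 because of k = 0, where
  natural subtraction gives 0 and D v p is zero. Otherwise ?\<tau> = ?\<sigma> + 2, the factors
  (?\<sigma> + 2)(?\<sigma> + 4) cancel between both moments, and ?\<sigma> = k + 2\<lambda> + 1
  remains.\<close>

lemma sint_D_of_degree:
  assumes p: "hpoly k p" and k: "real j = real k - 1 \<or> D v p = (\<lambda>_. 0)" "hpoly j (D v p)"
  shows "sint (D v p) = (real k + 2 * lambda_k Rp \<kappa> + 1) * sint (\<lambda>x. inner v x * p x)"
  and "D v p = (\<lambda>_. 0) \<Longrightarrow> sint (\<lambda>x. inner v x * p x) = 0"
proof -
  have q: "hpoly (Suc k) (\<lambda>x. inner v x * p x)" by (rule hp.graded_inner_mult[OF p])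
  let ?\<sigma> = "real CARD('n) + (real j + 2 * sum \<kappa> Rp)"
  let ?\<tau> = "real CARD('n) + (real (Suc k) + 2 * sum \<kappa> Rp)"
  have pos: "?\<sigma> > 0" "?\<tau> > 0" using sum_kappa_nonneg by (simp_all add: add_pos_nonneg)
  have 1: "(\<integral>x. (cutoff x)\<^sup>2 * (D v p x * wt x) \<partial>lborel) = 8 * sint (D v p) / (?\<sigma> * (?\<sigma> + 2) * (?\<sigma> + 4))"
    unfolding sint_def using sum_kappa_nonneg
    by (intro sphere_integral_weighted(2) continuous_on_mult continuous_on_wt hpoly_continuous[OF k(2)]
        hpoly_wt_homogeneous[OF k(2)]) auto
  have 2: "(\<integral>x. cutoff x * (inner v x * p x * wt x) \<partial>lborel) = 2 * sint (\<lambda>x. inner v x * p x) / (?\<tau> * (?\<tau> + 2))"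
    unfolding sint_def using sum_kappa_nonneg
    by (intro sphere_integral_weighted(1) continuous_on_mult continuous_on_wt hpoly_continuous[OF q]
        hpoly_wt_homogeneous[OF q]) auto
  have eq: "8 * sint (D v p) / (?\<sigma> * (?\<sigma> + 2) * (?\<sigma> + 4)) = 4 * (2 * sint (\<lambda>x. inner v x * p x) / (?\<tau> * (?\<tau> + 2)))"
    using integral_by_parts[OF hpoly_smooth[OF p], of v] unfolding 1 2 .
  have sint0: "sint (\<lambda>_. 0) = 0" using sint_cmult[of 0] by simp
  show z: "sint (\<lambda>x. inner v x * p x) = 0" if "D v p = (\<lambda>_. 0)"
    using eq pos sint0 that by (simp add: divide_simps split: if_splits)
  show "sint (D v p) = (real k + 2 * lambda_k Rp \<kappa> + 1) * sint (\<lambda>x. inner v x * p x)"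
  proof (cases "D v p = (\<lambda>_. 0)")
    case True
    then show ?thesis using z sint0 by simp
  next
    case False
    with k have \<tau>: "?\<tau> = ?\<sigma> + 2" by simp
    have \<sigma>: "?\<sigma> = real k + 2 * lambda_k Rp \<kappa> + 1" using False k by (simp add: lambda_k_def field_simps)
    have *: "s = \<sigma> * u" if "8 * s / (\<sigma> * (\<sigma> + 2) * (\<sigma> + 4)) = 4 * (2 * u / ((\<sigma> + 2) * (\<sigma> + 2 + 2)))" "\<sigma> > 0"
      for s u \<sigma> :: real
    proof -
      have "\<sigma> \<noteq> 0" "\<sigma> + 2 \<noteq> 0" "\<sigma> + 4 \<noteq> 0" using that(2) by auto
      then have "s * (\<sigma> + 4) = (\<sigma> * u) * (\<sigma> + 4)" using that(1) by (simp add: divide_simps mult_ac add.commute)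
      then show ?thesis using \<open>\<sigma> + 4 \<noteq> 0\<close> by simp
    qed
    show ?thesis using *[OF eq[unfolded \<tau>] pos(1)] unfolding \<sigma> .
  qed
qed

lemma sint_D:
  assumes p: "hpoly k p"
  shows "sint (D v p) = (real k + 2 * lambda_k Rp \<kappa> + 1) * sint (\<lambda>x. inner v x * p x)"
  and "k = 0 \<Longrightarrow> sint (\<lambda>x. inner v x * p x) = 0"
  using sint_D_of_degree[OF p _ hp.graded_D[OF p], of v] D_hpoly_0[of p v] p by (cases k; simp)+

text \<open>The vector defining the positive system lies on no mirror. It can be 0 only if
  \<open>R\<close> is empty, and then the weight is 1 everywhere. A nonzero point is wanted so that
  it can be scaled into the unit ball.\<close>

lemma wt_not_identically_0: "\<exists>x. x \<noteq> 0 \<and> wt x \<noteq> 0"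
proof -
  obtain \<beta> where \<beta>: "\<forall>\<alpha>\<in>R. inner \<alpha> \<beta> \<noteq> 0" using positive by (auto simp: positive_system_def)
  then have "wt \<beta> \<noteq> 0" unfolding wt_eq using Rp_subset finite_Rp by (auto simp: prod_zero_iff)
  moreover have "wt (axis undefined 1) \<noteq> 0" if "\<beta> = 0"
    using \<beta> that Rp_subset by (auto simp: hk_def)
  moreover have "axis undefined 1 \<noteq> (0 :: real^'n)" by (simp add: axis_eq_0_iff)
  ultimately show ?thesis by metis
qed

text \<open>Homogeneity turns the sphere integral into one over the ball, where the continuous
  nonnegative weight is nonzero on a nonempty open set. This justifies dividing by the total
  mass.\<close>

lemma sint_1_pos: "sint (\<lambda>_. 1) > 0"
proof -
  have I: "sint (\<lambda>_. 1) = (real CARD('n) + 2 * sum \<kappa> Rp) * (\<integral>x. indicator (ball 0 1) x * wt x \<partial>lborel)"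
    unfolding sint_def using sphere_integral_homogeneous[OF continuous_on_wt wt_homogeneous] sum_kappa_nonneg by simp
  obtain y where y: "y \<noteq> 0" "wt y \<noteq> 0" using wt_not_identically_0 by blast
  define x where "x = (1 / (2 * norm y)) *\<^sub>R y"
  have x: "x \<in> ball 0 1" "wt x \<noteq> 0" using y by (simp_all add: x_def wt_homogeneous)
  let ?f = "\<lambda>x. indicator (ball 0 1) x * wt x"
  have int: "integrable lborel ?f"
    by (rule integrable_continuous_on_bounded[OF _ _ continuous_on_wt]) simp_all
  have "(\<integral>x. ?f x \<partial>lborel) \<noteq> 0"
  proof
    assume "(\<integral>x. ?f x \<partial>lborel) = 0"
    then have ae: "AE x in lborel. ?f x = 0"
      using integral_nonneg_eq_0_iff_AE[OF int] by simp
    have "open (ball 0 1 \<inter> {x. wt x \<noteq> 0})"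
      by (intro open_Int open_ball open_Collect_neq continuous_on_wt continuous_on_const)
    moreover have "ball 0 1 \<inter> {x. wt x \<noteq> 0} \<noteq> {}" using x by blast
    ultimately have ne: "\<not> negligible (ball 0 1 \<inter> {x. wt x \<noteq> 0})" by (rule open_not_negligible)
    have "AE x in lborel. x \<notin> ball 0 1 \<inter> {x. wt x \<noteq> 0}"
      using ae by eventually_elim auto
    moreover have "ball 0 1 \<inter> {x. wt x \<noteq> 0} \<in> sets lborel"
      using borel_open[OF \<open>open (ball 0 1 \<inter> {x. wt x \<noteq> 0})\<close>] by simp
    ultimately have "ball 0 1 \<inter> {x. wt x \<noteq> 0} \<in> null_sets lborel"
      using AE_iff_null_sets by blast
    with ne show False by (simp add: negligible_iff_null_sets null_sets_completionI)
  qed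
  moreover have "(\<integral>x. ?f x \<partial>lborel) \<ge> 0" by (intro integral_nonneg_AE) simp
  ultimately have "(\<integral>x. ?f x \<partial>lborel) > 0" by linarith
  then show ?thesis unfolding I using sum_kappa_nonneg by (intro mult_pos_pos add_pos_nonneg) simp_all
qed

end


section \<open>Pairing with harmonic polynomials\<close>

text \<open>These are the radial Gaussian moments, the integrals of r^(k+2l+1) e^(-r^2/2) over r >
  0, scaled to 1 at k = 0 and k = 1; integration by parts in r gives the recursion. The two parities
  may be scaled independently because only degrees of equal parity are ever compared.\<close>

fun rec_const :: "real \<Rightarrow> nat \<Rightarrow> real" where
  "rec_const l 0 = 1"
| "rec_const l (Suc 0) = 1"
| "rec_const l (Suc (Suc k)) = (real k + 2 * l + 2) * rec_const l k"

lemma rec_const_pos: "l > -1 \<Longrightarrow> rec_const l k > 0"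
  by (induction l k rule: rec_const.induct) simp_all

lemma rec_const_even: "rec_const l (2 * k) = 2 ^ k * pochhammer (l + 1) k"
  by (induction k) (simp_all add: pochhammer_Suc algebra_simps)

definition list_mono :: "'n list \<Rightarrow> real^'n \<Rightarrow> real" where
  "list_mono ks x = prod_list (map (\<lambda>k. x $ k) ks)"

lemma list_mono_simps [simp]:
  "list_mono [] x = 1" "list_mono (k # ks) x = x $ k * list_mono ks x"
  by (simp_all add: list_mono_def)

lemma list_mono_eq: "list_mono ks x = (\<Prod>i\<in>UNIV. (x $ i) ^ count_list ks i)"
proof (induction ks)
  case (Cons k ks)
  have "(\<Prod>i\<in>UNIV. (x $ i) ^ count_list (k # ks) i)
      = (\<Prod>i\<in>UNIV. (if i = k then x $ i else 1) * (x $ i) ^ count_list ks i)"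
    by (rule prod.cong) simp_all
  also have "\<dots> = x $ k * list_mono ks x"
    unfolding prod.distrib Cons.IH by simp
  finally show ?case by simp
qed simp

lemma count_list_replicate_eq: "count_list (replicate n i) j = (if i = j then n else 0)"
  by (induction n) auto

lemma ex_list_with_counts:
  fixes a :: "'n::finite \<Rightarrow> nat"
  shows "\<exists>ks. \<forall>i. count_list ks i = a i"
proof -
  have "\<exists>ks. \<forall>i. count_list ks i = (if i \<in> I then a i else 0)" for I :: "'n set"
    using finite[of I]
  proof (induction I rule: finite_induct)
    case empty
    show ?case by (rule exI[of _ "[]"]) simp
  next
    case (insert j I)
    then obtain ks where "\<forall>i. count_list ks i = (if i \<in> I then a i else 0)" by blast
    with insert.hyps show ?case
      by (intro exI[of _ "replicate (a j) j @ ks"]) (auto simp: count_list_replicate_eq)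
  qed
  from this[of UNIV] show ?thesis by simp
qed

text \<open>Names the choice made inside \<open>dunkl_mono\<close>, so that a monomial and its Dunkl
  operator are indexed by the same list.\<close>

definition count_choice :: "('n::finite \<Rightarrow> nat) \<Rightarrow> 'n list" where
  "count_choice a = (SOME ks. \<forall>i. count_list ks i = a i)"

lemma count_list_count_choice: "count_list (count_choice a) i = a i"
  unfolding count_choice_def using someI_ex[OF ex_list_with_counts[of a]] by blast

lemma list_mono_count_choice: "list_mono (count_choice a) x = (\<Prod>i\<in>UNIV. (x $ i) ^ a i)"
  by (simp add: list_mono_eq count_list_count_choice)

lemma length_count_choice: "length (count_choice a) = mdeg a"
proof -
  have "(\<Sum>i\<in>UNIV. count_list (count_choice a) i) = length (count_choice a)"
    by (rule sum_count_set) simp_all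
  then show ?thesis by (simp add: mdeg_def count_list_count_choice)
qed

lemma mpoly_fun_eq: "mpoly_fun A c = (\<lambda>x. \<Sum>a\<in>A. c a * list_mono (count_choice a) x)"
  by (simp add: fun_eq_iff mpoly_fun_def list_mono_count_choice)

lemma mpoly_dunkl_eq:
  "mpoly_dunkl Rp \<kappa> A c f = (\<lambda>x. \<Sum>a\<in>A. c a * dunkl_list Rp \<kappa> (count_choice a) f x)"
  by (simp add: fun_eq_iff mpoly_dunkl_def dunkl_mono_def count_choice_def)

text \<open>Both sides are the derivative of t \<mapsto> p(t x) at t = 1, by the chain rule and by
  homogeneity.\<close>

lemma hpoly_euler:
  assumes "hpoly k p" "(p has_derivative p') (at x)"
  shows "p' x = real k * p x"
proof -
  interpret linear p' by (rule has_derivative_linear[OF assms(2)])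
  have "((\<lambda>t::real. t *\<^sub>R x) has_derivative (\<lambda>s. s *\<^sub>R x)) (at 1)"
    by (auto intro!: derivative_eq_intros)
  from has_derivative_compose[OF this, of p p'] assms(2)
  have "((\<lambda>t::real. p (t *\<^sub>R x)) has_real_derivative p' x) (at 1)"
    by (simp add: has_field_derivative_def scaleR mult_commute_abs)
  moreover have "((\<lambda>t::real. p (t *\<^sub>R x)) has_real_derivative real k * p x) (at 1)"
    unfolding hpoly_homogeneous[OF assms(1)] by (auto intro!: derivative_eq_intros)
  ultimately show ?thesis by (rule DERIV_unique)
qed

context dunkl_setting
begin

lemma Lap_cmult: "smooth_on UNIV f \<Longrightarrow> Lap (\<lambda>x. c * f x) = (\<lambda>x. c * Lap f x)"
proof -
  assume f: "smooth_on UNIV f"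
  have "D v (\<lambda>x. c * g x) = (\<lambda>x. c * D v g x)" if "smooth_on UNIV g" for v g
    using that by (simp add: fun_eq_iff hp.D_cmult)
  then show ?thesis using f by (simp add: hp.Lap_eq hp.smooth_on_D sum_distrib_left)
qed

lemma Lap_sum:
  assumes "\<And>i. i \<in> I \<Longrightarrow> smooth_on UNIV (f i)"
  shows "Lap (\<lambda>x. \<Sum>i\<in>I. f i x) = (\<lambda>x. \<Sum>i\<in>I. Lap (f i) x)"
proof -
  have "D v (\<lambda>x. \<Sum>i\<in>I. g i x) = (\<lambda>x. \<Sum>i\<in>I. D v (g i) x)" if "\<And>i. i \<in> I \<Longrightarrow> smooth_on UNIV (g i)" for v g
    using that by (simp add: fun_eq_iff hp.D_sum)
  then show ?thesis using assms by (simp add: hp.Lap_eq hp.smooth_on_D sum.swap[of _ I])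
qed

lemma Lap_pow_linear_combination:
  assumes "\<And>i. i \<in> I \<Longrightarrow> smooth_on UNIV (f i)"
  shows "(Lap ^^ n) (\<lambda>x. \<Sum>i\<in>I. c i * f i x) = (\<lambda>x. \<Sum>i\<in>I. c i * (Lap ^^ n) (f i) x)"
proof (induction n)
  case (Suc n)
  have "(Lap ^^ Suc n) (\<lambda>x. \<Sum>i\<in>I. c i * f i x) = Lap (\<lambda>x. \<Sum>i\<in>I. c i * (Lap ^^ n) (f i) x)"
    using Suc by simp
  also have "\<dots> = (\<lambda>x. \<Sum>i\<in>I. Lap (\<lambda>x. c i * (Lap ^^ n) (f i) x) x)"
    by (rule Lap_sum) (simp add: smooth_on_cmult hp.smooth_on_Lap_pow assms)
  also have "\<dots> = (\<lambda>x. \<Sum>i\<in>I. c i * (Lap ^^ Suc n) (f i) x)"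
    by (intro ext sum.cong HOL.refl) (simp add: Lap_cmult hp.smooth_on_Lap_pow assms)
  finally show ?case .
qed simp

lemma hpoly_list_mono: "hpoly (length ks) (list_mono ks)"
proof (induction ks)
  case Nil
  show ?case using hpoly_const[of 1] by (simp add: list_mono_def)
next
  case (Cons k ks)
  have "list_mono (k # ks) = (\<lambda>x. x $ k * list_mono ks x)" by auto
  with graded.coord[OF Cons, of k] show ?case by simp
qed

lemma hpoly_continuous_sphere: "hpoly k (f :: real^'n \<Rightarrow> real) \<Longrightarrow> continuous_on (sphere 0 1) f"
  using hpoly_continuous continuous_on_subset by blast

lemma dquot_mult:
  fixes \<alpha> :: "real^'n"
  assumes f: "smooth_on UNIV f" and g: "smooth_on UNIV g" and \<alpha>: "\<alpha> \<noteq> 0"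
  shows "dquot \<alpha> (\<lambda>x. f x * g x) x =
    dquot \<alpha> f x * g x + f x * dquot \<alpha> g x - inner \<alpha> x * (dquot \<alpha> f x * dquot \<alpha> g x)"
proof -
  have "frechet_derivative (\<lambda>x. f x * g x) (at x) = (\<lambda>v. f x * frechet_derivative g (at x) v + frechet_derivative f (at x) v * g x)"
    using frechet_derivative_at[OF has_derivative_mult[OF smooth_on_has_derivative[OF f UNIV_I]
          smooth_on_has_derivative[OF g UNIV_I]]] by simp
  then have 1: ?thesis if "inner \<alpha> x = 0"
    using f g \<alpha> that by (simp add: hp.dquot_smooth smooth_on_mult algebra_simps)
  have "(a * b - a' * b') / i = (a - a') / i * b + a * ((b - b') / i) - i * ((a - a') / i * ((b - b') / i))"
    if "i \<noteq> 0" for a b a' b' i :: real using that by (simp add: field_simps)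
  then have ?thesis if "inner \<alpha> x \<noteq> 0" using that by (simp add: dquot_def)
  with 1 show ?thesis by blast
qed

text \<open>D is not a derivation. Its defect is a combination of the functions <\<alpha>,x>
  \<open>dquot \<alpha> f\<close> \<open>dquot \<alpha> g\<close>; the divided differences are even
  and <\<alpha>,x> is odd under the reflection in \<alpha>, so the defect integrates to
  zero.\<close>

lemma sint_D_mult:
  assumes f: "hpoly a f" and g: "hpoly b g"
  shows "sint (D v (\<lambda>x. f x * g x)) = sint (\<lambda>x. D v f x * g x) + sint (\<lambda>x. f x * D v g x)"
proof -
  note fs = hpoly_smooth[OF f] and gs = hpoly_smooth[OF g]
  define E where "E = (\<lambda>\<alpha> x. inner \<alpha> x * (dquot \<alpha> f x * dquot \<alpha> g x))"
  have E_cont: "continuous_on (sphere 0 1) (E \<alpha>)" if "\<alpha> \<in> Rp" for \<alpha>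
    unfolding E_def
    by (intro continuous_intros continuous_on_subset[OF dquot_continuous[OF fs that]]
        continuous_on_subset[OF dquot_continuous[OF gs that]]) simp_all
  have E0: "sint (E \<alpha>) = 0" if \<alpha>: "\<alpha> \<in> Rp" for \<alpha>
  proof -
    have \<alpha>0: "\<alpha> \<noteq> 0" using hp.Rp_nonzero[OF \<alpha>] .
    have i: "inner \<alpha> (refl \<alpha> x) = - inner \<alpha> x" for x
      using inner_refl_left[of \<alpha> \<alpha> x] refl_self[OF \<alpha>0] by simp
    have "E \<alpha> (refl \<alpha> x) = (- 1) * E \<alpha> x" for x
    proof (cases "inner \<alpha> x = 0")
      case True
      then show ?thesis by (simp add: E_def refl_fixed)
    next
      case False
      have *: "(u - w) / (- i) = (w - u) / i" for u w i :: real by (simp add: divide_minus_right minus_divide_left)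
      from False show ?thesis by (simp only: E_def dquot_def i neg_equal_0_iff_equal not_False_eq_True if_True refl_refl *)
    qed
    then have "sint (\<lambda>x. E \<alpha> (refl \<alpha> x)) = - sint (E \<alpha>)" using sint_cmult[of "-1" "E \<alpha>"] by simp
    then show ?thesis using sint_refl[OF _ E_cont[OF \<alpha>], of \<alpha>] \<alpha> Rp_subset by auto
  qed
  have eq: "D v (\<lambda>x. f x * g x) x = (D v f x * g x + f x * D v g x) + (\<Sum>\<alpha>\<in>Rp. (- (\<kappa> \<alpha> * inner \<alpha> v)) * E \<alpha> x)" for x
  proof -
    have "frechet_derivative (\<lambda>x. f x * g x) (at x) v = f x * frechet_derivative g (at x) v + frechet_derivative f (at x) v * g x"
      using frechet_derivative_at[OF has_derivative_mult[OF smooth_on_has_derivative[OF fs UNIV_I, of x]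
            smooth_on_has_derivative[OF gs UNIV_I, of x]], THEN fun_cong, of v] by simp
    moreover have "(\<Sum>\<alpha>\<in>Rp. \<kappa> \<alpha> * inner \<alpha> v * dquot \<alpha> (\<lambda>x. f x * g x) x)
      = (\<Sum>\<alpha>\<in>Rp. (\<kappa> \<alpha> * inner \<alpha> v * dquot \<alpha> f x) * g x + f x * (\<kappa> \<alpha> * inner \<alpha> v * dquot \<alpha> g x)
           + (- (\<kappa> \<alpha> * inner \<alpha> v)) * E \<alpha> x)"
    proof (rule sum.cong)
      fix \<alpha> assume "\<alpha> \<in> Rp"
      show "\<kappa> \<alpha> * inner \<alpha> v * dquot \<alpha> (\<lambda>x. f x * g x) x
        = (\<kappa> \<alpha> * inner \<alpha> v * dquot \<alpha> f x) * g x + f x * (\<kappa> \<alpha> * inner \<alpha> v * dquot \<alpha> g x)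
           + (- (\<kappa> \<alpha> * inner \<alpha> v)) * E \<alpha> x"
        unfolding dquot_mult[OF fs gs hp.Rp_nonzero[OF \<open>\<alpha> \<in> Rp\<close>]] E_def by (simp add: algebra_simps)
    qed simp
    ultimately have "D v (\<lambda>x. f x * g x) x = f x * frechet_derivative g (at x) v + frechet_derivative f (at x) v * g x
      + ((\<Sum>\<alpha>\<in>Rp. \<kappa> \<alpha> * inner \<alpha> v * dquot \<alpha> f x) * g x + f x * (\<Sum>\<alpha>\<in>Rp. \<kappa> \<alpha> * inner \<alpha> v * dquot \<alpha> g x)
        + (\<Sum>\<alpha>\<in>Rp. (- (\<kappa> \<alpha> * inner \<alpha> v)) * E \<alpha> x))"
      unfolding sum.distrib sum_distrib_left sum_distrib_right
      using fs gs by (simp only: hp.D_smooth[OF smooth_on_mult[OF open_UNIV fs gs] UNIV_I])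
    then show ?thesis unfolding hp.D_smooth[OF fs UNIV_I] hp.D_smooth[OF gs UNIV_I] by (simp only: algebra_simps)
  qed
  have c: "continuous_on (sphere 0 1) (\<lambda>x. D v f x * g x)" "continuous_on (sphere 0 1) (\<lambda>x. f x * D v g x)"
    by (intro continuous_on_mult hpoly_continuous_sphere[OF f] hpoly_continuous_sphere[OF g]
        hpoly_continuous_sphere[OF hp.graded_D[OF f]] hpoly_continuous_sphere[OF hp.graded_D[OF g]])+
  have "D v (\<lambda>x. f x * g x) = (\<lambda>x. (D v f x * g x + f x * D v g x) + (\<Sum>\<alpha>\<in>Rp. (- (\<kappa> \<alpha> * inner \<alpha> v)) * E \<alpha> x))"
    using eq by blast
  then have "sint (D v (\<lambda>x. f x * g x)) = sint (\<lambda>x. (D v f x * g x + f x * D v g x) + (\<Sum>\<alpha>\<in>Rp. (- (\<kappa> \<alpha> * inner \<alpha> v)) * E \<alpha> x))"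
    by (rule arg_cong)
  also have "\<dots> = sint (\<lambda>x. D v f x * g x + f x * D v g x) + sint (\<lambda>x. \<Sum>\<alpha>\<in>Rp. (- (\<kappa> \<alpha> * inner \<alpha> v)) * E \<alpha> x)"
    by (intro sint_add continuous_on_add continuous_on_sum continuous_on_mult continuous_on_const c E_cont)
  also have "sint (\<lambda>x. \<Sum>\<alpha>\<in>Rp. (- (\<kappa> \<alpha> * inner \<alpha> v)) * E \<alpha> x) = (\<Sum>\<alpha>\<in>Rp. sint (\<lambda>x. (- (\<kappa> \<alpha> * inner \<alpha> v)) * E \<alpha> x))"
    by (rule sint_sum) (rule continuous_on_mult[OF continuous_on_const E_cont])
  also have "\<dots> = 0" unfolding sint_cmult by (simp add: E0)
  finally show ?thesis using sint_add[OF c] by simp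
qed

abbreviation rc :: "nat \<Rightarrow> real" where
  "rc \<equiv> rec_const (lambda_k Rp \<kappa>)"

lemma lambda_k_gt: "lambda_k Rp \<kappa> > -1"
  using sum_kappa_nonneg by (simp add: lambda_k_def add_pos_nonneg)

lemma sint_zero: "sint (\<lambda>_. 0) = 0"
  using sint_cmult[of 0] by simp

text \<open>The constants \<open>rc\<close> absorb the degree-dependent factor of
  \<open>sint_D\<close>, leaving the form of Gaussian integration by parts. For a + b = 0 the index
  a + b - 1 is truncated, but both sides are zero.\<close>

lemma sint_adjoint:
  assumes f: "hpoly a f" and g: "hpoly b g"
  shows "rc (a + b + 1) * sint (\<lambda>x. x $ j * f x * g x) =
    rc (a + b - 1) * (sint (\<lambda>x. D (axis j 1) f x * g x) + sint (\<lambda>x. f x * D (axis j 1) g x))"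
proof -
  note fg = hpoly_mult[OF f g]
  have xj: "(\<lambda>x. inner (axis j 1) x * (f x * g x)) = (\<lambda>x. x $ j * f x * g x)"
    by (simp add: inner_axis' mult.assoc)
  show ?thesis
  proof (cases "a + b")
    case 0
    then have "D (axis j 1) f = (\<lambda>_. 0)" "D (axis j 1) g = (\<lambda>_. 0)" using f g D_hpoly_0 by auto
    moreover have "sint (\<lambda>x. x $ j * f x * g x) = 0" using sint_D(2)[OF fg 0, of "axis j 1"] xj by simp
    ultimately show ?thesis by (simp add: sint_zero)
  next
    case (Suc k)
    have "sint (D (axis j 1) (\<lambda>x. f x * g x)) = (real k + 2 * lambda_k Rp \<kappa> + 2) * sint (\<lambda>x. x $ j * f x * g x)"
      using sint_D(1)[OF fg, of "axis j 1"] xj Suc by (simp add: algebra_simps)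
    then show ?thesis using sint_D_mult[OF f g, of "axis j 1"] Suc by (simp add: mult_ac)
  qed
qed

text \<open>Up to normalisation this is the Fischer-type pairing \<open>\<langle>p, exp(-Lap/2) v\<rangle>\<close>, for which
  multiplication by a coordinate is adjoint to the corresponding Dunkl operator.\<close>
definition fischer :: "nat \<Rightarrow> nat \<Rightarrow> (real^'n \<Rightarrow> real) \<Rightarrow> (real^'n \<Rightarrow> real) \<Rightarrow> real" where
  "fischer M s p v = (\<Sum>n\<le>M. (-1/2) ^ n / fact n * (rc (s - 2 * n) * sint (\<lambda>x. p x * (Lap ^^ n) v x)))"

text \<open>Adjointness turns the n-th term of x_k v into \<open>V n\<close>, with D_k on p, plus
  \<open>U n\<close>, with D_k on Lap^n v; commuting x_k past Lap^n adds 2n times the previous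
  \<open>U\<close>. As the coefficient (-1/2)^(n+1)/(n+1)! times 2(n+1) is minus its predecessor,
  all \<open>U\<close> cancel except \<open>U M\<close>, and that vanishes by b < 2M.\<close>

lemma fischer_step:
  assumes p: "hpoly a p" and v: "hpoly b v" and M: "b < 2 * M"
  shows "fischer M (a - 1 + b) (D (axis k 1) p) v = fischer M (a + b + 1) p (\<lambda>x. x $ k * v x)"
proof -
  define e where "e = (\<lambda>n. (-1/2 :: real) ^ n / fact n)"
  define U where "U = (\<lambda>n. rc (a + b - 1 - 2 * n) * sint (\<lambda>x. p x * D (axis k 1) ((Lap ^^ n) v) x))"
  define V where "V = (\<lambda>n. rc (a - 1 + b - 2 * n) * sint (\<lambda>x. D (axis k 1) p x * (Lap ^^ n) v x))"
  have Lv: "hpoly (b - 2 * n) ((Lap ^^ n) v)" for n by (rule hp.graded_Lap_pow[OF v])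
  \<comment> \<open>Degrees are natural numbers. Wherever truncated subtraction would give a wrong
    index, a polynomial is zero: Lap^n v if b < 2n, and D p if a = 0.\<close>
  have 1: "rc (a + b + 1 - 2 * n) * sint (\<lambda>x. x $ k * p x * (Lap ^^ n) v x) = V n + U n" for n
  proof (cases "b < 2 * n")
    case True
    then show ?thesis using Lap_pow_hpoly_eq_0[OF v True] by (simp add: U_def V_def sint_zero D_zero)
  next
    case False
    then have "a + b + 1 - 2 * n = a + (b - 2 * n) + 1" "a + b - 1 - 2 * n = a + (b - 2 * n) - 1" by auto
    moreover have "V n = rc (a + (b - 2 * n) - 1) * sint (\<lambda>x. D (axis k 1) p x * (Lap ^^ n) v x)"
    proof (cases "a = 0")
      case True
      then show ?thesis using D_hpoly_0[of p] p by (simp add: V_def sint_zero)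
    next
      case a: False
      with False have "a - 1 + b - 2 * n = a + (b - 2 * n) - 1" by auto
      then show ?thesis by (simp add: V_def)
    qed
    ultimately show ?thesis
      using sint_adjoint[OF p Lv[of n], of k] by (simp add: U_def distrib_left)
  qed
  have 2: "rc (a + b + 1 - 2 * n) * sint (\<lambda>x. p x * (Lap ^^ n) (\<lambda>x. x $ k * v x) x)
     = V n + U n + 2 * real n * (rc (a + b + 1 - 2 * n) * sint (\<lambda>x. p x * D (axis k 1) ((Lap ^^ (n - 1)) v) x))" for n
  proof -
    have "(\<lambda>x. p x * (Lap ^^ n) (\<lambda>x. x $ k * v x) x) = (\<lambda>x. x $ k * p x * (Lap ^^ n) v x
        + 2 * real n * (p x * D (axis k 1) ((Lap ^^ (n - 1)) v) x))"
      unfolding Lap_pow_coord_mult[OF v] by (simp add: algebra_simps)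
    moreover have "continuous_on (sphere 0 1) (\<lambda>x. x $ k * p x * (Lap ^^ n) v x)"
      by (intro continuous_intros hpoly_continuous_sphere[OF p] hpoly_continuous_sphere[OF Lv])
    moreover have "continuous_on (sphere 0 1) (\<lambda>x. 2 * real n * (p x * D (axis k 1) ((Lap ^^ (n - 1)) v) x))"
      by (intro continuous_intros hpoly_continuous_sphere[OF p] hpoly_continuous_sphere[OF hp.graded_D[OF Lv]])
    ultimately have "sint (\<lambda>x. p x * (Lap ^^ n) (\<lambda>x. x $ k * v x) x) = sint (\<lambda>x. x $ k * p x * (Lap ^^ n) v x)
        + 2 * real n * sint (\<lambda>x. p x * D (axis k 1) ((Lap ^^ (n - 1)) v) x)"
      using sint_add sint_cmult by simp
    then show ?thesis using 1[of n] by (simp add: algebra_simps)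
  qed
  have e_Suc: "e (Suc n) * (2 * real (Suc n)) = - e n" for n
  proof -
    have "fact (Suc n) = real (Suc n) * fact n" by simp
    then show ?thesis by (simp add: e_def divide_simps del: of_nat_Suc fact_Suc)
  qed
  have 3: "(\<Sum>n\<le>M. e n * (2 * real n * (rc (a + b + 1 - 2 * n) * sint (\<lambda>x. p x * D (axis k 1) ((Lap ^^ (n - 1)) v) x))))
     = (\<Sum>n<M. - e n * U n)"
  proof -
    have "(\<Sum>n\<le>M. e n * (2 * real n * (rc (a + b + 1 - 2 * n) * sint (\<lambda>x. p x * D (axis k 1) ((Lap ^^ (n - 1)) v) x))))
      = (\<Sum>n<M. e (Suc n) * (2 * real (Suc n) * (rc (a + b + 1 - 2 * Suc n) * sint (\<lambda>x. p x * D (axis k 1) ((Lap ^^ n) v) x))))"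
      by (subst sum.atMost_shift) simp
    also have "\<dots> = (\<Sum>n<M. - e n * U n)"
    proof (rule sum.cong)
      fix n
      have "a + b + 1 - 2 * Suc n = a + b - 1 - 2 * n" by simp
      then show "e (Suc n) * (2 * real (Suc n) * (rc (a + b + 1 - 2 * Suc n) * sint (\<lambda>x. p x * D (axis k 1) ((Lap ^^ n) v) x))) = - e n * U n"
        unfolding e_Suc[symmetric] U_def by (simp del: of_nat_Suc)
    qed simp
    finally show ?thesis .
  qed
  have "U M = 0" using Lap_pow_hpoly_eq_0[OF v M] by (simp add: U_def D_zero sint_zero)
  then have 4: "(\<Sum>n\<le>M. e n * U n) = (\<Sum>n<M. e n * U n)" by (simp add: lessThan_Suc_atMost[symmetric])
  have "fischer M (a + b + 1) p (\<lambda>x. x $ k * v x) = (\<Sum>n\<le>M. e n * V n) + (\<Sum>n\<le>M. e n * U n) + (\<Sum>n<M. - e n * U n)"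
    unfolding fischer_def 2 3[symmetric] by (simp add: e_def distrib_left sum.distrib)
  also have "\<dots> = (\<Sum>n\<le>M. e n * V n)" unfolding 4 by (simp add: sum_negf)
  finally show ?thesis by (simp add: fischer_def e_def V_def)
qed

lemma fischer_dunkl_list:
  assumes p: "hpoly a p" and v: "hpoly b v" and M: "b + length ks < 2 * M"
  shows "fischer M (a - length ks + b) (dunkl_list Rp \<kappa> ks p) v
    = fischer M (a + length ks + b) p (\<lambda>x. list_mono ks x * v x)"
  using v M
proof (induction ks arbitrary: b v)
  case (Cons k ks)
  have "fischer M (a - length ks - 1 + b) (D (axis k 1) (dunkl_list Rp \<kappa> ks p)) v
      = fischer M (a - length ks + b + 1) (dunkl_list Rp \<kappa> ks p) (\<lambda>x. x $ k * v x)"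
    using Cons.prems by (intro fischer_step hp.graded_dunkl_list[OF p]) auto
  also have "\<dots> = fischer M (a - length ks + Suc b) (dunkl_list Rp \<kappa> ks p) (\<lambda>x. x $ k * v x)" by simp
  also have "\<dots> = fischer M (a + length ks + Suc b) p (\<lambda>x. list_mono ks x * (x $ k * v x))"
    using Cons.prems by (intro Cons.IH graded.coord) auto
  finally show ?case by (simp add: mult_ac)
qed simp

lemma fischer_harmonic:
  assumes "Lap v = (\<lambda>_. 0)"
  shows "fischer M s p v = rc s * sint (\<lambda>x. p x * v x)"
proof -
  have "(Lap ^^ Suc n) v = (\<lambda>_. 0)" for n
    using Lap_pow_zero[of n] assms by (simp add: funpow_swap1)
  then have "fischer M s p v = (\<Sum>n\<le>M. if n = 0 then rc s * sint (\<lambda>x. p x * v x) else 0)"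
    unfolding fischer_def by (intro sum.cong HOL.refl) (auto simp: sint_zero gr0_conv_Suc)
  then show ?thesis by simp
qed

lemma sint_dunkl_list:
  assumes p: "hpoly k p" and M: "length ks < 2 * M"
  shows "rc (k - length ks) * sint (dunkl_list Rp \<kappa> ks p) = fischer M (k + length ks) p (list_mono ks)"
proof -
  have 1: "hpoly 0 (\<lambda>_ :: real^'n. 1)" by (rule hpoly_const)
  have "Lap (\<lambda>_. 1) = (\<lambda>_. 0)" by (rule Lap_hpoly_low[OF 1]) simp
  from fischer_harmonic[OF this, of M "k - length ks" "dunkl_list Rp \<kappa> ks p"]
  show ?thesis using fischer_dunkl_list[OF p 1, of ks M] M by simp
qed

lemma hpoly_mpoly_fun:
  assumes "\<forall>a\<in>A. mdeg a = m"
  shows "hpoly m (mpoly_fun A c :: real^'n \<Rightarrow> real)"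
  unfolding mpoly_fun_eq
proof (intro hp.graded_sum hp.graded_cmult)
  fix a assume "a \<in> A"
  then show "hpoly m (list_mono (count_choice a) :: real^'n \<Rightarrow> real)"
    using hpoly_list_mono[of "count_choice a"] assms by (simp add: length_count_choice)
qed

text \<open>A single monomial is in general not harmonic, so its pairing keeps all terms of the
  exponential. Summing with the coefficients \<open>c\<close> first makes the second argument
  harmonic, and only the term n = 0 is left. On the other side the second argument is the constant
  1, with the same effect.\<close>

lemma sint_harmonic_pairing:
  assumes p: "hpoly k p" and A: "\<forall>a\<in>A. mdeg a = m"
    and harm: "Lap (mpoly_fun A c) = (\<lambda>_. 0)"
  shows "rc (k + m) * sint (\<lambda>x. p x * mpoly_fun A c x) = rc (k - m) * sint (mpoly_dunkl Rp \<kappa> A c p)"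
proof -
  define M where "M = Suc m"
  let ?f = "\<lambda>a. list_mono (count_choice a)"
  have f: "hpoly m (?f a)" if "a \<in> A" for a
    using hpoly_list_mono[of "count_choice a"] A that by (simp add: length_count_choice)
  have "rc (k - m) * sint (mpoly_dunkl Rp \<kappa> A c p) = rc (k - m) * (\<Sum>a\<in>A. c a * sint (dunkl_list Rp \<kappa> (count_choice a) p))"
  proof -
    have "sint (mpoly_dunkl Rp \<kappa> A c p) = (\<Sum>a\<in>A. sint (\<lambda>x. c a * dunkl_list Rp \<kappa> (count_choice a) p x))"
      unfolding mpoly_dunkl_eq
      by (rule sint_sum) (rule continuous_on_mult[OF continuous_on_const hpoly_continuous_sphere[OF hp.graded_dunkl_list[OF p]]])
    then show ?thesis by (simp add: sint_cmult)
  qed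
  also have "\<dots> = (\<Sum>a\<in>A. c a * fischer M (k + m) p (?f a))"
    unfolding sum_distrib_left
  proof (rule sum.cong)
    fix a assume "a \<in> A"
    then have "length (count_choice a) = m" using A by (simp add: length_count_choice)
    then show "rc (k - m) * (c a * sint (dunkl_list Rp \<kappa> (count_choice a) p)) = c a * fischer M (k + m) p (?f a)"
      using sint_dunkl_list[OF p, of "count_choice a" M] by (simp add: M_def mult_ac)
  qed simp
  also have "\<dots> = fischer M (k + m) p (mpoly_fun A c)"
  proof -
    have "sint (\<lambda>x. p x * (Lap ^^ n) (mpoly_fun A c) x) = (\<Sum>a\<in>A. c a * sint (\<lambda>x. p x * (Lap ^^ n) (?f a) x))" for n
    proof -
      have "(\<lambda>x. p x * (Lap ^^ n) (mpoly_fun A c) x) = (\<lambda>x. \<Sum>a\<in>A. c a * (p x * (Lap ^^ n) (?f a) x))"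
      proof -
        have "(Lap ^^ n) (mpoly_fun A c) = (\<lambda>x. \<Sum>a\<in>A. c a * (Lap ^^ n) (?f a) x)"
          unfolding mpoly_fun_eq by (rule Lap_pow_linear_combination) (rule hpoly_smooth[OF f])
        then show ?thesis by (simp add: sum_distrib_left mult_ac)
      qed
      moreover have "continuous_on (sphere 0 1) (\<lambda>x. c a * (p x * (Lap ^^ n) (?f a) x))" if "a \<in> A" for a
        by (intro continuous_on_mult continuous_on_const hpoly_continuous_sphere[OF p]
            hpoly_continuous_sphere[OF hp.graded_Lap_pow[OF f[OF that]]])
      ultimately show ?thesis by (simp add: sint_sum sint_cmult)
    qed
    then show ?thesis
      unfolding fischer_def by (simp add: sum_distrib_left sum_distrib_right mult_ac sum.swap[of _ A])
  qed
  also have "\<dots> = rc (k + m) * sint (\<lambda>x. p x * mpoly_fun A c x)" by (rule fischer_harmonic[OF harm])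
  finally show ?thesis by simp
qed

text \<open>The Dunkl form of Euler's identity has the extra terms \<kappa> \<alpha> (p(x) - p(refl
  \<alpha> x)), which integrate to zero by invariance of the weighted sphere integral.\<close>

lemma sint_euler:
  assumes p: "hpoly k p"
  shows "(\<Sum>j\<in>UNIV. sint (\<lambda>x. x $ j * D (axis j 1) p x)) = real k * sint p"
proof -
  note ps = hpoly_smooth[OF p]
  note pc = hpoly_continuous_sphere[OF p]
  have rc: "continuous_on (sphere 0 1) (\<lambda>x. p (refl \<alpha> x))" for \<alpha>
    by (rule hpoly_continuous_sphere[OF hp.graded_refl[OF p]])
  have eq: "(\<Sum>j\<in>UNIV. x $ j * D (axis j 1) p x) = real k * p x + (\<Sum>\<alpha>\<in>Rp. \<kappa> \<alpha> * (p x + (- 1) * p (refl \<alpha> x)))" for x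
  proof -
    have "inner \<alpha> x * dquot \<alpha> p x = p x + (- 1) * p (refl \<alpha> x)" if "\<alpha> \<in> Rp" for \<alpha>
      using hp.difference_refl_eq[OF ps UNIV_I hp.Rp_nonzero[OF that]]
        hp.dquot_eq_sdquot[OF ps UNIV_I hp.Rp_nonzero[OF that]] by simp
    then have "D x p x = real k * p x + (\<Sum>\<alpha>\<in>Rp. \<kappa> \<alpha> * (p x + (- 1) * p (refl \<alpha> x)))"
      unfolding hp.D_smooth[OF ps UNIV_I] hpoly_euler[OF p smooth_on_has_derivative[OF ps UNIV_I]]
      by (simp add: mult.assoc)
    then show ?thesis using hp.D_direction[OF ps UNIV_I, of x] by simp
  qed
  have "(\<Sum>j\<in>UNIV. sint (\<lambda>x. x $ j * D (axis j 1) p x)) = sint (\<lambda>x. \<Sum>j\<in>UNIV. x $ j * D (axis j 1) p x)"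
    by (rule sint_sum[symmetric]) (intro continuous_intros hpoly_continuous_sphere[OF hp.graded_D[OF p]])
  also have "\<dots> = sint (\<lambda>x. real k * p x) + sint (\<lambda>x. \<Sum>\<alpha>\<in>Rp. \<kappa> \<alpha> * (p x + (- 1) * p (refl \<alpha> x)))"
    unfolding eq by (intro sint_add continuous_intros pc rc)
  also have "sint (\<lambda>x. \<Sum>\<alpha>\<in>Rp. \<kappa> \<alpha> * (p x + (- 1) * p (refl \<alpha> x)))
      = (\<Sum>\<alpha>\<in>Rp. sint (\<lambda>x. \<kappa> \<alpha> * (p x + (- 1) * p (refl \<alpha> x))))"
    by (rule sint_sum) (intro continuous_intros pc rc)
  also have "\<dots> = 0"
  proof (rule sum.neutral, rule ballI)
    fix \<alpha> assume "\<alpha> \<in> Rp"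
    then have "\<alpha> \<in> R" using Rp_subset by blast
    have "sint (\<lambda>x. p x + (- 1) * p (refl \<alpha> x)) = sint p + (- 1) * sint (\<lambda>x. p (refl \<alpha> x))"
      unfolding sint_cmult[symmetric] by (intro sint_add continuous_intros pc rc)
    then show "sint (\<lambda>x. \<kappa> \<alpha> * (p x + (- 1) * p (refl \<alpha> x))) = 0"
      unfolding sint_cmult sint_refl[OF \<open>\<alpha> \<in> R\<close> pc] by simp
  qed
  finally show ?thesis by (simp add: sint_cmult)
qed

text \<open>\<open>sint_D\<close> applied to each D_j p, of degree k + 1, contributes (k + 1) +
  2\<lambda> + 1; \<open>sint_euler\<close> for p itself contributes k + 2.\<close>

lemma sint_Lap:
  assumes p: "hpoly (k + 2) p"
  shows "sint (Lap p) = (real k + 2) * (real k + 2 * lambda_k Rp \<kappa> + 2) * sint p"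
proof -
  have D: "hpoly (k + 1) (D (axis j 1) p)" for j using hp.graded_D[OF p, of "axis j 1"] by simp
  have "sint (Lap p) = (\<Sum>j\<in>UNIV. sint (D (axis j 1) (D (axis j 1) p)))"
    unfolding hp.Lap_eq by (rule sint_sum) (rule hpoly_continuous_sphere[OF hp.graded_D[OF D]])
  also have "\<dots> = (\<Sum>j\<in>UNIV. (real k + 2 * lambda_k Rp \<kappa> + 2) * sint (\<lambda>x. x $ j * D (axis j 1) p x))"
    using sint_D(1)[OF D] by (simp add: inner_axis' add_ac)
  also have "\<dots> = (real k + 2 * lambda_k Rp \<kappa> + 2) * (real (k + 2) * sint p)"
    unfolding sum_distrib_left[symmetric] sint_euler[OF p] ..
  finally show ?thesis by simp
qed

text \<open>The Laplacian recursion descends to degree one. There D_j p is constant, and coordinates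
  have mean zero by the case k = 0 of \<open>sint_D\<close>.\<close>

lemma sint_odd: "hpoly (2 * n + 1) p \<Longrightarrow> sint p = 0"
proof (induction n arbitrary: p)
  case 0
  then have "hpoly 0 (D (axis j 1) p)" for j using hp.graded_D[of 1 p] by simp
  then have "sint (\<lambda>x. x $ j * D (axis j 1) p x) = 0" for j
    using sint_D(2)[of 0 "D (axis j 1) p" "axis j 1"] by (simp add: inner_axis')
  then show ?case using sint_euler[OF 0] by simp
next
  case (Suc n)
  have p: "hpoly ((2 * n + 1) + 2) p" using Suc.prems by (simp add: add_ac)
  have "hpoly (2 * n + 1) (Lap p)" using hp.graded_Lap[OF p] by simp
  then have "sint (Lap p) = 0" by (rule Suc.IH)
  moreover have "real (2 * n + 1) + 2 * lambda_k Rp \<kappa> + 2 > 0" using lambda_k_gt by simp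
  ultimately show ?case using sint_Lap[OF p] by auto
qed

lemma sint_even:
  "hpoly (2 * n) p \<Longrightarrow> sint p = (Lap ^^ n) p 0 / (4 ^ n * fact n * pochhammer (lambda_k Rp \<kappa> + 1) n) * sint (\<lambda>_. 1)"
proof (induction n arbitrary: p)
  case 0
  then have "is_const p" using hp.graded_0[of 0 p] by simp
  then obtain c where "p = (\<lambda>_. c)" by (auto simp: is_const_def)
  then show ?case using sint_cmult[of c "\<lambda>_. 1"] by simp
next
  case (Suc n)
  let ?l = "lambda_k Rp \<kappa>"
  have p: "hpoly (2 * n + 2) p" using Suc.prems by (simp add: add_ac)
  have "hpoly (2 * n) (Lap p)" using hp.graded_Lap[OF p] by simp
  from Suc.IH[OF this] have 1: "sint (Lap p) = (Lap ^^ Suc n) p 0 / (4 ^ n * fact n * pochhammer (?l + 1) n) * sint (\<lambda>_. 1)"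
    by (simp add: funpow_swap1)
  \<comment> \<open>At degree 2n + 2 the two factors of \<open>sint_Lap\<close> are 2(n + 1) and
    2(\<lambda> + 1 + n); they extend the power of 4, the factorial and the Pochhammer symbol by one
    step each.\<close>
  have 2: "sint (Lap p) = (4 * real (Suc n) * (?l + 1 + real n)) * sint p"
    using sint_Lap[OF p] by (simp add: algebra_simps)
  have "?l + 1 + real n > 0" using lambda_k_gt by simp
  then have "4 * real (Suc n) * (?l + 1 + real n) \<noteq> 0" by simp
  then have "sint p = sint (Lap p) / (4 * real (Suc n) * (?l + 1 + real n))" unfolding 2 by simp
  also have "\<dots> = (Lap ^^ Suc n) p 0 / (4 ^ Suc n * fact (Suc n) * pochhammer (?l + 1) (Suc n)) * sint (\<lambda>_. 1)"
    unfolding 1 by (simp add: pochhammer_Suc mult_ac del: of_nat_Suc funpow.simps)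
  finally show ?case .
qed

lemma pochhammer_lambda_pos: "pochhammer (lambda_k Rp \<kappa> + 1) n > 0"
  using lambda_k_gt by (intro pochhammer_pos) simp

text \<open>The powers of 2 come from three places: rc(k + m) = 2^(m+n) (\<lambda>+1)_(m+n), rc(k -
  m) = 2^n (\<lambda>+1)_n, and the denominator 4^n n! (\<lambda>+1)_n of \<open>sint_even\<close>.
  Together they leave 2^(-m-2n). For other k either q(D) kills p, when k < m, or q(D) p has odd
  degree.\<close>

theorem sint_harmonic_mult_hpoly:
  assumes p: "hpoly k p" and A: "\<forall>a\<in>A. mdeg a = m"
    and harm: "Lap (mpoly_fun A c) = (\<lambda>_. 0)"
  shows "k = m + 2 * n \<Longrightarrow> sint (\<lambda>x. p x * mpoly_fun A c x) =
      mpoly_dunkl Rp \<kappa> A c ((Lap ^^ n) p) 0 / (fact n * pochhammer (lambda_k Rp \<kappa> + 1) (m + n)) * (1 / 2) ^ (m + 2 * n) * sint (\<lambda>_. 1)"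
    and "\<nexists>n. k = m + 2 * n \<Longrightarrow> sint (\<lambda>x. p x * mpoly_fun A c x) = 0"
proof -
  let ?l = "lambda_k Rp \<kappa>"
  note pair = sint_harmonic_pairing[OF p A harm]
  have md: "hpoly (k - m) (mpoly_dunkl Rp \<kappa> A c p)"
    unfolding mpoly_dunkl_eq
  proof (intro hp.graded_sum hp.graded_cmult)
    fix a assume "a \<in> A"
    then show "hpoly (k - m) (dunkl_list Rp \<kappa> (count_choice a) p)"
      using hp.graded_dunkl_list[OF p, of "count_choice a"] A by (simp add: length_count_choice)
  qed
  show "sint (\<lambda>x. p x * mpoly_fun A c x) =
      mpoly_dunkl Rp \<kappa> A c ((Lap ^^ n) p) 0 / (fact n * pochhammer (?l + 1) (m + n)) * (1 / 2) ^ (m + 2 * n) * sint (\<lambda>_. 1)"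
    if k: "k = m + 2 * n"
  proof -
    have comm: "(Lap ^^ n) (mpoly_dunkl Rp \<kappa> A c p) = mpoly_dunkl Rp \<kappa> A c ((Lap ^^ n) p)"
      unfolding mpoly_dunkl_eq
      by (subst Lap_pow_linear_combination) (simp_all add: Lap_pow_dunkl_list_commute[OF p]
          hpoly_smooth[OF hp.graded_dunkl_list[OF p]])
    have e: "sint (mpoly_dunkl Rp \<kappa> A c p) = mpoly_dunkl Rp \<kappa> A c ((Lap ^^ n) p) 0 / (4 ^ n * fact n * pochhammer (?l + 1) n) * sint (\<lambda>_. 1)"
      using sint_even[of n "mpoly_dunkl Rp \<kappa> A c p"] md k comm by simp
    have "k + m = 2 * (m + n)" "k - m = 2 * n" using k by auto
    with pair have "2 ^ (m + n) * pochhammer (?l + 1) (m + n) * sint (\<lambda>x. p x * mpoly_fun A c x)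
        = 2 ^ n * pochhammer (?l + 1) n * sint (mpoly_dunkl Rp \<kappa> A c p)"
      by (simp only: rec_const_even)
    also have "\<dots> = 2 ^ n * (mpoly_dunkl Rp \<kappa> A c ((Lap ^^ n) p) 0 / (4 ^ n * fact n) * sint (\<lambda>_. 1))"
      unfolding e using pochhammer_lambda_pos[of n] by simp
    finally have h: "2 ^ (m + n) * pochhammer (?l + 1) (m + n) * sint (\<lambda>x. p x * mpoly_fun A c x)
      = 2 ^ n * (mpoly_dunkl Rp \<kappa> A c ((Lap ^^ n) p) 0 / (4 ^ n * fact n) * sint (\<lambda>_. 1))" .
    have "(4::real) ^ n = 2 ^ n * 2 ^ n" by (simp add: power_mult_distrib[symmetric])
    with h pochhammer_lambda_pos[of "m + n"] show ?thesis
      by (simp add: field_simps power_add power_mult power2_eq_square power_divide)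
  qed
  show "sint (\<lambda>x. p x * mpoly_fun A c x) = 0" if k: "\<nexists>n. k = m + 2 * n"
  proof -
    have "sint (mpoly_dunkl Rp \<kappa> A c p) = 0"
    proof (cases "k < m")
      case True
      then have "dunkl_list Rp \<kappa> (count_choice a) p = (\<lambda>_. 0)" if "a \<in> A" for a
        using A that by (intro dunkl_list_hpoly_eq_0[OF p]) (simp add: length_count_choice)
      then have "mpoly_dunkl Rp \<kappa> A c p = (\<lambda>_. 0)" by (simp add: mpoly_dunkl_eq)
      then show ?thesis by (simp add: sint_zero)
    next
      case False
      with k have "odd (k - m)" by (metis evenE le_add_diff_inverse not_less)
      then obtain j where "k - m = 2 * j + 1" by (rule oddE)
      then show ?thesis using md sint_odd[of j] by simp
    qed
    then show ?thesis using pair rec_const_pos[OF lambda_k_gt, of "k + m"] by simp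
  qed
qed

end


section \<open>Asymptotic expansion for smooth functions\<close>

lemma smooth_on_subset:
  assumes "smooth_on T f" "S \<subseteq> T"
  shows "smooth_on S f"
proof -
  have "higher_differentiable_on T f n \<Longrightarrow> higher_differentiable_on S f n" for n
    using assms(2) by (induction n arbitrary: f) (auto intro: continuous_on_subset)
  then show ?thesis using assms(1) by (simp add: smooth_on_def)
qed

text \<open>The case of \<open>segment_difference\<close> with the identity as shift: the segment
  runs from x to x - x = 0.\<close>

lemma (in symmetric_domain) hadamard:
  assumes f: "smooth_on S f"
  obtains g where "\<And>j. smooth_on S (g j)" "\<And>x. x \<in> S \<Longrightarrow> f x = f 0 + (\<Sum>j\<in>UNIV. x $ j * g j x)"
proof
  interpret segment_map S "\<lambda>x. x" by (rule segment_id)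
  let ?g = "\<lambda>j. seg_avg (\<lambda>_. 1) (\<lambda>x. x) (\<lambda>y. frechet_derivative f (at y) (axis j 1))"
  show "smooth_on S (?g j)" for j
    by (intro smooth_on_seg_avg smooth_on_frechet_derivative f continuous_on_const)
  fix x assume x: "x \<in> S"
  have c: "continuous_on S (\<lambda>y. frechet_derivative f (at y) v)" for v
    by (intro smooth_on_continuous smooth_on_frechet_derivative f)
  have i: "(\<lambda>t. frechet_derivative f (at (x - t *\<^sub>R x)) v) integrable_on {0..1}" for v
    using seg_avg_integrable[OF c continuous_on_const[of _ 1] x] by simp
  have "f x - f (x - x) = integral {0..1} (\<lambda>t. frechet_derivative f (at (x - t *\<^sub>R x)) x)"
    by (rule segment_difference[OF f x])
  also have "\<dots> = integral {0..1} (\<lambda>t. \<Sum>j\<in>UNIV. x $ j * frechet_derivative f (at (x - t *\<^sub>R x)) (axis j 1))"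
    by (rule integral_cong) (rule smooth_on_imp_frechet_sum[OF f segment_in[OF x]])
  also have "\<dots> = (\<Sum>j\<in>UNIV. integral {0..1} (\<lambda>t. x $ j * frechet_derivative f (at (x - t *\<^sub>R x)) (axis j 1)))"
    by (rule integral_sum) (use integrable_cmul[OF i] in simp_all)
  also have "\<dots> = (\<Sum>j\<in>UNIV. x $ j * ?g j x)" by (simp add: seg_avg_def)
  finally show "f x = f 0 + (\<Sum>j\<in>UNIV. x $ j * ?g j x)" by simp
qed

section \<open>Locality and linearity of iterated Dunkl operators\<close>

context dunkl_domain
begin

text \<open>Dunkl operators are not local, but mirror images of points of \<open>S\<close> stay in
  \<open>S\<close>, so the values on \<open>S\<close> suffice. This allows a function to be replaced
  by a Taylor decomposition that is valid only on a ball.\<close>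

lemma Lap_pow_cong:
  assumes f: "smooth_on S f" and fg: "\<And>y. y \<in> S \<Longrightarrow> f y = g y" and x: "x \<in> S"
  shows "(Lap ^^ n) f x = (Lap ^^ n) g x"
  using x
proof (induction n arbitrary: x)
  case (Suc n)
  show ?case using Lap_cong[OF smooth_on_Lap_pow[OF f] Suc.IH Suc.prems] by simp
qed (simp add: fg)

lemma Lap_pow_add:
  assumes f: "smooth_on S f" and g: "smooth_on S g" and x: "x \<in> S"
  shows "(Lap ^^ n) (\<lambda>x. f x + g x) x = (Lap ^^ n) f x + (Lap ^^ n) g x"
  using x
proof (induction n arbitrary: x)
  case (Suc n)
  have "(Lap ^^ Suc n) (\<lambda>x. f x + g x) x = Lap (\<lambda>x. (Lap ^^ n) f x + (Lap ^^ n) g x) x"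
    using Lap_cong[OF smooth_on_Lap_pow[OF smooth_on_add[OF open_S f g]] Suc.IH Suc.prems] by simp
  also have "\<dots> = (Lap ^^ Suc n) f x + (Lap ^^ Suc n) g x"
    using Lap_add[OF smooth_on_Lap_pow[OF f] smooth_on_Lap_pow[OF g] Suc.prems] by simp
  finally show ?case .
qed simp

lemma dunkl_list_cong:
  assumes f: "smooth_on S f" and fg: "\<And>y. y \<in> S \<Longrightarrow> f y = g y" and x: "x \<in> S"
  shows "dunkl_list Rp \<kappa> ks f x = dunkl_list Rp \<kappa> ks g x"
  using x
proof (induction ks arbitrary: x)
  case (Cons k ks)
  show ?case using D_cong[OF smooth_on_dunkl_list[OF f] Cons.IH Cons.prems] by simp
qed (simp add: fg)

lemma dunkl_list_add:
  assumes f: "smooth_on S f" and g: "smooth_on S g" and x: "x \<in> S"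
  shows "dunkl_list Rp \<kappa> ks (\<lambda>x. f x + g x) x = dunkl_list Rp \<kappa> ks f x + dunkl_list Rp \<kappa> ks g x"
  using x
proof (induction ks arbitrary: x)
  case (Cons k ks)
  have "dunkl_list Rp \<kappa> (k # ks) (\<lambda>x. f x + g x) x
      = D (axis k 1) (\<lambda>x. dunkl_list Rp \<kappa> ks f x + dunkl_list Rp \<kappa> ks g x) x"
    using D_cong[OF smooth_on_dunkl_list[OF smooth_on_add[OF open_S f g]] Cons.IH Cons.prems] by simp
  also have "\<dots> = dunkl_list Rp \<kappa> (k # ks) f x + dunkl_list Rp \<kappa> (k # ks) g x"
    using D_add[OF smooth_on_dunkl_list[OF f] smooth_on_dunkl_list[OF g] Cons.prems] by simp
  finally show ?case .
qed simp

lemma mpoly_dunkl_Lap_cong: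
  assumes f: "smooth_on S f" and fg: "\<And>y. y \<in> S \<Longrightarrow> f y = g y"
  shows "mpoly_dunkl Rp \<kappa> A c ((Lap ^^ n) f) 0 = mpoly_dunkl Rp \<kappa> A c ((Lap ^^ n) g) 0"
  unfolding mpoly_dunkl_eq
  using dunkl_list_cong[OF smooth_on_Lap_pow[OF f] Lap_pow_cong[OF f fg] zero_S] by simp

lemma mpoly_dunkl_Lap_add:
  assumes f: "smooth_on S f" and g: "smooth_on S g"
  shows "mpoly_dunkl Rp \<kappa> A c ((Lap ^^ n) (\<lambda>x. f x + g x)) 0 =
    mpoly_dunkl Rp \<kappa> A c ((Lap ^^ n) f) 0 + mpoly_dunkl Rp \<kappa> A c ((Lap ^^ n) g) 0"
proof -
  note L = smooth_on_Lap_pow[OF f] smooth_on_Lap_pow[OF g]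
  have "dunkl_list Rp \<kappa> ks ((Lap ^^ n) (\<lambda>x. f x + g x)) 0
      = dunkl_list Rp \<kappa> ks ((Lap ^^ n) f) 0 + dunkl_list Rp \<kappa> ks ((Lap ^^ n) g) 0" for ks
    using dunkl_list_cong[OF smooth_on_Lap_pow[OF smooth_on_add[OF open_S f g]] Lap_pow_add[OF f g] zero_S]
      dunkl_list_add[OF L zero_S] by simp
  then show ?thesis by (simp add: mpoly_dunkl_eq distrib_left sum.distrib)
qed

lemma mpoly_dunkl_Lap_sum:
  assumes "\<And>k. smooth_on S (p k)"
  shows "mpoly_dunkl Rp \<kappa> A c ((Lap ^^ n) (\<lambda>x. \<Sum>k<M. p k x)) 0 =
    (\<Sum>k<(M::nat). mpoly_dunkl Rp \<kappa> A c ((Lap ^^ n) (p k)) 0)"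
proof (induction M)
  case 0
  have "mpoly_dunkl Rp \<kappa> A c ((Lap ^^ n) (\<lambda>x. 0 + 0)) 0 = mpoly_dunkl Rp \<kappa> A c ((Lap ^^ n) (\<lambda>x. 0)) 0
      + mpoly_dunkl Rp \<kappa> A c ((Lap ^^ n) (\<lambda>x. 0)) 0"
    by (rule mpoly_dunkl_Lap_add) (simp_all add: open_S)
  then show ?case by simp
next
  case (Suc M)
  have "smooth_on S (\<lambda>x. \<Sum>k<M. p k x)" by (rule smooth_on_sum[OF open_S assms])
  then show ?case using Suc mpoly_dunkl_Lap_add[of "\<lambda>x. \<Sum>k<M. p k x" "p M" A c n] assms by simp
qed

end

context graded_setting
begin

lemma mpoly_dunkl_Lap_graded_eq_0:
  assumes f: "graded S B k f" and A: "\<forall>a\<in>A. mdeg a = m" and k: "k > m + 2 * n"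
  shows "mpoly_dunkl Rp \<kappa> A c ((Lap ^^ n) f) 0 = 0"
proof -
  have "dunkl_list Rp \<kappa> (count_choice a) ((Lap ^^ n) f) 0 = 0" if "a \<in> A" for a
    using k A that by (intro graded_at_0[OF graded_dunkl_list[OF graded_Lap_pow[OF f]]])
      (simp add: length_count_choice)
  then show ?thesis by (simp add: mpoly_dunkl_eq)
qed

end

section \<open>Taylor splitting and the expansion for smooth functions\<close>

context dunkl_setting
begin

text \<open>The operator lowers degrees by m + 2n in all: higher degrees leave a polynomial
  vanishing at the origin, lower ones are annihilated. So the n-th coefficient sees exactly one
  Taylor component.\<close>

lemma mpoly_dunkl_Lap_hpoly_eq_0:
  assumes p: "hpoly k p" and A: "\<forall>a\<in>A. mdeg a = m" and k: "k \<noteq> m + 2 * n"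
  shows "mpoly_dunkl Rp \<kappa> A c ((Lap ^^ n) p) 0 = 0"
proof (cases "k > m + 2 * n")
  case True
  then show ?thesis by (rule hp.mpoly_dunkl_Lap_graded_eq_0[OF p A])
next
  case False
  have "dunkl_list Rp \<kappa> (count_choice a) ((Lap ^^ n) p) = (\<lambda>_. 0)" if "a \<in> A" for a
  proof (cases "k < 2 * n")
    case True
    have "dunkl_list Rp \<kappa> ks (\<lambda>_. 0) = (\<lambda>_. 0)" for ks by (induction ks) (simp_all add: D_zero)
    then show ?thesis using Lap_pow_hpoly_eq_0[OF p True] by simp
  next
    case False': False
    show ?thesis
      using False False' k A that by (intro dunkl_list_hpoly_eq_0[OF hp.graded_Lap_pow[OF p]])
        (auto simp: length_count_choice)
  qed
  then show ?thesis by (simp add: mpoly_dunkl_eq)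
qed

text \<open>A mere size bound on the remainder would say nothing about its derivatives; membership
  in \<open>graded\<close> does, and it also implies the size bound. The induction applies
  Hadamard's lemma once and expands the resulting factors g_j.\<close>

lemma taylor_graded:
  fixes f :: "real^'n \<Rightarrow> real"
  assumes "\<epsilon> > 0" "smooth_on (ball 0 \<epsilon>) f"
  shows "\<exists>p r. (\<forall>k. hpoly k (p k)) \<and> graded (ball 0 \<epsilon>) (smooth_on (ball 0 \<epsilon>)) M r \<and>
    (\<forall>x\<in>ball 0 \<epsilon>. f x = (\<Sum>k<M. p k x) + r x)"
  using assms(2)
proof (induction M arbitrary: f)
  case 0
  have "graded (ball 0 \<epsilon>) (smooth_on (ball 0 \<epsilon>)) 0 f" by (rule graded.base) (rule 0)
  then show ?case by (intro exI[of _ "\<lambda>_ _. 0"] exI[of _ f]) (simp add: hp.graded_zero)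
next
  case (Suc M)
  interpret gs: graded_setting R Rp \<kappa> "ball 0 \<epsilon>" "smooth_on (ball 0 \<epsilon>)"
    by (rule graded_setting_ball[OF assms(1)])
  obtain g where g: "\<And>j. smooth_on (ball 0 \<epsilon>) (g j)"
    "\<And>x. x \<in> ball 0 \<epsilon> \<Longrightarrow> f x = f 0 + (\<Sum>j\<in>UNIV. x $ j * g j x)"
    using gs.hadamard[OF Suc.prems] by blast
  have "\<forall>j. \<exists>p r. (\<forall>k. hpoly k (p k)) \<and> graded (ball 0 \<epsilon>) (smooth_on (ball 0 \<epsilon>)) M r \<and>
    (\<forall>x\<in>ball 0 \<epsilon>. g j x = (\<Sum>k<M. p k x) + r x)"
    using Suc.IH[OF g(1)] by blast
  then obtain p r where pr: "\<And>j k. hpoly k (p j k)"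
    "\<And>j. graded (ball 0 \<epsilon>) (smooth_on (ball 0 \<epsilon>)) M (r j)"
    "\<And>j x. x \<in> ball 0 \<epsilon> \<Longrightarrow> g j x = (\<Sum>k<M. p j k x) + r j x"
    by metis
  define p' where "p' = (\<lambda>k x. case k of 0 \<Rightarrow> f 0 | Suc k \<Rightarrow> \<Sum>j\<in>UNIV. x $ j * p j k x)"
  define r' where "r' = (\<lambda>x. \<Sum>j\<in>UNIV. x $ j * r j x)"
  have "hpoly k (p' k)" for k
  proof (cases k)
    case 0
    then show ?thesis by (simp add: p'_def hpoly_const)
  next
    case (Suc k')
    have "hpoly (Suc k') (\<lambda>x. \<Sum>j\<in>UNIV. x $ j * p j k' x)" by (intro hp.graded_sum graded.coord pr(1))
    with Suc show ?thesis by (simp add: p'_def)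
  qed
  moreover have "graded (ball 0 \<epsilon>) (smooth_on (ball 0 \<epsilon>)) (Suc M) r'"
    unfolding r'_def by (intro gs.graded_sum graded.coord pr(2))
  moreover have "f x = (\<Sum>k<Suc M. p' k x) + r' x" if x: "x \<in> ball 0 \<epsilon>" for x
  proof -
    have "(\<Sum>j\<in>UNIV. x $ j * g j x) = (\<Sum>j\<in>UNIV. \<Sum>k<M. x $ j * p j k x) + r' x"
      by (simp add: pr(3)[OF x] distrib_left sum.distrib r'_def sum_distrib_left)
    also have "(\<Sum>j\<in>UNIV. \<Sum>k<M. x $ j * p j k x) = (\<Sum>k<M. p' (Suc k) x)"
      unfolding p'_def by (subst sum.swap) simp
    finally show ?thesis using g(2)[OF x] by (simp add: sum.lessThan_Suc_shift p'_def del: sum.lessThan_Suc)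
  qed
  ultimately show ?case by blast
qed

text \<open>An explicit bound with \<open>K\<close> and \<delta> takes the place of the little-o,
  since the analytic case combines it with a remainder estimate for a power series.\<close>

theorem harmonic_mean_expansion:
  fixes f :: "real^'n \<Rightarrow> real"
  assumes \<epsilon>: "\<epsilon> > 0" and f: "smooth_on (ball 0 \<epsilon>) f" and A: "\<forall>a\<in>A. mdeg a = m"
    and harm: "Lap (mpoly_fun A c) = (\<lambda>_. 0)"
  shows "\<exists>K \<delta>. \<delta> > 0 \<and> K \<ge> 0 \<and> (\<forall>r. 0 < r \<and> r < \<delta> \<longrightarrow>
    \<bar>sint (\<lambda>y. mpoly_fun A c y * f (r *\<^sub>R y)) / sint (\<lambda>_. 1)
      - (\<Sum>n\<le>N. mpoly_dunkl Rp \<kappa> A c ((Lap ^^ n) f) 0 /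
          (fact n * pochhammer (lambda_k Rp \<kappa> + 1) (m + n)) * (r / 2) ^ (m + 2 * n))\<bar> \<le> K * r ^ (m + 2 * N + 1))"
proof -
  let ?S = "ball 0 \<epsilon> :: (real^'n) set"
  let ?l = "lambda_k Rp \<kappa>"
  \<comment> \<open>One more than the last degree of the expansion: every m + 2n with n \<le> N is
    kept in the polynomial part, and the remainder is one power of r smaller than the last
    term.\<close>
  define M where "M = m + 2 * N + 1"
  define q where "q = (mpoly_fun A c :: real^'n \<Rightarrow> real)"
  interpret gs: graded_setting R Rp \<kappa> ?S "smooth_on ?S"
    by (rule graded_setting_ball[OF \<epsilon>])
  obtain p h where p: "\<And>k. hpoly k (p k)" and h: "graded ?S (smooth_on ?S) M h"
    and fp: "\<And>x. x \<in> ?S \<Longrightarrow> f x = (\<Sum>k<M. p k x) + h x"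
    using taylor_graded[OF \<epsilon> f, of M] by metis
  have ps: "smooth_on ?S (p k)" for k by (rule smooth_on_subset[OF hpoly_smooth[OF p]]) simp
  have hs: "smooth_on ?S h" by (rule gs.graded_smooth[OF h])
  have op: "mpoly_dunkl Rp \<kappa> A c ((Lap ^^ n) f) 0 = mpoly_dunkl Rp \<kappa> A c ((Lap ^^ n) (p (m + 2 * n))) 0"
    if n: "n \<le> N" for n
  proof -
    have "mpoly_dunkl Rp \<kappa> A c ((Lap ^^ n) f) 0 = mpoly_dunkl Rp \<kappa> A c ((Lap ^^ n) (\<lambda>x. (\<Sum>k<M. p k x) + h x)) 0"
      by (rule gs.mpoly_dunkl_Lap_cong[OF f fp])
    also have "\<dots> = (\<Sum>k<M. mpoly_dunkl Rp \<kappa> A c ((Lap ^^ n) (p k)) 0) + mpoly_dunkl Rp \<kappa> A c ((Lap ^^ n) h) 0"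
    proof -
      have "smooth_on ?S (\<lambda>x. \<Sum>k<M. p k x)" by (rule smooth_on_sum[OF open_ball ps])
      then show ?thesis
        using gs.mpoly_dunkl_Lap_add[of "\<lambda>x. \<Sum>k<M. p k x" h A c n] hs gs.mpoly_dunkl_Lap_sum[of p A c n M] ps by simp
    qed
    also have "mpoly_dunkl Rp \<kappa> A c ((Lap ^^ n) h) 0 = 0"
      using n by (intro gs.mpoly_dunkl_Lap_graded_eq_0[OF h A]) (simp add: M_def)
    also have "(\<Sum>k<M. mpoly_dunkl Rp \<kappa> A c ((Lap ^^ n) (p k)) 0)
        = (\<Sum>k<M. if k = m + 2 * n then mpoly_dunkl Rp \<kappa> A c ((Lap ^^ n) (p k)) 0 else 0)"
      by (intro sum.cong HOL.refl) (simp add: mpoly_dunkl_Lap_hpoly_eq_0[OF p A])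
    also have "\<dots> = mpoly_dunkl Rp \<kappa> A c ((Lap ^^ n) (p (m + 2 * n))) 0"
      using n by (simp add: M_def)
    finally show ?thesis by simp
  qed
  have qc: "continuous_on (sphere 0 1) q"
    unfolding q_def by (rule hpoly_continuous_sphere[OF hpoly_mpoly_fun[OF A]])
  have "bounded ((\<lambda>y. q y * wt y) ` sphere 0 1)"
    by (intro compact_imp_bounded compact_continuous_image continuous_on_mult qc continuous_on_wt compact_sphere)
  then obtain Q where "\<forall>z\<in>(\<lambda>y. q y * wt y) ` sphere 0 1. norm z \<le> Q" unfolding bounded_iff by blast
  then have Q: "\<bar>q y * wt y\<bar> \<le> Q" if "norm y = 1" for y using that by simp
  have Q0: "Q \<ge> 0" using Q[of "axis undefined 1"] by simp
  have "cball 0 (\<epsilon> / 2) \<subseteq> ?S" using \<epsilon> by auto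
  then obtain C where "\<forall>x\<in>cball 0 (\<epsilon> / 2). \<bar>h x\<bar> \<le> C * norm x ^ M" using gs.graded_bound[OF h] by blast
  then have C: "\<bar>h x\<bar> \<le> \<bar>C\<bar> * norm x ^ M" if "norm x \<le> \<epsilon> / 2" for x
    using that abs_ge_self[of C] mult_right_mono[of C "\<bar>C\<bar>" "norm x ^ M"] by force
  define V where "V = real CARD('n) * measure lborel (ball 0 1 :: (real^'n) set)"
  have V0: "V \<ge> 0" by (simp add: V_def)
  have main: "sint (\<lambda>y. q y * f (r *\<^sub>R y)) / sint (\<lambda>_. 1)
      - (\<Sum>n\<le>N. mpoly_dunkl Rp \<kappa> A c ((Lap ^^ n) f) 0 / (fact n * pochhammer (?l + 1) (m + n)) * (r / 2) ^ (m + 2 * n))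
     = sint (\<lambda>y. q y * h (r *\<^sub>R y)) / sint (\<lambda>_. 1)
   \<and> \<bar>sint (\<lambda>y. q y * h (r *\<^sub>R y))\<bar> \<le> Q * (\<bar>C\<bar> * r ^ M) * V" if r: "0 < r" "r < \<epsilon> / 2" for r
  proof
    have rS: "r *\<^sub>R y \<in> ?S" if "norm y = 1" for y using that r by simp
    have hc: "continuous_on (sphere 0 1) (\<lambda>y. q y * h (r *\<^sub>R y))"
      by (intro continuous_on_mult qc continuous_on_compose2[OF smooth_on_continuous[OF hs]] continuous_intros)
        (use rS in auto)
    have pc: "continuous_on (sphere 0 1) (\<lambda>y. r ^ k * (p k y * q y))" for k
      by (intro continuous_on_mult continuous_on_const qc hpoly_continuous_sphere[OF p])
    have "sint (\<lambda>y. q y * f (r *\<^sub>R y)) = sint (\<lambda>y. (\<Sum>k<M. r ^ k * (p k y * q y)) + q y * h (r *\<^sub>R y))"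
      unfolding sint_def
    proof (rule sphere_integral_cong)
      fix y :: "real^'n" assume "norm y = 1"
      then show "q y * f (r *\<^sub>R y) * wt y = ((\<Sum>k<M. r ^ k * (p k y * q y)) + q y * h (r *\<^sub>R y)) * wt y"
        using fp[OF rS] by (simp add: hpoly_homogeneous[OF p] distrib_left sum_distrib_left mult_ac)
    qed
    also have "\<dots> = sint (\<lambda>y. \<Sum>k<M. r ^ k * (p k y * q y)) + sint (\<lambda>y. q y * h (r *\<^sub>R y))"
      by (rule sint_add[OF _ hc]) (intro continuous_on_sum pc)
    also have "sint (\<lambda>y. \<Sum>k<M. r ^ k * (p k y * q y)) = (\<Sum>k<M. sint (\<lambda>y. r ^ k * (p k y * q y)))"
      by (rule sint_sum[OF pc])
    also have "\<dots> = (\<Sum>k<M. r ^ k * sint (\<lambda>y. p k y * q y))" by (simp only: sint_cmult)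
    \<comment> \<open>Components of degree not of the form m + 2n have zero integral against
      \<open>q\<close>; those of this form below \<open>M\<close> are the ones with n \<le>
      N.\<close>
    also have "\<dots> = (\<Sum>k\<in>(\<lambda>n. m + 2 * n) ` {..N}. r ^ k * sint (\<lambda>y. p k y * q y))"
    proof (rule sum.mono_neutral_right)
      show "\<forall>k\<in>{..<M} - (\<lambda>n. m + 2 * n) ` {..N}. r ^ k * sint (\<lambda>y. p k y * q y) = 0"
      proof
        fix k assume k: "k \<in> {..<M} - (\<lambda>n. m + 2 * n) ` {..N}"
        then have "\<nexists>n. k = m + 2 * n" by (auto simp: M_def)
        then show "r ^ k * sint (\<lambda>y. p k y * q y) = 0"
          using sint_harmonic_mult_hpoly(2)[OF p A harm] by (simp add: q_def)
      qed
    qed (auto simp: M_def)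
    also have "\<dots> = (\<Sum>n\<le>N. r ^ (m + 2 * n) * sint (\<lambda>y. p (m + 2 * n) y * q y))"
      by (subst sum.reindex) (auto simp: inj_on_def)
    also have "\<dots> = (\<Sum>n\<le>N. mpoly_dunkl Rp \<kappa> A c ((Lap ^^ n) f) 0 / (fact n * pochhammer (?l + 1) (m + n)) * (r / 2) ^ (m + 2 * n)) * sint (\<lambda>_. 1)"
      unfolding sum_distrib_right
    proof (rule sum.cong)
      fix n assume n: "n \<in> {..N}"
      show "r ^ (m + 2 * n) * sint (\<lambda>y. p (m + 2 * n) y * q y) =
         mpoly_dunkl Rp \<kappa> A c ((Lap ^^ n) f) 0 / (fact n * pochhammer (?l + 1) (m + n)) * (r / 2) ^ (m + 2 * n) * sint (\<lambda>_. 1)"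
        unfolding q_def sint_harmonic_mult_hpoly(1)[OF p A harm HOL.refl] using n
        by (simp add: op power_divide)
    qed simp
    finally show "sint (\<lambda>y. q y * f (r *\<^sub>R y)) / sint (\<lambda>_. 1)
      - (\<Sum>n\<le>N. mpoly_dunkl Rp \<kappa> A c ((Lap ^^ n) f) 0 / (fact n * pochhammer (?l + 1) (m + n)) * (r / 2) ^ (m + 2 * n))
     = sint (\<lambda>y. q y * h (r *\<^sub>R y)) / sint (\<lambda>_. 1)"
      using sint_1_pos by (simp add: add_divide_distrib)
    show "\<bar>sint (\<lambda>y. q y * h (r *\<^sub>R y))\<bar> \<le> Q * (\<bar>C\<bar> * r ^ M) * V"
      unfolding sint_def V_def
    proof (rule sphere_integral_bound[OF _ sphere_integrable_wt[OF hc]])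
      fix y :: "real^'n" assume y: "norm y = 1"
      have "\<bar>h (r *\<^sub>R y)\<bar> \<le> \<bar>C\<bar> * r ^ M" using C[of "r *\<^sub>R y"] y r by simp
      then have "\<bar>q y * wt y\<bar> * \<bar>h (r *\<^sub>R y)\<bar> \<le> Q * (\<bar>C\<bar> * r ^ M)"
        using Q[OF y] Q0 by (intro mult_mono) auto
      then show "\<bar>q y * h (r *\<^sub>R y) * wt y\<bar> \<le> Q * (\<bar>C\<bar> * r ^ M)" by (simp add: abs_mult mult_ac)
    qed
  qed
  show ?thesis
  proof (rule exI[of _ "Q * \<bar>C\<bar> * V / sint (\<lambda>_. 1)"], rule exI[of _ "\<epsilon> / 2"], intro conjI allI impI)
    show "\<epsilon> / 2 > 0" using \<epsilon> by simp
    show "Q * \<bar>C\<bar> * V / sint (\<lambda>_. 1) \<ge> 0" using Q0 V0 sint_1_pos by simp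
    fix r :: real assume r: "0 < r \<and> r < \<epsilon> / 2"
    have "\<bar>sint (\<lambda>y. q y * h (r *\<^sub>R y)) / sint (\<lambda>_. 1)\<bar> \<le> Q * (\<bar>C\<bar> * r ^ M) * V / sint (\<lambda>_. 1)"
      using main[of r] r sint_1_pos by (simp add: divide_right_mono)
    then show "\<bar>sint (\<lambda>y. mpoly_fun A c y * f (r *\<^sub>R y)) / sint (\<lambda>_. 1)
      - (\<Sum>n\<le>N. mpoly_dunkl Rp \<kappa> A c ((Lap ^^ n) f) 0 / (fact n * pochhammer (?l + 1) (m + n)) * (r / 2) ^ (m + 2 * n))\<bar>
       \<le> Q * \<bar>C\<bar> * V / sint (\<lambda>_. 1) * r ^ (m + 2 * N + 1)"
      using main[of r] r by (simp add: q_def M_def mult_ac)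
  qed
qed

lemma sphere_integral_eq_sint:
  "sphere_integral (\<lambda>y. g y * (hk Rp \<kappa> y)\<^sup>2) = sint g" "sphere_integral (\<lambda>y. (hk Rp \<kappa> y)\<^sup>2) = sint (\<lambda>_. 1)"
  by (simp_all add: sint_def)

end


section \<open>Power series\<close>

text \<open>Homogeneous polynomials together with a bound on the sum of the moduli of their coefficients.\<close>

inductive hpoly_bd :: "nat \<Rightarrow> real \<Rightarrow> (real^'n \<Rightarrow> real) \<Rightarrow> bool" where
  const: "\<bar>c\<bar> \<le> b \<Longrightarrow> hpoly_bd 0 b (\<lambda>_. c)"
| coord: "hpoly_bd k b f \<Longrightarrow> hpoly_bd (Suc k) b (\<lambda>x. x $ j * f x)"
| add: "hpoly_bd k b f \<Longrightarrow> hpoly_bd k b' g \<Longrightarrow> hpoly_bd k (b + b') (\<lambda>x. f x + g x)"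

lemma hpoly_bd_imp_hpoly: "hpoly_bd k b f \<Longrightarrow> hpoly k f"
  by (induction rule: hpoly_bd.induct) (auto intro: hpoly_const graded.coord graded.add)

lemma hpoly_bd_nonneg: "hpoly_bd k b f \<Longrightarrow> b \<ge> 0"
  by (induction rule: hpoly_bd.induct) auto

lemma hpoly_bd_bound: "hpoly_bd k b f \<Longrightarrow> \<bar>f x\<bar> \<le> b * norm x ^ k"
proof (induction rule: hpoly_bd.induct)
  case (coord k b f j)
  then show ?case
    using mult_mono[OF component_le_norm_cart[of x j] coord.IH] by (simp add: abs_mult mult_ac)
qed (auto simp: distrib_right)

lemma hpoly_bd_zero: "hpoly_bd k 0 (\<lambda>_. 0)"
proof (induction k)
  case 0
  show ?case by (rule hpoly_bd.const) simp
next
  case (Suc k)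
  from hpoly_bd.coord[OF Suc] show ?case by simp
qed

lemma hpoly_bd_cmult: "hpoly_bd k b f \<Longrightarrow> hpoly_bd k (\<bar>c\<bar> * b) (\<lambda>x. c * f x)"
proof (induction rule: hpoly_bd.induct)
  case (const c' b)
  then show ?case by (intro hpoly_bd.const) (simp add: abs_mult mult_left_mono)
next
  case (coord k b f j)
  from hpoly_bd.coord[OF coord.IH, of j] show ?case by (simp add: mult_ac)
next
  case (add k b f b' g)
  from hpoly_bd.add[OF add.IH] show ?case by (simp add: distrib_left)
qed

lemma hpoly_bd_sum:
  "(\<And>i. i \<in> I \<Longrightarrow> hpoly_bd k (b i) (f i)) \<Longrightarrow> hpoly_bd k (\<Sum>i\<in>I. b i) (\<lambda>x. \<Sum>i\<in>I. f i x)"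
proof (induction I rule: infinite_finite_induct)
  case (insert i I)
  then have "hpoly_bd k (b i + (\<Sum>i\<in>I. b i)) (\<lambda>x. f i x + (\<Sum>i\<in>I. f i x))"
    by (intro hpoly_bd.add) simp_all
  with insert.hyps show ?case by simp
qed (simp_all add: hpoly_bd_zero)

lemma hpoly_bd_list_mono: "hpoly_bd (length ks) 1 (list_mono ks)"
proof (induction ks)
  case Nil
  have "list_mono [] = (\<lambda>x :: real^'a. 1)" by auto
  then show ?case by (simp add: hpoly_bd.const)
next
  case (Cons k ks)
  have "list_mono (k # ks) = (\<lambda>x. x $ k * list_mono ks x)" by auto
  with hpoly_bd.coord[OF Cons, of k] show ?case by simp
qed

lemma hpoly_bd_mono: "hpoly_bd k b f \<Longrightarrow> b \<le> b' \<Longrightarrow> hpoly_bd k b' f"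
proof (induction arbitrary: b' rule: hpoly_bd.induct)
  case (const c b)
  then show ?case by (intro hpoly_bd.const) simp
next
  case (coord k b f j)
  show ?case by (rule hpoly_bd.coord[OF coord.IH[OF coord.prems]])
next
  case (add k b f b2 g)
  have "hpoly_bd k (b + (b' - b)) (\<lambda>x. f x + g x)"
    by (rule hpoly_bd.add[OF add.hyps(1) add.IH(2)]) (use add.prems in simp)
  then show ?case by simp
qed

text \<open>Each of the k coordinate factors contributes at most b |v| to the coefficient sum of the
  derivative. The derivative in a fixed direction stays in the class \<open>hpoly_bd\<close>, so
  termwise differentiation can be iterated.\<close>

lemma hpoly_bd_has_derivative:
  assumes "hpoly_bd k b f"
  shows "\<exists>d. (\<forall>x. (f has_derivative d x) (at x)) \<and> (k = 0 \<longrightarrow> (\<forall>x v. d x v = 0)) \<and>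
    (\<forall>k' v. k = Suc k' \<longrightarrow> hpoly_bd k' (real k * b * norm v) (\<lambda>x. d x v))"
  using assms
proof (induction rule: hpoly_bd.induct)
  case (const c b)
  show ?case by (rule exI[of _ "\<lambda>_ _. 0"]) simp
next
  case (coord k b f j)
  from coord.IH obtain d where d: "\<And>x. (f has_derivative d x) (at x)" "\<And>x v. k = 0 \<Longrightarrow> d x v = 0"
    "\<And>k' v. k = Suc k' \<Longrightarrow> hpoly_bd k' (real k * b * norm v) (\<lambda>x. d x v)" by blast
  let ?d = "\<lambda>x v. x $ j * d x v + v $ j * f x"
  have b: "b \<ge> 0" by (rule hpoly_bd_nonneg[OF coord.hyps])
  have "((\<lambda>x. x $ j * f x) has_derivative ?d x) (at x)" for x
    by (rule has_derivative_mult[OF bounded_linear_imp_has_derivative[OF bounded_linear_vec_nth] d(1)])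
  moreover have "hpoly_bd k (real (Suc k) * b * norm v) (\<lambda>x. ?d x v)" for v
  proof -
    have "hpoly_bd k (\<bar>v $ j\<bar> * b) (\<lambda>x. v $ j * f x)" by (rule hpoly_bd_cmult[OF coord.hyps])
    then have 1: "hpoly_bd k (b * norm v) (\<lambda>x. v $ j * f x)"
      by (rule hpoly_bd_mono) (use mult_right_mono[OF component_le_norm_cart[of v j] b] in \<open>simp add: mult.commute\<close>)
    show ?thesis
    proof (cases k)
      case 0
      then show ?thesis using 1 d(2) by simp
    next
      case (Suc k')
      have "hpoly_bd k (real k * b * norm v) (\<lambda>x. x $ j * d x v)"
        using hpoly_bd.coord[OF d(3)[OF Suc, of v], of j] Suc by simp
      from hpoly_bd.add[OF this 1] show ?thesis by (simp add: algebra_simps)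
    qed
  qed
  ultimately show ?case by (intro exI[of _ ?d]) auto
next
  case (add k b f b' g)
  from add.IH(1) obtain d where d: "\<And>x. (f has_derivative d x) (at x)" "\<And>x v. k = 0 \<Longrightarrow> d x v = 0"
    "\<And>k' v. k = Suc k' \<Longrightarrow> hpoly_bd k' (real k * b * norm v) (\<lambda>x. d x v)" by blast
  from add.IH(2) obtain e where e: "\<And>x. (g has_derivative e x) (at x)" "\<And>x v. k = 0 \<Longrightarrow> e x v = 0"
    "\<And>k' v. k = Suc k' \<Longrightarrow> hpoly_bd k' (real k * b' * norm v) (\<lambda>x. e x v)" by blast
  have "((\<lambda>x. f x + g x) has_derivative (\<lambda>v. d x v + e x v)) (at x)" for x
    by (rule has_derivative_add[OF d(1) e(1)])
  moreover have "hpoly_bd k' (real k * (b + b') * norm v) (\<lambda>x. d x v + e x v)" if "k = Suc k'" for k' v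
    using hpoly_bd.add[OF d(3)[OF that, of v] e(3)[OF that, of v]] by (simp add: algebra_simps)
  ultimately show ?case using d(2) e(2) by (intro exI[of _ "\<lambda>x v. d x v + e x v"]) auto
qed

section \<open>Termwise differentiation of power series\<close>

lemma summable_termwise_derivative:
  fixes b :: "nat \<Rightarrow> real"
  assumes sm: "\<And>t. 0 \<le> t \<Longrightarrow> t < \<rho> \<Longrightarrow> summable (\<lambda>k. b k * t ^ k)"
    and b: "\<And>k. b k \<ge> 0" and t: "0 \<le> t" "t < \<rho>"
  shows "summable (\<lambda>k. real (Suc k) * b (Suc k) * t ^ k)"
proof -
  have "summable (\<lambda>n. diffs b n * t ^ n)"
  proof (rule termdiff_converges[of t \<rho>])
    show "norm t < \<rho>" using t by simp
    show "summable (\<lambda>n. b n * z ^ n)" if "norm z < \<rho>" for z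
    proof (rule summable_rabs_cancel)
      show "summable (\<lambda>n. \<bar>b n * z ^ n\<bar>)"
        using sm[of "\<bar>z\<bar>"] that b by (simp add: abs_mult power_abs)
    qed
  qed
  then show ?thesis by (simp add: diffs_def)
qed

lemma power_series_has_derivative:
  fixes P :: "nat \<Rightarrow> real^'n \<Rightarrow> real"
  assumes P: "\<And>k. hpoly_bd k (b k) (P k)"
    and sm: "\<And>t. 0 \<le> t \<Longrightarrow> t < \<rho> \<Longrightarrow> summable (\<lambda>k. b k * t ^ k)"
    and der: "\<And>k x. (P k has_derivative d k x) (at x)" "\<And>x v. d 0 x v = 0"
      "\<And>k v. hpoly_bd k (real (Suc k) * b (Suc k) * norm v) (\<lambda>x. d (Suc k) x v)"
    and x: "x \<in> ball 0 \<rho>"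
  shows "((\<lambda>x. \<Sum>k. P k x) has_derivative (\<lambda>v. \<Sum>k. d (Suc k) x v)) (at x)"
proof -
  \<comment> \<open>A radius strictly between |x| and \<rho> gives a single dominating series
    \<open>w\<close> for the derivatives on a whole neighbourhood of x.\<close>
  obtain t where t: "norm x < t" "t < \<rho>" using x dense[of "norm x" \<rho>] by auto
  have t0: "t > 0" using t(1) norm_ge_zero[of x] by linarith
  have b0: "b k \<ge> 0" for k by (rule hpoly_bd_nonneg[OF P])
  define w where "w = (\<lambda>i. real i * b i * t ^ (i - 1))"
  have "summable (\<lambda>n. w (Suc n))"
    using summable_termwise_derivative[of \<rho> b t] sm b0 t t0 by (simp add: w_def)
  then have w: "summable w" using summable_Suc_iff by blast
  have dw: "\<bar>d i y v\<bar> \<le> w i * norm v" if "y \<in> ball 0 t" for i y v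
  proof (cases i)
    case 0
    then show ?thesis by (simp add: der(2) w_def)
  next
    case (Suc k)
    have "\<bar>d i y v\<bar> \<le> real (Suc k) * b (Suc k) * norm v * norm y ^ k"
      using hpoly_bd_bound[OF der(3)[of k v], of y] Suc by simp
    also have "\<dots> \<le> real (Suc k) * b (Suc k) * norm v * t ^ k"
      using that b0 by (intro mult_left_mono power_mono) auto
    finally show ?thesis using Suc by (simp add: w_def mult_ac)
  qed
  have dsum: "summable (\<lambda>i. d i y v)" if "y \<in> ball 0 t" for y v
    by (rule summable_comparison_test'[OF summable_mult2[OF w, of "norm v"], of 0]) (use dw[OF that] in simp)
  have Psum: "summable (\<lambda>n. P n x)"
  proof (rule summable_comparison_test'[of "\<lambda>n. b n * norm x ^ n" 0])
    show "summable (\<lambda>n. b n * norm x ^ n)" using sm[of "norm x"] t by simp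
    show "norm (P n x) \<le> b n * norm x ^ n" for n using hpoly_bd_bound[OF P] by simp
  qed
  have "\<exists>g. \<forall>y\<in>ball 0 t. (\<lambda>n. P n y) sums g y \<and> (g has_derivative (\<lambda>v. \<Sum>i. d i y v)) (at y within ball 0 t)"
  proof (rule has_derivative_series[OF convex_ball])
    show "(P n has_derivative d n y) (at y within ball 0 t)" for n y
      using der(1) has_derivative_at_withinI by blast
    show "\<forall>\<^sub>F n in sequentially. \<forall>y\<in>ball 0 t. \<forall>v. norm ((\<Sum>i<n. d i y v) - (\<Sum>i. d i y v)) \<le> e * norm v"
      if e: "e > 0" for e
    proof -
      obtain N where N: "\<And>n. n \<ge> N \<Longrightarrow> norm (\<Sum>i. w (i + n)) < e" using suminf_exist_split[OF e w] by blast
      have "norm ((\<Sum>i<n. d i y v) - (\<Sum>i. d i y v)) \<le> e * norm v"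
        if n: "N \<le> n" and y: "y \<in> ball 0 t" for n y v
      proof -
        have ws: "summable (\<lambda>i. w (i + n))" by (rule summable_ignore_initial_segment[OF w])
        have "norm ((\<Sum>i<n. d i y v) - (\<Sum>i. d i y v)) = norm (\<Sum>i. d (i + n) y v)"
          using suminf_minus_initial_segment[OF dsum[OF y, of v], of n] by (simp add: norm_minus_commute)
        also have "\<dots> \<le> (\<Sum>i. w (i + n) * norm v)"
          by (rule norm_suminf_le) (use dw[OF y] ws in \<open>auto intro: summable_mult2\<close>)
        also have "\<dots> = (\<Sum>i. w (i + n)) * norm v" by (rule suminf_mult2[OF ws, symmetric])
        also have "\<dots> \<le> e * norm v" using N[OF n] by (intro mult_right_mono) auto
        finally show ?thesis .
      qed
      then show ?thesis unfolding eventually_sequentially by blast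
    qed
    show "x \<in> ball 0 t" using t by simp
    show "(\<lambda>n. P n x) sums (\<Sum>n. P n x)" using Psum by (rule summable_sums)
  qed
  then obtain g where g: "\<And>y. y \<in> ball 0 t \<Longrightarrow> (\<lambda>n. P n y) sums g y"
    "\<And>y. y \<in> ball 0 t \<Longrightarrow> (g has_derivative (\<lambda>v. \<Sum>i. d i y v)) (at y within ball 0 t)" by blast
  have xt: "x \<in> ball 0 t" using t by simp
  have "(g has_derivative (\<lambda>v. \<Sum>i. d i x v)) (at x)"
    using g(2)[OF xt] at_within_open[OF xt open_ball] by simp
  then have "((\<lambda>x. \<Sum>k. P k x) has_derivative (\<lambda>v. \<Sum>i. d i x v)) (at x)"
    by (rule has_derivative_transform_within_open[OF _ open_ball xt]) (simp add: g(1) sums_unique)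
  moreover have "(\<Sum>i. d i x v) = (\<Sum>k. d (Suc k) x v)" for v
    using suminf_split_head[OF dsum[OF xt, of v]] der(2) by simp
  ultimately show ?thesis by simp
qed

lemma hpoly_bd_sequence_derivative:
  assumes "\<And>k. hpoly_bd k (b k) (P k)"
  obtains d where "\<And>k x. (P k has_derivative d k x) (at x)" "\<And>x v. d 0 x v = 0"
    "\<And>k v. hpoly_bd k (real (Suc k) * b (Suc k) * norm v) (\<lambda>x. d (Suc k) x v)"
proof -
  have "\<forall>k. \<exists>d. (\<forall>x. (P k has_derivative d x) (at x)) \<and> (k = 0 \<longrightarrow> (\<forall>x v. d x v = 0)) \<and>
      (\<forall>k' v. k = Suc k' \<longrightarrow> hpoly_bd k' (real k * b k * norm v) (\<lambda>x. d x v))"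
    by (rule allI) (rule hpoly_bd_has_derivative[OF assms])
  from choice[OF this] obtain d where d: "\<forall>k. (\<forall>x. (P k has_derivative d k x) (at x)) \<and> (k = 0 \<longrightarrow> (\<forall>x v. d k x v = 0)) \<and>
      (\<forall>k' v. k = Suc k' \<longrightarrow> hpoly_bd k' (real k * b k * norm v) (\<lambda>x. d k x v))" ..
  show thesis
  proof (rule that[of d])
    show "(P k has_derivative d k x) (at x)" for k x using d[rule_format, of k] by (elim conjE) (erule spec)
    show "d 0 x v = 0" for x v using d[rule_format, of 0] by simp
    show "hpoly_bd k (real (Suc k) * b (Suc k) * norm v) (\<lambda>x. d (Suc k) x v)" for k v
      using d[rule_format, of "Suc k"] by (simp del: of_nat_Suc)
  qed
qed

text \<open>The derivative in direction v is a series of the same kind, with majorant coefficients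
  (k + 1) b_(k+1) |v| and the same radius, so the induction closes once \<open>P\<close> and
  \<open>b\<close> are generalised.\<close>

lemma power_series_smooth:
  fixes P :: "nat \<Rightarrow> real^'n \<Rightarrow> real"
  assumes "\<And>k. hpoly_bd k (b k) (P k)"
    and "\<And>t. 0 \<le> t \<Longrightarrow> t < \<rho> \<Longrightarrow> summable (\<lambda>k. b k * t ^ k)"
  shows "smooth_on (ball 0 \<rho>) (\<lambda>x. \<Sum>k. P k x)"
  unfolding smooth_on_def
proof
  fix n
  show "higher_differentiable_on (ball 0 \<rho>) (\<lambda>x. \<Sum>k. P k x) n"
    using assms
  proof (induction n arbitrary: P b)
    case (0 P b)
    obtain d where d: "\<And>k x. (P k has_derivative d k x) (at x)" "\<And>x v. d 0 x v = 0"
      "\<And>k v. hpoly_bd k (real (Suc k) * b (Suc k) * norm v) (\<lambda>x. d (Suc k) x v)"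
      by (rule hpoly_bd_sequence_derivative[of b P]) (use 0(1) in auto)
    show ?case by (rule higher_differentiable_on_0I[OF power_series_has_derivative[OF 0 d]])
  next
    case (Suc n P b)
    obtain d where d: "\<And>k x. (P k has_derivative d k x) (at x)" "\<And>x v. d 0 x v = 0"
      "\<And>k v. hpoly_bd k (real (Suc k) * b (Suc k) * norm v) (\<lambda>x. d (Suc k) x v)"
      by (rule hpoly_bd_sequence_derivative[of b P]) (use Suc.prems(1) in auto)
    show ?case
    proof (rule higher_differentiable_on_SucI[OF open_ball power_series_has_derivative[OF Suc.prems d]])
      fix v
      show "higher_differentiable_on (ball 0 \<rho>) (\<lambda>x. \<Sum>k. d (Suc k) x v) n"
      proof (rule Suc.IH[OF d(3)])
        fix t :: real assume "0 \<le> t" "t < \<rho>"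
        then have "summable (\<lambda>k. real (Suc k) * b (Suc k) * t ^ k * norm v)"
          by (intro summable_mult2 summable_termwise_derivative[OF Suc.prems(2) hpoly_bd_nonneg[OF Suc.prems(1)]])
        then show "summable (\<lambda>k. real (Suc k) * b (Suc k) * norm v * t ^ k)" by (simp add: mult_ac)
      qed
    qed
  qed
qed

section \<open>From multi-index series to series of homogeneous polynomials\<close>

lemma finite_mdeg_eq: "finite {a :: 'n::finite \<Rightarrow> nat. mdeg a = k}"
proof (rule finite_subset)
  show "{a :: 'n \<Rightarrow> nat. mdeg a = k} \<subseteq> PiE UNIV (\<lambda>_. {..k})"
    by (auto simp: mdeg_def intro!: member_le_sum)
qed (intro finite_PiE, auto)

text \<open>The finite sets of multi-indices of degree below n eventually contain every finite set,
  so the partial sums by degree are a subfamily of the net that defines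
  \<open>has_sum\<close>.\<close>

lemma has_sum_by_degree:
  fixes g :: "('n::finite \<Rightarrow> nat) \<Rightarrow> real"
  assumes "(g has_sum s) UNIV"
  shows "(\<lambda>k. \<Sum>a | mdeg a = k. g a) sums s"
proof -
  have fin: "finite {a :: 'n \<Rightarrow> nat. mdeg a < n}" for n
  proof -
    have "{a :: 'n \<Rightarrow> nat. mdeg a < n} = (\<Union>k<n. {a. mdeg a = k})" by auto
    then show ?thesis using finite_mdeg_eq by auto
  qed
  have eq: "(\<Sum>k<n. \<Sum>a | mdeg a = k. g a) = sum g {a. mdeg a < n}" for n
  proof -
    have "(\<Sum>k<n. \<Sum>a | mdeg a = k. g a) = (\<Sum>k<n. \<Sum>a | a \<in> {a. mdeg a < n} \<and> mdeg a = k. g a)"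
      by (intro sum.cong HOL.refl) auto
    also have "\<dots> = sum g {a. mdeg a < n}" by (rule sum.group) (auto simp: fin)
    finally show ?thesis .
  qed
  have lim: "filterlim (\<lambda>n. {a :: 'n \<Rightarrow> nat. mdeg a < n}) (finite_subsets_at_top UNIV) sequentially"
    unfolding filterlim_finite_subsets_at_top
  proof (intro allI impI)
    fix X :: "('n \<Rightarrow> nat) set" assume "finite X \<and> X \<subseteq> UNIV"
    then have X: "finite (mdeg ` X)" by simp
    have sub: "X \<subseteq> {a. mdeg a < n}" if "n > Max (mdeg ` X)" for n
    proof
      fix a assume "a \<in> X"
      then have "mdeg a \<le> Max (mdeg ` X)" by (intro Max_ge X) simp
      with that show "a \<in> {a. mdeg a < n}" by simp
    qed
    show "\<forall>\<^sub>F n in sequentially. finite {a :: 'n \<Rightarrow> nat. mdeg a < n} \<and> X \<subseteq> {a. mdeg a < n} \<and> {a :: 'n \<Rightarrow> nat. mdeg a < n} \<subseteq> UNIV"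
      by (rule eventually_mono[OF eventually_gt_at_top[of "Max (mdeg ` X)"]]) (simp add: fin sub)
  qed
  have "(sum g \<longlongrightarrow> s) (finite_subsets_at_top UNIV)" using assms by (simp add: has_sum_def)
  from filterlim_compose[OF this lim] show ?thesis by (simp add: sums_def eq)
qed

lemma real_analytic_power_series:
  fixes f :: "real^'n \<Rightarrow> real"
  assumes "real_analytic_on S f" "0 \<in> S"
  obtains \<rho> P b where "\<rho> > 0" "\<And>k. hpoly_bd k (b k) (P k)"
    "\<And>t. 0 \<le> t \<Longrightarrow> t < \<rho> \<Longrightarrow> summable (\<lambda>k. b k * t ^ k)"
    "\<And>x. x \<in> ball 0 \<rho> \<Longrightarrow> (\<lambda>k. P k x) sums f x"
proof -
  obtain \<delta> c where \<delta>: "\<delta> > 0" and c: "\<And>y. y \<in> ball 0 \<delta> \<Longrightarrow> (\<lambda>k. \<bar>pow_term c 0 y k\<bar>) summable_on UNIV"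
    "\<And>y. y \<in> ball 0 \<delta> \<Longrightarrow> (pow_term c 0 y has_sum f y) UNIV"
    using assms unfolding real_analytic_on_def by blast
  define P where "P = (\<lambda>k (x :: real^'n). \<Sum>a | mdeg a = k. c a * list_mono (count_choice a) x)"
  define b where "b = (\<lambda>k. \<Sum>a | mdeg a = k. \<bar>c a\<bar>)"
  \<comment> \<open>The majorant at radius t is the absolute series at the diagonal point (t, ...,
    t), whose norm is at most its l1 norm d t. Dividing by the dimension keeps that point inside the
    ball of radius \<delta>.\<close>
  let ?\<rho> = "\<delta> / real CARD('n)"
  have pt: "pow_term c 0 y a = c a * list_mono (count_choice a) y" for y a
    by (simp add: pow_term_def list_mono_count_choice)
  show thesis
  proof (rule that[of ?\<rho> b P])
    show "?\<rho> > 0" using \<delta> by simp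
    show "hpoly_bd k (b k) (P k)" for k
      unfolding P_def b_def
    proof (rule hpoly_bd_sum)
      fix a :: "'n \<Rightarrow> nat" assume "a \<in> {a. mdeg a = k}"
      then show "hpoly_bd k \<bar>c a\<bar> (\<lambda>x. c a * list_mono (count_choice a) x)"
        using hpoly_bd_cmult[OF hpoly_bd_list_mono[of "count_choice a"], of "c a"] by (simp add: length_count_choice)
    qed
    show "(\<lambda>k. P k x) sums f x" if "x \<in> ball 0 ?\<rho>" for x
    proof -
      have "?\<rho> \<le> \<delta>" using \<delta> by (simp add: field_simps)
      then have "x \<in> ball 0 \<delta>" using that by simp
      from has_sum_by_degree[OF c(2)[OF this]] show ?thesis by (simp add: pt P_def)
    qed
    fix t :: real assume t: "0 \<le> t" "t < ?\<rho>"
    let ?y = "(\<chi> i. t) :: real^'n"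
    have "norm ?y \<le> (\<Sum>i\<in>UNIV. \<bar>?y $ i\<bar>)" by (rule norm_le_l1_cart)
    also have "\<dots> < \<delta>" using t by (simp add: field_simps)
    finally have "(\<lambda>a. \<bar>pow_term c 0 ?y a\<bar>) summable_on UNIV" by (intro c(1)) simp
    then obtain s where s: "((\<lambda>a. \<bar>pow_term c 0 ?y a\<bar>) has_sum s) UNIV" by (auto simp: summable_on_def)
    have "\<bar>pow_term c 0 ?y a\<bar> = \<bar>c a\<bar> * t ^ mdeg a" for a
      using t(1) by (simp add: pow_term_def abs_mult mdeg_def power_sum abs_prod)
    then have "(\<lambda>k. b k * t ^ k) sums s"
      using has_sum_by_degree[OF s] by (simp add: b_def sum_distrib_right)
    then show "summable (\<lambda>k. b k * t ^ k)" by (rule sums_summable)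
  qed
qed

text \<open>Uniqueness of asymptotic coefficients: once the lower ones vanish, divide by r^k and let
  r tend to 0 from the right. The right-hand side keeps a positive power of r because k \<le>
  s.\<close>

lemma small_polynomial_coeffs_eq_0:
  fixes e :: "nat \<Rightarrow> real"
  assumes \<delta>: "\<delta> > 0" and bound: "\<And>r. 0 < r \<Longrightarrow> r < \<delta> \<Longrightarrow> \<bar>\<Sum>k\<le>s. e k * r ^ k\<bar> \<le> K * r ^ Suc s"
  shows "k \<le> s \<Longrightarrow> e k = 0"
proof (induction k rule: less_induct)
  case (less k)
  have eq: "(\<Sum>j\<le>s. e j * r ^ j) = r ^ k * (\<Sum>j\<in>{k..s}. e j * r ^ (j - k))" for r
  proof -
    have "(\<Sum>j\<le>s. e j * r ^ j) = (\<Sum>j\<in>{k..s}. e j * r ^ j)"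
      by (rule sum.mono_neutral_right) (use less in auto)
    also have "\<dots> = (\<Sum>j\<in>{k..s}. r ^ k * (e j * r ^ (j - k)))"
    proof (rule sum.cong)
      fix j assume "j \<in> {k..s}"
      then have "r ^ j = r ^ k * r ^ (j - k)" by (simp add: power_add[symmetric])
      then show "e j * r ^ j = r ^ k * (e j * r ^ (j - k))" by simp
    qed simp
    finally show ?thesis by (simp add: sum_distrib_left)
  qed
  have "((\<lambda>r. \<Sum>j\<in>{k..s}. e j * r ^ (j - k)) \<longlongrightarrow> (\<Sum>j\<in>{k..s}. e j * 0 ^ (j - k))) (at_right 0)"
    by (intro tendsto_intros)
  also have "(\<Sum>j\<in>{k..s}. e j * 0 ^ (j - k)) = (\<Sum>j\<in>{k..s}. if j = k then e j else 0)"
    by (rule sum.cong) auto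
  also have "\<dots> = e k" using less.prems by simp
  finally have lim: "((\<lambda>r. \<Sum>j\<in>{k..s}. e j * r ^ (j - k)) \<longlongrightarrow> e k) (at_right 0)" .
  have lim0: "((\<lambda>r::real. K * r ^ (Suc s - k)) \<longlongrightarrow> K * 0 ^ (Suc s - k)) (at_right 0)"
    by (intro tendsto_intros)
  have "\<forall>\<^sub>F r in at_right 0. 0 < r \<and> r < \<delta>"
    using \<delta> eventually_at_right_less[of 0] eventually_at_right_field by (auto simp: eventually_at_right_field intro!: exI[of _ \<delta>])
  then have "\<forall>\<^sub>F r in at_right 0. \<bar>\<Sum>j\<in>{k..s}. e j * r ^ (j - k)\<bar> \<le> K * r ^ (Suc s - k)"
  proof eventually_elim
    case (elim r)
    have "r ^ k * \<bar>\<Sum>j\<in>{k..s}. e j * r ^ (j - k)\<bar> \<le> K * r ^ Suc s"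
      using bound[of r] elim unfolding eq by (simp add: abs_mult)
    also have "K * r ^ Suc s = r ^ k * (K * r ^ (Suc s - k))"
      using less.prems power_add[of r k "Suc s - k"] by simp
    finally show ?case using elim by (simp add: mult_le_cancel_left_pos)
  qed
  then have "\<bar>e k\<bar> \<le> K * 0 ^ (Suc s - k)"
    by (rule tendsto_le[OF _ lim0 tendsto_rabs[OF lim], rotated]) simp
  then show ?case using less.prems by (simp add: power_0_left split: if_splits)
qed

context dunkl_setting
begin

theorem harmonic_mean_power_series:
  fixes f :: "real^'n \<Rightarrow> real"
  assumes f: "real_analytic_on (ball 0 1) f" and A: "\<forall>a\<in>A. mdeg a = m"
    and harm: "Lap (mpoly_fun A c) = (\<lambda>_. 0)"
  shows "\<exists>\<rho>. 0 < \<rho> \<and> \<rho> < 1 \<and> (\<forall>r. 0 < r \<and> r < \<rho> \<longrightarrow>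
    (\<lambda>n. mpoly_dunkl Rp \<kappa> A c ((Lap ^^ n) f) 0 /
        (fact n * pochhammer (lambda_k Rp \<kappa> + 1) (m + n)) * (r / 2) ^ (m + 2 * n))
    sums (sint (\<lambda>y. mpoly_fun A c y * f (r *\<^sub>R y)) / sint (\<lambda>_. 1)))"
proof -
  obtain \<rho> P b where \<rho>: "\<rho> > 0" and P: "\<And>k. hpoly_bd k (b k) (P k)"
    and sm: "\<And>t. 0 \<le> t \<Longrightarrow> t < \<rho> \<Longrightarrow> summable (\<lambda>k. b k * t ^ k)"
    and fP: "\<And>x. x \<in> ball 0 \<rho> \<Longrightarrow> (\<lambda>k. P k x) sums f x"
    by (rule real_analytic_power_series[OF f]) auto
  have b0: "b k \<ge> 0" for k by (rule hpoly_bd_nonneg[OF P])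
  have f_smooth: "smooth_on (ball 0 \<rho>) f"
    by (rule smooth_on_cong[OF open_ball _ power_series_smooth[OF P sm]]) (rule sums_unique[OF fP, symmetric])
  define q where "q = (mpoly_fun A c :: real^'n \<Rightarrow> real)"
  define \<omega> where "\<omega> = sint (\<lambda>_. 1)"
  have \<omega>: "\<omega> > 0" using sint_1_pos by (simp add: \<omega>_def)
  define F where "F = (\<lambda>r. sint (\<lambda>y. q y * f (r *\<^sub>R y)) / \<omega>)"
  define \<alpha> where "\<alpha> = (\<lambda>k. sint (\<lambda>y. q y * P k y) / \<omega>)"
  have qc: "continuous_on (sphere 0 1) q"
    unfolding q_def by (rule hpoly_continuous_sphere[OF hpoly_mpoly_fun[OF A]])
  have Pc: "continuous_on (sphere 0 1) (P k)" for k
    by (rule hpoly_continuous_sphere[OF hpoly_bd_imp_hpoly[OF P]])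
  have "bounded ((\<lambda>y. q y * wt y) ` sphere 0 1)"
    by (intro compact_imp_bounded compact_continuous_image continuous_on_mult qc continuous_on_wt compact_sphere)
  then obtain Q where "\<forall>z\<in>(\<lambda>y. q y * wt y) ` sphere 0 1. norm z \<le> Q" unfolding bounded_iff by blast
  then have Q: "\<bar>q y * wt y\<bar> \<le> Q" if "norm y = 1" for y using that by simp
  have Q0: "Q \<ge> 0" using Q[of "axis undefined 1"] by simp
  define W where "W = Q * (real CARD('n) * measure lborel (ball 0 1 :: (real^'n) set)) / \<omega>"
  have W0: "W \<ge> 0" using Q0 \<omega> by (simp add: W_def)
  define \<tau> where "\<tau> = (\<lambda>n r. \<Sum>i. b (i + n) * r ^ (i + n))"
  \<comment> \<open>Instead of interchanging the integral with the infinite sum, the finite part is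
    integrated by linearity and the rest is bounded uniformly on the sphere by the tail of the
    majorant. The same estimate yields convergence and the asymptotic bound.\<close>
  have tail: "\<bar>F r - (\<Sum>k<n. \<alpha> k * r ^ k)\<bar> \<le> W * \<tau> n r" if r: "0 < r" "r < \<rho>" for r n
  proof -
    have rS: "r *\<^sub>R y \<in> ball 0 \<rho>" if "norm y = 1" for y :: "real^'n" using that r by simp
    let ?h = "\<lambda>y. f (r *\<^sub>R y) - (\<Sum>k<n. r ^ k * P k y)"
    have fc: "continuous_on (sphere 0 1) (\<lambda>y. f (r *\<^sub>R y))"
      by (rule continuous_on_compose2[OF smooth_on_continuous[OF f_smooth]]) (use rS in \<open>auto intro!: continuous_intros\<close>)
    have hc: "continuous_on (sphere 0 1) (\<lambda>y. q y * ?h y)"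
      by (intro continuous_on_mult qc continuous_on_diff fc continuous_on_sum continuous_on_const Pc)
    have pc: "continuous_on (sphere 0 1) (\<lambda>y. r ^ k * (q y * P k y))" for k
      by (intro continuous_on_mult continuous_on_const qc Pc)
    have "sint (\<lambda>y. q y * f (r *\<^sub>R y)) = sint (\<lambda>y. (\<Sum>k<n. r ^ k * (q y * P k y)) + q y * ?h y)"
      by (rule arg_cong[of _ _ sint]) (auto simp: algebra_simps sum_distrib_left)
    also have "\<dots> = sint (\<lambda>y. \<Sum>k<n. r ^ k * (q y * P k y)) + sint (\<lambda>y. q y * ?h y)"
      by (rule sint_add[OF _ hc]) (intro continuous_on_sum pc)
    also have "sint (\<lambda>y. \<Sum>k<n. r ^ k * (q y * P k y)) = (\<Sum>k<n. sint (\<lambda>y. r ^ k * (q y * P k y)))"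
      by (rule sint_sum[OF pc])
    also have "\<dots> = (\<Sum>k<n. r ^ k * sint (\<lambda>y. q y * P k y))" by (simp only: sint_cmult)
    finally have "F r - (\<Sum>k<n. \<alpha> k * r ^ k) = sint (\<lambda>y. q y * ?h y) / \<omega>"
      by (simp add: F_def \<alpha>_def add_divide_distrib sum_divide_distrib mult_ac)
    moreover have "\<bar>sint (\<lambda>y. q y * ?h y)\<bar> \<le> (Q * \<tau> n r) * (real CARD('n) * measure lborel (ball 0 1 :: (real^'n) set))"
      unfolding sint_def
    proof (rule sphere_integral_bound[OF _ sphere_integrable_wt[OF hc]])
      fix y :: "real^'n" assume y: "norm y = 1"
      have hom: "P k (r *\<^sub>R y) = r ^ k * P k y" for k by (rule hpoly_homogeneous[OF hpoly_bd_imp_hpoly[OF P]])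
      have s: "summable (\<lambda>k. P k (r *\<^sub>R y))" "(\<Sum>k. P k (r *\<^sub>R y)) = f (r *\<^sub>R y)"
        using fP[OF rS[OF y]] by (auto simp: sums_iff)
      have "?h y = (\<Sum>i. P (i + n) (r *\<^sub>R y))"
        using suminf_minus_initial_segment[OF s(1), of n] s(2) by (simp add: hom)
      also have "\<bar>\<dots>\<bar> \<le> \<tau> n r"
        unfolding \<tau>_def real_norm_def[symmetric]
      proof (rule norm_suminf_le)
        show "norm (P (i + n) (r *\<^sub>R y)) \<le> b (i + n) * r ^ (i + n)" for i
          using hpoly_bd_bound[OF P, of "i + n" "r *\<^sub>R y"] y r by simp
        show "summable (\<lambda>i. b (i + n) * r ^ (i + n))"
          by (rule summable_ignore_initial_segment[OF sm]) (use r in auto)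
      qed
      finally have "\<bar>q y * wt y\<bar> * \<bar>?h y\<bar> \<le> Q * \<tau> n r"
        using Q[OF y] Q0 by (intro mult_mono) auto
      then show "\<bar>q y * ?h y * wt y\<bar> \<le> Q * \<tau> n r" by (simp add: abs_mult mult_ac)
    qed
    ultimately show ?thesis using \<omega> by (simp add: W_def divide_right_mono mult_ac)
  qed
  have F_sums: "(\<lambda>k. \<alpha> k * r ^ k) sums F r" if r: "0 < r" "r < \<rho>" for r
  proof -
    have "(\<lambda>n. \<tau> n r) \<longlonglongrightarrow> 0"
      unfolding \<tau>_def
      by (rule LIMSEQ_I) (use suminf_exist_split[OF _ sm[of r]] r in auto)
    then have "(\<lambda>n. W * \<tau> n r) \<longlonglongrightarrow> 0" by (rule tendsto_mult_right_zero)
    then have "(\<lambda>n. (\<Sum>k<n. \<alpha> k * r ^ k) - F r) \<longlonglongrightarrow> 0"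
      by (rule Lim_null_comparison[rotated]) (use tail[OF r] in \<open>simp add: abs_minus_commute\<close>)
    then show ?thesis unfolding sums_def using LIM_zero_iff[of "\<lambda>n. \<Sum>k<n. \<alpha> k * r ^ k" "F r"] by simp
  qed
  define a where "a = (\<lambda>n. mpoly_dunkl Rp \<kappa> A c ((Lap ^^ n) f) 0 /
        (fact n * pochhammer (lambda_k Rp \<kappa> + 1) (m + n)) / 2 ^ (m + 2 * n))"
  define B where "B = (\<lambda>k. if k \<in> range (\<lambda>n. m + 2 * n) then a ((k - m) div 2) else 0)"
  have B_a: "B (m + 2 * n) = a n" for n by (auto simp: B_def)
  have coeff: "\<alpha> k = B k" for k
  proof -
    \<comment> \<open>The asymptotic comparison determines coefficients up to the order where it is
      cut. Taking \<open>k\<close> as the last index of the expansion cuts it at m + 2k, which is at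
      least \<open>k\<close>.\<close>
    define s where "s = m + 2 * k"
    obtain K \<delta> where \<delta>: "\<delta> > 0" and K: "K \<ge> 0"
      and expn: "\<And>r. 0 < r \<Longrightarrow> r < \<delta> \<Longrightarrow> \<bar>F r - (\<Sum>n\<le>k. mpoly_dunkl Rp \<kappa> A c ((Lap ^^ n) f) 0 /
          (fact n * pochhammer (lambda_k Rp \<kappa> + 1) (m + n)) * (r / 2) ^ (m + 2 * n))\<bar> \<le> K * r ^ (m + 2 * k + 1)"
      using harmonic_mean_expansion[OF \<rho> f_smooth A harm, of k] unfolding F_def q_def \<omega>_def by blast
    have B_sum: "(\<Sum>n\<le>k. mpoly_dunkl Rp \<kappa> A c ((Lap ^^ n) f) 0 /
          (fact n * pochhammer (lambda_k Rp \<kappa> + 1) (m + n)) * (r / 2) ^ (m + 2 * n)) = (\<Sum>j\<le>s. B j * r ^ j)" for r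
    proof -
      have "(\<Sum>j\<le>s. B j * r ^ j) = (\<Sum>j\<in>(\<lambda>n. m + 2 * n) ` {..k}. B j * r ^ j)"
        by (rule sum.mono_neutral_right) (auto simp: s_def B_def)
      also have "\<dots> = (\<Sum>n\<le>k. a n * r ^ (m + 2 * n))"
        by (subst sum.reindex) (auto simp: inj_on_def B_a)
      finally show ?thesis by (simp add: a_def power_divide)
    qed
    \<comment> \<open>At a fixed radius inside the ball of convergence the tail with r0^(s+1)
      removed sums to a constant \<open>T\<close>; for smaller r the tail is then at most T
      r^(s+1).\<close>
    define r0 where "r0 = \<rho> / 2"
    have r0: "0 < r0" "r0 < \<rho>" using \<rho> by (simp_all add: r0_def)
    define T where "T = (\<Sum>i. b (i + Suc s) * r0 ^ i)"
    have sT: "summable (\<lambda>i. b (i + Suc s) * r0 ^ i)"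
    proof -
      have "summable (\<lambda>i. b (i + Suc s) * r0 ^ (i + Suc s))"
        by (rule summable_ignore_initial_segment[OF sm]) (use r0 in auto)
      then have "summable (\<lambda>i. b (i + Suc s) * r0 ^ (i + Suc s) * inverse (r0 ^ Suc s))" by (rule summable_mult2)
      then show ?thesis using r0 by (simp add: power_add field_simps)
    qed
    have \<tau>_T: "\<tau> (Suc s) r \<le> T * r ^ Suc s" if r: "0 < r" "r < r0" for r
    proof -
      have "\<tau> (Suc s) r \<le> (\<Sum>i. b (i + Suc s) * r0 ^ i * r ^ Suc s)"
        unfolding \<tau>_def
      proof (rule suminf_le)
        show "b (i + Suc s) * r ^ (i + Suc s) \<le> b (i + Suc s) * r0 ^ i * r ^ Suc s" for i
          using r b0 power_mono[of r r0 i] unfolding power_add by (simp add: mult.assoc mult_left_mono mult_right_mono)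
        show "summable (\<lambda>i. b (i + Suc s) * r ^ (i + Suc s))"
          by (rule summable_ignore_initial_segment[OF sm]) (use r r0 in auto)
        show "summable (\<lambda>i. b (i + Suc s) * r0 ^ i * r ^ Suc s)" by (rule summable_mult2[OF sT])
      qed
      also have "\<dots> = T * r ^ Suc s" unfolding T_def by (rule suminf_mult2[OF sT, symmetric])
      finally show ?thesis .
    qed
    have "\<alpha> k - B k = 0"
    proof (rule small_polynomial_coeffs_eq_0[where s=s and e="\<lambda>k. \<alpha> k - B k" and \<delta>="min \<delta> r0" and K="W * T + K"])
      show "min \<delta> r0 > 0" using \<delta> r0 by simp
      show "k \<le> s" by (simp add: s_def)
      fix r assume r: "0 < r" "r < min \<delta> r0"
      have "\<bar>F r - (\<Sum>j\<le>s. \<alpha> j * r ^ j)\<bar> \<le> W * \<tau> (Suc s) r"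
        using tail[of r "Suc s"] r r0 by (simp add: lessThan_Suc_atMost)
      also have "\<dots> \<le> W * (T * r ^ Suc s)" using \<tau>_T[of r] r W0 by (intro mult_left_mono) auto
      finally have "\<bar>F r - (\<Sum>j\<le>s. \<alpha> j * r ^ j)\<bar> \<le> W * (T * r ^ Suc s)" .
      moreover have "\<bar>F r - (\<Sum>j\<le>s. B j * r ^ j)\<bar> \<le> K * r ^ Suc s"
        using expn[of r] r unfolding B_sum by (simp add: s_def)
      moreover have "(\<Sum>j\<le>s. (\<alpha> j - B j) * r ^ j) = (\<Sum>j\<le>s. \<alpha> j * r ^ j) - (\<Sum>j\<le>s. B j * r ^ j)"
        by (simp add: left_diff_distrib sum_subtractf)
      ultimately have "\<bar>\<Sum>j\<le>s. (\<alpha> j - B j) * r ^ j\<bar> \<le> W * (T * r ^ Suc s) + K * r ^ Suc s" by linarith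
      then show "\<bar>\<Sum>j\<le>s. (\<alpha> j - B j) * r ^ j\<bar> \<le> (W * T + K) * r ^ Suc s" by (simp add: distrib_right mult.assoc)
    qed
    then show ?thesis by simp
  qed
  show ?thesis
  \<comment> \<open>The radius found for the series may be 1 or more, whereas the claim asks for one
    below 1; hence the cap 1/2.\<close>
  proof (rule exI[of _ "min \<rho> (1 / 2)"], intro conjI allI impI)
    show "0 < min \<rho> (1 / 2)" "min \<rho> (1 / 2) < 1" using \<rho> by simp_all
    fix r assume r: "0 < r \<and> r < min \<rho> (1 / 2)"
    have "(\<lambda>k. B k * r ^ k) sums F r" using F_sums[of r] r by (simp add: coeff)
    moreover have "strict_mono (\<lambda>n. m + 2 * n)" by (simp add: strict_mono_def)
    moreover have "B k * r ^ k = 0" if "k \<notin> range (\<lambda>n. m + 2 * n)" for k using that by (simp add: B_def)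
    ultimately have "(\<lambda>n. B (m + 2 * n) * r ^ (m + 2 * n)) sums F r"
      using sums_mono_reindex[of "\<lambda>n. m + 2 * n" "\<lambda>k. B k * r ^ k"] by simp
    then show "(\<lambda>n. mpoly_dunkl Rp \<kappa> A c ((Lap ^^ n) f) 0 /
        (fact n * pochhammer (lambda_k Rp \<kappa> + 1) (m + n)) * (r / 2) ^ (m + 2 * n))
      sums (sint (\<lambda>y. mpoly_fun A c y * f (r *\<^sub>R y)) / sint (\<lambda>_. 1))"
      by (simp add: B_a a_def F_def q_def \<omega>_def power_divide)
  qed
qed

end

theorem theorem3p2:
  fixes R Rp :: "(real^'n) set" and \<kappa> :: "real^'n \<Rightarrow> real"
    and m :: nat and A :: "('n \<Rightarrow> nat) set" and c :: "('n \<Rightarrow> nat) \<Rightarrow> real"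
  assumes R: "reduced_root_system R"
    and Rp: "positive_system R Rp"
    and \<kappa>: "multiplicity_fn R \<kappa>"
    and A: "finite A" "\<forall>a\<in>A. mdeg a = m"
    and harm: "\<forall>x. dunkl_lap Rp \<kappa> (mpoly_fun A c) x = 0"
  shows
   "(\<forall>(f :: real^'n \<Rightarrow> real) \<epsilon> N. \<epsilon> > 0 \<longrightarrow> smooth_on (ball 0 \<epsilon>) f \<longrightarrow>
      (\<lambda>r. sphere_integral (\<lambda>y. mpoly_fun A c y * f (r *\<^sub>R y) * (hk Rp \<kappa> y)\<^sup>2)
              / sphere_integral (\<lambda>y. (hk Rp \<kappa> y)\<^sup>2)
           - (\<Sum>n\<le>N. mpoly_dunkl Rp \<kappa> A c ((dunkl_lap Rp \<kappa> ^^ n) f) 0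
                 / (fact n * pochhammer (lambda_k Rp \<kappa> + 1) (m + n)) * (r / 2) ^ (m + 2 * n)))
      \<in> o[at_right 0](\<lambda>r. r ^ (m + 2 * N)))
  \<and>
   (\<forall>f :: real^'n \<Rightarrow> real. real_analytic_on (ball 0 1) f \<longrightarrow>
      (\<exists>\<rho>. 0 < \<rho> \<and> \<rho> < 1 \<and> (\<forall>r. 0 < r \<and> r < \<rho> \<longrightarrow>
         (\<lambda>n. mpoly_dunkl Rp \<kappa> A c ((dunkl_lap Rp \<kappa> ^^ n) f) 0
                 / (fact n * pochhammer (lambda_k Rp \<kappa> + 1) (m + n)) * (r / 2) ^ (m + 2 * n))
         sums (sphere_integral (\<lambda>y. mpoly_fun A c y * f (r *\<^sub>R y) * (hk Rp \<kappa> y)\<^sup>2)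
               / sphere_integral (\<lambda>y. (hk Rp \<kappa> y)\<^sup>2)))))"
proof -
  interpret dunkl_setting R Rp \<kappa> by unfold_locales (rule R Rp \<kappa>)+
  have harm': "dunkl_lap Rp \<kappa> (mpoly_fun A c) = (\<lambda>_. 0)" using harm by blast
  show ?thesis
    unfolding sphere_integral_eq_sint
  proof (intro conjI allI impI)
    fix f :: "real^'n \<Rightarrow> real" and \<epsilon> :: real and N
    assume \<epsilon>: "\<epsilon> > 0" and f: "smooth_on (ball 0 \<epsilon>) f"
    let ?E = "\<lambda>r. sint (\<lambda>y. mpoly_fun A c y * f (r *\<^sub>R y)) / sint (\<lambda>_. 1)
       - (\<Sum>n\<le>N. mpoly_dunkl Rp \<kappa> A c ((dunkl_lap Rp \<kappa> ^^ n) f) 0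
             / (fact n * pochhammer (lambda_k Rp \<kappa> + 1) (m + n)) * (r / 2) ^ (m + 2 * n))"
    obtain K \<delta> where \<delta>: "\<delta> > 0" and K: "K \<ge> 0"
      and bound: "\<And>r. 0 < r \<Longrightarrow> r < \<delta> \<Longrightarrow> \<bar>?E r\<bar> \<le> K * r ^ (m + 2 * N + 1)"
      using harmonic_mean_expansion[OF \<epsilon> f A(2) harm', of N] by blast
    show "?E \<in> o[at_right 0](\<lambda>r. r ^ (m + 2 * N))"
    proof (rule landau_o.smallI)
      fix e :: real assume e: "e > 0"
      \<comment> \<open>The spare power of r is traded for the factor e; K + 1 in the denominator is
        positive also when K = 0.\<close>
      have "\<forall>\<^sub>F r in at_right 0. 0 < r \<and> r < min \<delta> (e / (K + 1))"
        using \<delta> e K by (auto simp: eventually_at_right_field intro!: exI[of _ "min \<delta> (e / (K + 1))"])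
      then show "\<forall>\<^sub>F r in at_right 0. norm (?E r) \<le> e * norm (r ^ (m + 2 * N))"
      proof eventually_elim
        case (elim r)
        then have "(K + 1) * r < e" using K by (simp add: field_simps)
        with elim have "K * r \<le> e" by (simp add: algebra_simps)
        then have "K * r * r ^ (m + 2 * N) \<le> e * r ^ (m + 2 * N)" using elim by (intro mult_right_mono) auto
        moreover have "K * r ^ (m + 2 * N + 1) = K * r * r ^ (m + 2 * N)" by simp
        moreover have "\<bar>?E r\<bar> \<le> K * r ^ (m + 2 * N + 1)" using elim by (intro bound) auto
        ultimately have "\<bar>?E r\<bar> \<le> e * r ^ (m + 2 * N)" by linarith
        then show ?case using elim by (simp only: real_norm_def) simp
      qed
    qed
  next
    fix f :: "real^'n \<Rightarrow> real"
    assume "real_analytic_on (ball 0 1) f"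
    then show "\<exists>\<rho>. 0 < \<rho> \<and> \<rho> < 1 \<and> (\<forall>r. 0 < r \<and> r < \<rho> \<longrightarrow>
         (\<lambda>n. mpoly_dunkl Rp \<kappa> A c ((dunkl_lap Rp \<kappa> ^^ n) f) 0
                 / (fact n * pochhammer (lambda_k Rp \<kappa> + 1) (m + n)) * (r / 2) ^ (m + 2 * n))
         sums (sint (\<lambda>y. mpoly_fun A c y * f (r *\<^sub>R y)) / sint (\<lambda>_. 1)))"
      by (rule harmonic_mean_power_series[OF _ A(2) harm'])
  qed
qed

end
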